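(* Let $F/K$ be a finite field extension (of arbitrary characteristic) and let $L/K$ be its normal closure. Put $E(L/K)=\mathrm{End}_K(L)$ and $$\mathcal{A}(E(L/K),L,F)=\{A\in \mathcal{A}(E(L/K),L)\mid C_{E(L/K)}(F)\subseteq A\}.$$ Then: (1) $\mathcal{A}(E(L/K),L,F)=\{C_{E(L/K)}(M)=\mathcal{D}(L/M)\rtimes G(L/M)=\mathcal{D}(L/K)^M\rtimes G(L/K)^M \mid M\in \mathcal{F}(F/K)\}$. (2) (Analogue of the Galois correspondence for subfields.) The map $$\mathcal{F}(F/K)\to \mathcal{A}(E(L/K),L,F),\quad M\mapsto C_{E(L/K)}(M)=\mathcal{D}(L/M)\rtimes G(L/M)=\mathcal{D}(L/K)^M\rtimes G(L/K)^M$$ is a bijection. Its inverse is $$A\mapsto C_{E(L/K)}(A)=C_L(A\cap \mathcal{D}(L/K)_+)\cap L^{A\cap G(L/K)}=\big(C_L(A\cap\mathcal{D}(L/K)_+)\big)^{A\cap G(L/K)}=L^{A\cap \mathcal{D}(L/K)_+}\cap L^{A\cap G(L/K)}=\big(L^{A\cap\mathcal{D}(L/K)_+}\big)^{A\cap G(L/K)}.$$ In particular, the inverse sends $\mathcal{D}(L/M)\rtimes G(L/M)$ to $L^{\mathcal{D}(L/M)_+}\cap L^{G(L/M)}=\big(L^{\mathcal{D}(L/M)_+}\big)^{G(L/M)}$. (3) For every field $M\in\mathcal{F}(F/K)$ we have $[M:K]\,|G(L/M)|\,\dim_K(\mathcal{D}(L/M))=[L:K]^2$. Equivalently, $|G(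L/M)|\,\dim_M(\mathcal{D}(L/M))=[L:M]^2$.
   Context: Notation and conventions. - For a finite field extension $L/K$ and an intermediate field $K\subseteq M\subseteq L$: - $E(L/M)=\mathrm{End}_M(L)\subseteq E(L/K)=\mathrm{End}_K(L)$. - $L$ is identified with the subalgebra of multiplication operators in $E(L/K)$. - $G(L/M)$ is the group of $M$-algebra automorphisms of $L$, viewed inside $E(L/K)$. - $\mathcal{D}(L/M)$ is the algebra of $M$-linear differential operators on $L$. It is defined as $\bigcup_{i\ge0}\mathcal{D}_i$, where $\mathcal{D}_0=L$ and $\mathcal{D}_i=\{\delta\in E(L/M)\mid [\delta,l]\in\mathcal{D}_{i-1}\ \text{for all } l\in L\}$. - $\mathcal{D}(L/K)_+=\{\delta\in\mathcal{D}(L/K)\mid \delta(1)=0\}$, and similarly for $\mathcal{D}(L/M)_+$. - $\mathcal{D}(L/K)^M=\{\delta\in\mathcal{D}(L/K)\mid \delta m=m\delta\ \text{for all } m\in M\}$. - $G(L/K)^M=\{g\in G(L/K)\mid g(m)=m\ \text{for all } m\in M\}$. - For a subalgebra $D\subseteq E(L/K)$ and a group $H\subseteq E(L/K)$, the notation $D\rtimes H$ denotes the subalgebra $\sum_{h\in H}Dh$ of $E(L/K)$; the notation asserts that this sum is direct, i.e. it is a skew group algebra. - $\mathcal{F}(L/K)$ (respectively $\mathcal{F}(F/K)$) is the set of intermediate fields of $L/K$ (respectively of $F/K$). - $\mathcal{A}(E(L/K),L)$ is the set of $K$-subalgebras of $E(L/K)$ that contain $L$. - $C_{E(L/K)}(S)$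 is the centralizer of a subset $S$ in $E(L/K)$, and $C_L(S)=\{l\in L\mid ls=sl\ \text{for all } s\in S\}$. - For $S\subseteq\mathcal{D}(L/K)_+$, $L^S=\{l\in L\mid s(l)=0\ \text{for all } s\in S\}$. - For a subgroup $H\subseteq G(L/K)$, $L^H$ is the fixed field of $H$. *)

theory Defs
  imports "HOL-Algebra.Algebra"
begin

section \<open>Normal closures and intermediate fields\<close>

definition normal_extension :: "('a, 'b) ring_scheme \<Rightarrow> 'a set \<Rightarrow> bool" where
  "normal_extension L K \<longleftrightarrow>
     (\<forall>x\<in>carrier L. (ring.algebraic L over K) x) \<and>
     (\<forall>p\<in>carrier (K[X]\<^bsub>L\<^esub>). pirreducible\<^bsub>L\<^esub> K p \<longrightarrow> (\<exists>x. ring.is_root L p x) \<longrightarrow> ring.splitted L p)"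

text \<open>\<open>L/K\<close> is a normal closure of \<open>F/K\<close>: it is normal, and it is minimal with this property
  among the extensions of \<open>F\<close> inside \<open>L\<close>.\<close>

definition is_normal_closure :: "('a, 'b) ring_scheme \<Rightarrow> 'a set \<Rightarrow> 'a set \<Rightarrow> bool" where
  "is_normal_closure L K F \<longleftrightarrow>
     normal_extension L K \<and>
     (\<forall>N. subfield N L \<longrightarrow> F \<subseteq> N \<longrightarrow> normal_extension (L\<lparr>carrier := N\<rparr>) K \<longrightarrow> N = carrier L)"

text \<open>The intermediate fields of \<open>F/K\<close>, where \<open>F\<close> is a subset of \<open>L\<close>.\<close>

definition intermediate_fields :: "('a, 'b) ring_scheme \<Rightarrow> 'a set \<Rightarrow> 'a set \<Rightarrow> 'a set set" where
  "intermediate_fields L F K = {M. subfield M L \<and> K \<subseteq> M \<and> M \<subseteq> F}"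


section \<open>The endomorphism algebra\<close>

text \<open>Maps are extensional (\<open>undefined\<close> outside \<open>carrier L\<close>), so that HOL equality of maps
  is equality on \<open>L\<close>. The operations do not depend on \<open>M\<close>; hence \<open>End_alg L M\<close> is a subring of
  \<open>End_alg L K\<close> whenever \<open>K \<subseteq> M\<close>.\<close>

definition End_alg :: "('a, 'b) ring_scheme \<Rightarrow> 'a set \<Rightarrow> ('a \<Rightarrow> 'a) ring" where
  "End_alg L M =
     \<lparr> carrier = {f \<in> carrier L \<rightarrow>\<^sub>E carrier L.
         (\<forall>x\<in>carrier L. \<forall>y\<in>carrier L. f (x \<oplus>\<^bsub>L\<^esub> y) = f x \<oplus>\<^bsub>L\<^esub> f y) \<and>
         (\<forall>m\<in>M. \<forall>x\<in>carrier L. f (m \<otimes>\<^bsub>L\<^esub> x) = m \<otimes>\<^bsub>L\<^esub> f x)},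
       monoid.mult = compose (carrier L),
       one = (\<lambda>x\<in>carrier L. x),
       ring.zero = (\<lambda>x\<in>carrier L. \<zero>\<^bsub>L\<^esub>),
       add = (\<lambda>f g. \<lambda>x\<in>carrier L. f x \<oplus>\<^bsub>L\<^esub> g x) \<rparr>"

text \<open>An element (a subset) of \<open>L\<close>, viewed in the endomorphism algebra.\<close>

definition mult_op :: "('a, 'b) ring_scheme \<Rightarrow> 'a \<Rightarrow> 'a \<Rightarrow> 'a" where
  "mult_op L l = (\<lambda>x\<in>carrier L. l \<otimes>\<^bsub>L\<^esub> x)"

abbreviation mult_ops :: "('a, 'b) ring_scheme \<Rightarrow> 'a set \<Rightarrow> ('a \<Rightarrow> 'a) set" where
  "mult_ops L S \<equiv> mult_op L ` S"

definition Gal :: "('a, 'b) ring_scheme \<Rightarrow> 'a set \<Rightarrow> ('a \<Rightarrow> 'a) set" where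
  "Gal L M = {g \<in> ring_iso L L. g \<in> extensional (carrier L) \<and> (\<forall>m\<in>M. g m = m)}"

definition centralizer :: "('c, 'd) ring_scheme \<Rightarrow> 'c set \<Rightarrow> 'c set" where
  "centralizer R S = {x \<in> carrier R. \<forall>s\<in>S. x \<otimes>\<^bsub>R\<^esub> s = s \<otimes>\<^bsub>R\<^esub> x}"

text \<open>\<open>C\<^sub>L(S)\<close>, as a subset of \<open>L\<close> itself.\<close>

definition field_centralizer ::
    "('a, 'b) ring_scheme \<Rightarrow> 'a set \<Rightarrow> ('a \<Rightarrow> 'a) set \<Rightarrow> 'a set" where
  "field_centralizer L K S =
     {l \<in> carrier L. \<forall>s\<in>S. mult_op L l \<otimes>\<^bsub>End_alg L K\<^esub> s = s \<otimes>\<^bsub>End_alg L K\<^esub> mult_op L l}"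

definition common_zeros :: "('a, 'b) ring_scheme \<Rightarrow> ('a \<Rightarrow> 'a) set \<Rightarrow> 'a set" where
  "common_zeros L S = {l \<in> carrier L. \<forall>s\<in>S. s l = \<zero>\<^bsub>L\<^esub>}"

definition fixed_points :: "'a set \<Rightarrow> ('a \<Rightarrow> 'a) set \<Rightarrow> 'a set" where
  "fixed_points S H = {x \<in> S. \<forall>h\<in>H. h x = x}"


section \<open>Differential operators\<close>

primrec diff_ops_order :: "('a, 'b) ring_scheme \<Rightarrow> 'a set \<Rightarrow> nat \<Rightarrow> ('a \<Rightarrow> 'a) set" where
  "diff_ops_order L M 0 = mult_ops L (carrier L)"
| "diff_ops_order L M (Suc i) =
     {\<delta> \<in> carrier (End_alg L M). \<forall>l\<in>carrier L.
        (\<delta> \<otimes>\<^bsub>End_alg L M\<^esub> mult_op L l) \<ominus>\<^bsub>End_alg L M\<^esub> (mult_op L l \<otimes>\<^bsub>End_alg L M\<^esub> \<delta>)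
          \<in> diff_ops_order L M i}"

definition diff_ops :: "('a, 'b) ring_scheme \<Rightarrow> 'a set \<Rightarrow> ('a \<Rightarrow> 'a) set" where
  "diff_ops L M = (\<Union>i. diff_ops_order L M i)"

definition diff_ops_plus :: "('a, 'b) ring_scheme \<Rightarrow> 'a set \<Rightarrow> ('a \<Rightarrow> 'a) set" where
  "diff_ops_plus L M = {\<delta> \<in> diff_ops L M. \<delta> \<one>\<^bsub>L\<^esub> = \<zero>\<^bsub>L\<^esub>}"

text \<open>\<open>D(L/K)\<^sup>M\<close> and \<open>G(L/K)\<^sup>M\<close>.\<close>

definition diff_ops_comm :: "('a, 'b) ring_scheme \<Rightarrow> 'a set \<Rightarrow> 'a set \<Rightarrow> ('a \<Rightarrow> 'a) set" where
  "diff_ops_comm L K M =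
     {\<delta> \<in> diff_ops L K. \<forall>m\<in>M.
        \<delta> \<otimes>\<^bsub>End_alg L K\<^esub> mult_op L m = mult_op L m \<otimes>\<^bsub>End_alg L K\<^esub> \<delta>}"

definition Gal_fixing :: "('a, 'b) ring_scheme \<Rightarrow> 'a set \<Rightarrow> 'a set \<Rightarrow> ('a \<Rightarrow> 'a) set" where
  "Gal_fixing L K M = {g \<in> Gal L K. \<forall>m\<in>M. g m = m}"


section \<open>Subalgebras and skew group algebras\<close>

text \<open>The library's \<^const>\<open>subalgebra\<close> only says that \<open>A\<close> is a \<open>K\<close>-subspace.\<close>

definition is_subalgebra :: "('a, 'b) ring_scheme \<Rightarrow> 'a set \<Rightarrow> ('a \<Rightarrow> 'a) set \<Rightarrow> bool" where
  "is_subalgebra L K A \<longleftrightarrow>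
     subring A (End_alg L K) \<and> subalgebra (mult_ops L K) A (End_alg L K)"

definition algebras_over :: "('a, 'b) ring_scheme \<Rightarrow> 'a set \<Rightarrow> ('a \<Rightarrow> 'a) set set" where
  "algebras_over L K = {A. is_subalgebra L K A \<and> mult_ops L (carrier L) \<subseteq> A}"

definition algebras_over_containing ::
    "('a, 'b) ring_scheme \<Rightarrow> 'a set \<Rightarrow> 'a set \<Rightarrow> ('a \<Rightarrow> 'a) set set" where
  "algebras_over_containing L K F =
     {A \<in> algebras_over L K. centralizer (End_alg L K) (mult_ops L F) \<subseteq> A}"

text \<open>The sum \<open>\<Sum>\<^bsub>h \<in> H\<^esub> D h\<close> of subspaces of a ring \<open>R\<close>.\<close>

definition skew_sum :: "('c, 'd) ring_scheme \<Rightarrow> 'c set \<Rightarrow> 'c set \<Rightarrow> 'c set" where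
  "skew_sum R D H =
     {(\<Oplus>\<^bsub>R\<^esub>h\<in>S. d h \<otimes>\<^bsub>R\<^esub> h) | S d. finite S \<and> S \<subseteq> H \<and> d \<in> S \<rightarrow> D}"

text \<open>What the notation \<open>D \<rtimes> H\<close> asserts about \<open>D\<close> and \<open>H\<close>: \<open>H\<close> is a group acting by conjugation
  on the subalgebra \<open>D\<close>, and the sum of the \<open>D h\<close> is direct.\<close>

definition is_skew_group_algebra ::
    "('a, 'b) ring_scheme \<Rightarrow> 'a set \<Rightarrow> ('a \<Rightarrow> 'a) set \<Rightarrow> ('a \<Rightarrow> 'a) set \<Rightarrow> bool" where
  "is_skew_group_algebra L K D H \<longleftrightarrow>
     is_subalgebra L K D \<and>
     subgroup H (units_of (End_alg L K)) \<and>
     (\<forall>h\<in>H. \<forall>d\<in>D. h \<otimes>\<^bsub>End_alg L K\<^esub> d \<otimes>\<^bsub>End_alg L K\<^esub> inv\<^bsub>End_alg L K\<^esub> h \<in> D) \<and>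
     (\<forall>S d. finite S \<longrightarrow> S \<subseteq> H \<longrightarrow> d \<in> S \<rightarrow> D \<longrightarrow>
        (\<Oplus>\<^bsub>End_alg L K\<^esub>h\<in>S. d h \<otimes>\<^bsub>End_alg L K\<^esub> h) = \<zero>\<^bsub>End_alg L K\<^esub> \<longrightarrow>
        (\<forall>h\<in>S. d h = \<zero>\<^bsub>End_alg L K\<^esub>))"

definition equals_skew_group_algebra ::
    "('a, 'b) ring_scheme \<Rightarrow> 'a set \<Rightarrow> ('a \<Rightarrow> 'a) set \<Rightarrow> ('a \<Rightarrow> 'a) set \<Rightarrow> ('a \<Rightarrow> 'a) set \<Rightarrow> bool" where
  "equals_skew_group_algebra L K A D H \<longleftrightarrow>
     is_skew_group_algebra L K D H \<and> A = skew_sum (End_alg L K) D H"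

end

theory Submission
  imports Defs
begin

text \<open>For \<open>l, c \<in> L\<close> put \<open>T\<^sub>l\<^sub>,\<^sub>c \<delta> = \<delta> l - c \<delta>\<close>. These operators on \<open>End\<^sub>M(L)\<close> commute, and the product of
  \<open>T\<^sub>l\<^sub>,\<^sub>c\<close> over the roots \<open>c\<close> of the minimal polynomial of \<open>l\<close> over \<open>K\<close>, all of which lie in \<open>L\<close>,
  is zero. Hence \<open>End\<^sub>M(L)\<close> is the sum of joint generalised eigenspaces. A joint eigenvector \<open>h\<close> makes
  \<open>l \<mapsto> h(l) / h(1)\<close> an automorphism \<open>\<chi>\<close>, and the generalised eigenspace belonging to \<open>\<chi>\<close> is
  \<open>D(L/M) \<chi>\<close>; so \<open>End\<^sub>M(L) = D(L/M) \<rtimes> G(L/M)\<close> in every characteristic. The correspondence between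
  algebras and fields is the Jacobson-Bourbaki density argument, and the formulas in (3) count
  left \<open>L\<close>-dimensions. The same eigenvectors in \<open>Hom\<^sub>K(N, L)\<close> extend embeddings, which shows that the
  normal closure is finite over \<open>K\<close>.\<close>

section \<open>Twisted commutators\<close>

text \<open>The obstacle is inseparability. A minimal polynomial may have repeated roots, so the
  operators need not be diagonalisable and the automorphisms alone span too little over
  \<open>L\<close>. The nilpotent parts that remain are exactly the differential operators, since
  \<open>D(L/M)\<close> is the generalised eigenspace of the character \<open>l \<mapsto> l\<close>.
  Normality enters twice: it puts the eigenvalues into \<open>L\<close>, where they act as scalars
  from the left, and it makes an embedding of \<open>L\<close> into itself surjective. All
  components \<open>D(L/M) \<chi>\<close> have the same left \<open>L\<close>-dimension, so (3)
  reduces to \<open>|G| dim_L D = [L:M]\<close>. Only finitely many \<open>l\<close> have to be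
  treated, namely a \<open>K\<close>-basis, because \<open>\<chi>\<close> and hence the twist by
  \<open>l\<close> and \<open>\<chi> l\<close> depend \<open>K\<close>-linearly on \<open>l\<close>.
  That needs \<open>L/K\<close> finite, whereas the normal closure is given only by minimality. So
  maps are taken on a source \<open>N\<close> that may be smaller than \<open>L\<close>: a finite
  \<open>N\<close> comes first, it is shown to be normal, and minimality makes it all of
  \<open>L\<close>.\<close>

definition linear_maps :: "('a, 'b) ring_scheme \<Rightarrow> 'a set \<Rightarrow> 'a set \<Rightarrow> ('a \<Rightarrow> 'a) set" where
  "linear_maps R K N = {f \<in> N \<rightarrow>\<^sub>E carrier R.
     (\<forall>x\<in>N. \<forall>y\<in>N. f (x \<oplus>\<^bsub>R\<^esub> y) = f x \<oplus>\<^bsub>R\<^esub> f y) \<and>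
     (\<forall>k\<in>K. \<forall>x\<in>N. f (k \<otimes>\<^bsub>R\<^esub> x) = k \<otimes>\<^bsub>R\<^esub> f x)}"

definition embeddings :: "('a, 'b) ring_scheme \<Rightarrow> 'a set \<Rightarrow> 'a set \<Rightarrow> ('a \<Rightarrow> 'a) set" where
  "embeddings R K N = {\<chi> \<in> linear_maps R K N.
     \<chi> \<one>\<^bsub>R\<^esub> = \<one>\<^bsub>R\<^esub> \<and> (\<forall>x\<in>N. \<forall>y\<in>N. \<chi> (x \<otimes>\<^bsub>R\<^esub> y) = \<chi> x \<otimes>\<^bsub>R\<^esub> \<chi> y)}"

definition zero_map :: "('a, 'b) ring_scheme \<Rightarrow> 'a set \<Rightarrow> 'a \<Rightarrow> 'a" where
  "zero_map R N = (\<lambda>x\<in>N. \<zero>\<^bsub>R\<^esub>)"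

definition add_map :: "('a, 'b) ring_scheme \<Rightarrow> 'a set \<Rightarrow> ('a \<Rightarrow> 'a) \<Rightarrow> ('a \<Rightarrow> 'a) \<Rightarrow> 'a \<Rightarrow> 'a" where
  "add_map R N f g = (\<lambda>x\<in>N. f x \<oplus>\<^bsub>R\<^esub> g x)"

definition scale_map :: "('a, 'b) ring_scheme \<Rightarrow> 'a set \<Rightarrow> 'a \<Rightarrow> ('a \<Rightarrow> 'a) \<Rightarrow> 'a \<Rightarrow> 'a" where
  "scale_map R N c f = (\<lambda>x\<in>N. c \<otimes>\<^bsub>R\<^esub> f x)"

text \<open>Here \<open>l\<close> acts in the source and \<open>c\<close> in the target, so
  \<open>c\<close> may be a conjugate of \<open>l\<close> outside \<open>N\<close>. For
  \<open>N = L\<close> and \<open>c = l\<close> this is the commutator \<open>[f, l]\<close> from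
  the definition of differential operators. It vanishes iff \<open>f (l x) = c (f x)\<close> for all
  \<open>x\<close>.\<close>

definition twist :: "('a, 'b) ring_scheme \<Rightarrow> 'a set \<Rightarrow> 'a \<Rightarrow> 'a \<Rightarrow> ('a \<Rightarrow> 'a) \<Rightarrow> 'a \<Rightarrow> 'a" where
  "twist R N l c f = (\<lambda>x\<in>N. f (l \<otimes>\<^bsub>R\<^esub> x) \<ominus>\<^bsub>R\<^esub> c \<otimes>\<^bsub>R\<^esub> f x)"

text \<open>A list and not a set of eigenvalues, because roots occur with multiplicity in the
  inseparable case. The list serves all of \<open>P\<close> at once, so the property passes to
  subsets of \<open>P\<close>.\<close>

abbreviation annihilated :: "('a, 'b) ring_scheme \<Rightarrow> 'a set \<Rightarrow> ('a \<Rightarrow> 'a) set \<Rightarrow> 'a \<Rightarrow> bool" where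
  "annihilated R N P l \<equiv>
     \<exists>cs. set cs \<subseteq> carrier R \<and> (\<forall>f\<in>P. fold (twist R N l) cs f = zero_map R N)"

abbreviation eigen :: "('a, 'b) ring_scheme \<Rightarrow> 'a set \<Rightarrow> ('a \<Rightarrow> 'a) \<Rightarrow> 'a \<Rightarrow> bool" where
  "eigen R N f l \<equiv> \<exists>c\<in>carrier R. twist R N l c f = zero_map R N"

abbreviation nilpotent_eigen :: "('a, 'b) ring_scheme \<Rightarrow> 'a set \<Rightarrow> ('a \<Rightarrow> 'a) \<Rightarrow> 'a \<Rightarrow> bool" where
  "nilpotent_eigen R N f l \<equiv> \<exists>c\<in>carrier R. \<exists>n. (twist R N l c ^^ n) f = zero_map R N"

lemma linear_mapsD:
  assumes "f \<in> linear_maps R K N"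
  shows "x \<in> N \<Longrightarrow> f x \<in> carrier R"
    and "f \<in> extensional N"
    and "\<lbrakk> x \<in> N; y \<in> N \<rbrakk> \<Longrightarrow> f (x \<oplus>\<^bsub>R\<^esub> y) = f x \<oplus>\<^bsub>R\<^esub> f y"
    and "\<lbrakk> k \<in> K; x \<in> N \<rbrakk> \<Longrightarrow> f (k \<otimes>\<^bsub>R\<^esub> x) = k \<otimes>\<^bsub>R\<^esub> f x"
  using assms unfolding linear_maps_def by (auto simp: PiE_iff)

lemma linear_mapsI:
  assumes "\<And>x. x \<in> N \<Longrightarrow> f x \<in> carrier R"
    and "f \<in> extensional N"
    and "\<And>x y. \<lbrakk> x \<in> N; y \<in> N \<rbrakk> \<Longrightarrow> f (x \<oplus>\<^bsub>R\<^esub> y) = f x \<oplus>\<^bsub>R\<^esub> f y"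
    and "\<And>k x. \<lbrakk> k \<in> K; x \<in> N \<rbrakk> \<Longrightarrow> f (k \<otimes>\<^bsub>R\<^esub> x) = k \<otimes>\<^bsub>R\<^esub> f x"
  shows "f \<in> linear_maps R K N"
  using assms unfolding linear_maps_def by (auto simp: PiE_iff)

lemma linear_maps_eqI:
  assumes "f \<in> linear_maps R K N" "g \<in> linear_maps R K' N" "\<And>x. x \<in> N \<Longrightarrow> f x = g x"
  shows "f = g"
  using extensionalityI[OF linear_mapsD(2)[OF assms(1)] linear_mapsD(2)[OF assms(2)]] assms(3) by auto

lemma linear_maps_antimono: "K \<subseteq> M \<Longrightarrow> linear_maps R M N \<subseteq> linear_maps R K N"
  unfolding linear_maps_def by auto

lemma embeddingsD:
  assumes "\<chi> \<in> embeddings R K N"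
  shows "\<chi> \<in> linear_maps R K N" and "\<chi> \<one>\<^bsub>R\<^esub> = \<one>\<^bsub>R\<^esub>"
    and "\<lbrakk> x \<in> N; y \<in> N \<rbrakk> \<Longrightarrow> \<chi> (x \<otimes>\<^bsub>R\<^esub> y) = \<chi> x \<otimes>\<^bsub>R\<^esub> \<chi> y"
  using assms unfolding embeddings_def by auto

text \<open>These are the operations that the splitting applies inside \<open>P\<close>: twists, and
  scalars for the factor \<open>1 / (b - a)\<close>. Sums are formed in the target set
  \<open>S\<close> of \<open>primary_decomposition\<close>.\<close>

definition twist_stable :: "('a, 'b) ring_scheme \<Rightarrow> 'a set \<Rightarrow> 'a set \<Rightarrow> ('a \<Rightarrow> 'a) set \<Rightarrow> bool" where
  "twist_stable R K N P \<longleftrightarrow> P \<subseteq> linear_maps R K N \<and>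
     (\<forall>f\<in>P. \<forall>l\<in>N. \<forall>c\<in>carrier R. twist R N l c f \<in> P) \<and>
     (\<forall>f\<in>P. \<forall>c\<in>carrier R. scale_map R N c f \<in> P)"

lemma twist_stableD:
  assumes "twist_stable R K N P"
  shows "f \<in> P \<Longrightarrow> f \<in> linear_maps R K N"
    and "\<lbrakk> f \<in> P; l \<in> N; c \<in> carrier R \<rbrakk> \<Longrightarrow> twist R N l c f \<in> P"
    and "\<lbrakk> f \<in> P; c \<in> carrier R \<rbrakk> \<Longrightarrow> scale_map R N c f \<in> P"
  using assms unfolding twist_stable_def by auto

context cring
begin

lemmas ring_normal_form = minus_eq r_distr l_distr minus_add l_minus r_minus a_ac m_ac minus_minus

context
  fixes K N assumes N: "subring N R" and K: "K \<subseteq> N"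
begin

lemma subring_closed:
  "x \<in> N \<Longrightarrow> x \<in> carrier R" "k \<in> K \<Longrightarrow> k \<in> N" "\<zero> \<in> N" "\<one> \<in> N"
  "\<lbrakk> x \<in> N; y \<in> N \<rbrakk> \<Longrightarrow> x \<oplus> y \<in> N" "\<lbrakk> x \<in> N; y \<in> N \<rbrakk> \<Longrightarrow> x \<otimes> y \<in> N"
  using subringE[OF N] K by auto

lemma linear_maps_zero: "f \<in> linear_maps R K N \<Longrightarrow> f \<zero> = \<zero>"
  using linear_mapsD(3)[of f R K N \<zero> \<zero>] linear_mapsD(1)[of f R K N \<zero>] subring_closed(3)
  by (metis add.r_cancel_one' l_zero zero_closed)

lemma zero_map_linear: "zero_map R N \<in> linear_maps R K N"
  by (rule linear_mapsI) (auto simp: zero_map_def subring_closed)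

lemma add_map_linear:
  assumes "f \<in> linear_maps R K N" "g \<in> linear_maps R K N"
  shows "add_map R N f g \<in> linear_maps R K N"
  by (rule linear_mapsI)
    (auto simp: add_map_def subring_closed linear_mapsD[OF assms(1)] linear_mapsD[OF assms(2)] a_ac r_distr)

lemma scale_map_linear:
  assumes "f \<in> linear_maps R K N" "c \<in> carrier R"
  shows "scale_map R N c f \<in> linear_maps R K N"
  using assms(2) by (intro linear_mapsI)
    (auto simp: scale_map_def subring_closed linear_mapsD[OF assms(1)] m_ac r_distr)

lemma twist_linear:
  assumes f: "f \<in> linear_maps R K N" and "l \<in> N" "c \<in> carrier R"
  shows "twist R N l c f \<in> linear_maps R K N"
proof (rule linear_mapsI)
  note [simp] = subring_closed assms linear_mapsD[OF f]
  show "x \<in> N \<Longrightarrow> twist R N l c f x \<in> carrier R" for x by (simp add: twist_def)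
  show "twist R N l c f \<in> extensional N" by (simp add: twist_def)
  show "twist R N l c f (x \<oplus> y) = twist R N l c f x \<oplus> twist R N l c f y" if "x \<in> N" "y \<in> N" for x y
    using that by (simp add: twist_def r_distr) (simp add: ring_normal_form)
  show "twist R N l c f (k \<otimes> x) = k \<otimes> twist R N l c f x" if "k \<in> K" "x \<in> N" for k x
    using that by (simp add: twist_def m_lcomm[of l k]) (simp add: ring_normal_form)
qed

text \<open>A twist is precomposition with \<open>l\<close> minus postcomposition with
  \<open>c\<close>. Precompositions commute with each other, and so do postcompositions, because
  \<open>L\<close> is commutative; the two kinds act on opposite sides of \<open>f\<close>.\<close>

lemma twist_commute:
  assumes f: "f \<in> linear_maps R K N" and "l \<in> N" "c \<in> carrier R" "l' \<in> N" "c' \<in> carrier R"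
  shows "twist R N l c (twist R N l' c' f) = twist R N l' c' (twist R N l c f)"
  unfolding twist_def using assms
  by (auto intro!: restrict_ext simp: subring_closed linear_mapsD[OF f] m_lcomm[of l l']) (simp add: ring_normal_form subring_closed linear_mapsD[OF f])

lemma twist_scale_map:
  assumes f: "f \<in> linear_maps R K N" and "l \<in> N" "c \<in> carrier R" "d \<in> carrier R"
  shows "twist R N l c (scale_map R N d f) = scale_map R N d (twist R N l c f)"
  unfolding twist_def scale_map_def using assms
  by (auto intro!: restrict_ext simp: subring_closed linear_mapsD[OF f] ring_normal_form)

lemma twist_add_map:
  assumes f: "f \<in> linear_maps R K N" and g: "g \<in> linear_maps R K N" and "l \<in> N" "c \<in> carrier R"
  shows "twist R N l c (add_map R N f g) = add_map R N (twist R N l c f) (twist R N l c g)"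
  unfolding twist_def add_map_def using assms
  by (auto intro!: restrict_ext simp: subring_closed linear_mapsD[OF f] linear_mapsD[OF g] ring_normal_form)

lemma twist_zero_map:
  assumes "l \<in> N" "c \<in> carrier R"
  shows "twist R N l c (zero_map R N) = zero_map R N"
  unfolding twist_def zero_map_def using assms
  by (auto intro!: restrict_ext simp: subring_closed ring_normal_form)

lemma scale_map_zero_map:
  assumes "c \<in> carrier R"
  shows "scale_map R N c (zero_map R N) = zero_map R N"
  unfolding scale_map_def zero_map_def using assms by (auto intro!: restrict_ext)

lemma twist_power_linear:
  assumes "f \<in> linear_maps R K N" and "l \<in> N" "c \<in> carrier R"
  shows "(twist R N l c ^^ n) f \<in> linear_maps R K N"
  by (induction n) (auto simp: assms twist_linear)

lemma twist_power_commute: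
  assumes f: "f \<in> linear_maps R K N" and "l \<in> N" "c \<in> carrier R" "l' \<in> N" "c' \<in> carrier R"
  shows "(twist R N l c ^^ n) (twist R N l' c' f) = twist R N l' c' ((twist R N l c ^^ n) f)"
  by (induction n) (auto simp: twist_commute[of _ l c l' c'] twist_power_linear assms)

lemma twist_power_scale_map:
  assumes f: "f \<in> linear_maps R K N" and "l \<in> N" "c \<in> carrier R" "d \<in> carrier R"
  shows "(twist R N l c ^^ n) (scale_map R N d f) = scale_map R N d ((twist R N l c ^^ n) f)"
  by (induction n) (auto simp: twist_scale_map twist_power_linear assms)

lemma fold_twist_scale_map:
  assumes "f \<in> linear_maps R K N" and "l \<in> N" "set cs \<subseteq> carrier R" "d \<in> carrier R"
  shows "fold (twist R N l) cs (scale_map R N d f) = scale_map R N d (fold (twist R N l) cs f)"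
  using assms by (induction cs arbitrary: f) (auto simp: twist_linear twist_scale_map)

text \<open>By \<open>twist_commute\<close> any factor of the product may be applied first. This
  lets an induction strip an eigenvalue of its choice from the list.\<close>

lemma fold_twist_remove1:
  assumes "f \<in> linear_maps R K N" and "l \<in> N" "set cs \<subseteq> carrier R" "a \<in> set cs"
  shows "fold (twist R N l) (remove1 a cs) (twist R N l a f) = fold (twist R N l) cs f"
  using assms
proof (induction cs arbitrary: f)
  case (Cons c cs)
  then have car: "c \<in> carrier R" "a \<in> carrier R" by auto
  show ?case
  proof (cases "a = c")
    case False
    then have "fold (twist R N l) (remove1 a (c # cs)) (twist R N l a f)
        = fold (twist R N l) (remove1 a cs) (twist R N l a (twist R N l c f))"
      using twist_commute[OF Cons.prems(1,2) car(1) Cons.prems(2) car(2)] by simp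
    also have "\<dots> = fold (twist R N l) cs (twist R N l c f)"
      using Cons False by (intro Cons.IH) (auto simp: twist_linear)
    finally show ?thesis by simp
  qed simp
qed simp

lemma twist_stable_linear_maps: "twist_stable R K N (linear_maps R K N)"
  unfolding twist_stable_def by (auto simp: twist_linear scale_map_linear)

lemma twist_stable_nilpotent:
  assumes P: "twist_stable R K N P" and l: "l \<in> N"
  shows "twist_stable R K N {f \<in> P. nilpotent_eigen R N f l}" (is "twist_stable R K N ?Q")
  unfolding twist_stable_def
proof (intro conjI ballI subsetI)
  fix f l' c' assume f: "f \<in> ?Q"
    and c': "c' \<in> carrier R"
  then obtain c n where c: "f \<in> P" "c \<in> carrier R" "(twist R N l c ^^ n) f = zero_map R N" by auto
  note f_lin = twist_stableD(1)[OF P c(1)]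
  have "(twist R N l c ^^ n) (scale_map R N c' f) = zero_map R N"
    using twist_power_scale_map[OF f_lin l c(2) c', of n] c c' by (simp add: scale_map_zero_map)
  then show "scale_map R N c' f \<in> ?Q"
    using c c' twist_stableD(3)[OF P] by auto
  assume l': "l' \<in> N"
  have "(twist R N l c ^^ n) (twist R N l' c' f) = zero_map R N"
    using twist_power_commute[OF f_lin l c(2) l' c', of n] c c' l' by (simp add: twist_zero_map)
  then show "twist R N l' c' f \<in> ?Q"
    using c c' l' twist_stableD(2)[OF P] by auto
qed (use twist_stableD(1)[OF P] in auto)

lemma twist_stable_kernel:
  assumes P: "twist_stable R K N P" and l: "l \<in> N" and c: "c \<in> carrier R"
  shows "twist_stable R K N {f \<in> P. twist R N l c f = zero_map R N}"
  unfolding twist_stable_def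
  using twist_stableD[OF P] l c
  by (auto simp: twist_zero_map scale_map_zero_map twist_scale_map
      intro: twist_commute[of _ l c, THEN trans])

end

end

section \<open>Generalised eigenspaces and joint eigenvectors of the twists\<close>

context field
begin

text \<open>The twists by \<open>a\<close> and by \<open>b\<close> differ by the scalar
  \<open>b - a\<close>; with \<open>d = 1 / (b - a)\<close> this is the Bezout relation for two
  distinct linear factors. The scalars stand inside the twists so that both summands are visibly
  twists of members of a stable set.\<close>

lemma twist_difference:
  assumes N: "subring N R" and K: "K \<subseteq> N" and f: "f \<in> linear_maps R K N"
    and l: "l \<in> N" and a: "a \<in> carrier R" and b: "b \<in> carrier R" and ab: "a \<noteq> b"
  shows "\<exists>d\<in>carrier R.
    f = add_map R N (twist R N l a (scale_map R N d f)) (twist R N l b (scale_map R N (\<ominus> d) f))"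
proof (intro bexI extensionalityI[OF linear_mapsD(2)[OF f]])
  let ?d = "inv (b \<ominus> a)"
  have "b \<ominus> a \<in> Units R" using a b ab field_Units
    by (metis DiffI minus_closed r_right_minus_eq singletonD)
  then have d: "?d \<in> carrier R" "?d \<otimes> (b \<ominus> a) = \<one>" by auto
  show "?d \<in> carrier R" by (rule d(1))
  show "add_map R N (twist R N l a (scale_map R N ?d f)) (twist R N l b (scale_map R N (\<ominus> ?d) f)) \<in> extensional N"
    by (simp add: add_map_def)
  fix x assume x: "x \<in> N"
  note [simp] = subring_closed[OF N K] linear_mapsD[OF f] a b d(1) x l
  have "(d \<otimes> (b \<ominus> a)) \<otimes> v = (d \<otimes> u \<ominus> a \<otimes> (d \<otimes> v)) \<oplus> (\<ominus> d \<otimes> u \<ominus> b \<otimes> (\<ominus> d \<otimes> v))"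
    if "d \<in> carrier R" "u \<in> carrier R" "v \<in> carrier R" for d u v
    using that by (simp add: ring_normal_form r_neg1 r_neg2)
  from this[of ?d "f (l \<otimes> x)" "f x"]
  show "f x = add_map R N (twist R N l a (scale_map R N ?d f)) (twist R N l b (scale_map R N (\<ominus> ?d) f)) x"
    by (simp add: d(2) add_map_def twist_def scale_map_def)
qed

text \<open>Two distinct roots \<open>a\<close>, \<open>b\<close> give \<open>f = (T\<^sub>a f - T\<^sub>b f) / (b - a)\<close>, and either summand is
  killed by a shorter product.\<close>

lemma split_by_annihilator:
  assumes N: "subring N R" and K: "K \<subseteq> N" and P: "twist_stable R K N P" and l: "l \<in> N"
    and S_add: "\<And>f g. \<lbrakk> f \<in> S; g \<in> S \<rbrakk> \<Longrightarrow> add_map R N f g \<in> S"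
    and S: "\<And>f c n. \<lbrakk> f \<in> P; c \<in> carrier R; (twist R N l c ^^ n) f = zero_map R N \<rbrakk> \<Longrightarrow> f \<in> S"
  shows "\<lbrakk> f \<in> P; set cs \<subseteq> carrier R; fold (twist R N l) cs f = zero_map R N \<rbrakk> \<Longrightarrow> f \<in> S"
proof (induction "length cs" arbitrary: f cs rule: less_induct)
  case less
  show ?case
  proof (cases "\<exists>a\<in>set cs. \<exists>b\<in>set cs. a \<noteq> b")
    case True
    then obtain a b where ab: "a \<in> set cs" "b \<in> set cs" "a \<noteq> b" by auto
    then have car: "a \<in> carrier R" "b \<in> carrier R" using less.prems(2) by auto
    obtain d where d: "d \<in> carrier R"
      "f = add_map R N (twist R N l a (scale_map R N d f)) (twist R N l b (scale_map R N (\<ominus> d) f))"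
      using twist_difference[OF N K twist_stableD(1)[OF P less.prems(1)] l car ab(3)] by blast
    have part: "twist R N l e (scale_map R N d f) \<in> S" if e: "e \<in> set cs" and d: "d \<in> carrier R" for d e
    proof (rule less.hyps)
      show "length (remove1 e cs) < length cs"
        using e by (simp add: length_remove1) (use length_pos_if_in_set in fastforce)
      have e': "e \<in> carrier R" using e less.prems(2) by auto
      show "twist R N l e (scale_map R N d f) \<in> P"
        using twist_stableD[OF P] less.prems(1) l d e' by blast
      show "set (remove1 e cs) \<subseteq> carrier R" using less.prems(2) set_remove1_subset by fast
      have "fold (twist R N l) (remove1 e cs) (twist R N l e (scale_map R N d f))
          = scale_map R N d (fold (twist R N l) cs f)"
        using twist_stableD[OF P] less.prems(1,2) d l e
        by (simp add: fold_twist_remove1[OF N K] fold_twist_scale_map[OF N K])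
      then show "fold (twist R N l) (remove1 e cs) (twist R N l e (scale_map R N d f)) = zero_map R N"
        using less.prems(3) d by (simp add: scale_map_zero_map[OF N K])
    qed
    show ?thesis
      by (subst d(2)) (rule S_add[OF part[OF ab(1) d(1)] part[OF ab(2) a_inv_closed[OF d(1)]]])
  next
    case False
    obtain c where c: "cs = replicate (length cs) c" "c \<in> carrier R"
    proof (cases cs)
      \<comment> \<open>For the empty list \<open>f\<close> itself is zero, and any \<open>c\<close>
        serves with exponent 0.\<close>
      case Nil with that[of \<zero>] show ?thesis by simp
    next
      case (Cons c cs')
      then have "cs = replicate (length cs) c" using False
        by (intro replicate_eqI) auto
      moreover have "c \<in> carrier R" using Cons less.prems by auto
      ultimately show ?thesis using that by blast
    qed
    have "fold (twist R N l) (replicate n c) f = (twist R N l c ^^ n) f" for n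
      by (induction n arbitrary: f) (auto simp: funpow_swap1)
    then have "(twist R N l c ^^ length cs) f = zero_map R N" using c less.prems(3) by metis
    with S less.prems c show ?thesis by blast
  qed
qed

text \<open>One \<open>l\<close> at a time. The members of \<open>P\<close> that are nilpotent for
  the first \<open>l\<close> form a stable set again, since twists commute, so the induction
  hypothesis for the remaining list puts them into \<open>S\<close>. Splitting by the annihilator of
  the first \<open>l\<close> then writes every member of \<open>P\<close> as a sum of such
  maps.\<close>

lemma primary_decomposition:
  assumes N: "subring N R" and K: "K \<subseteq> N"
    and S_add: "\<And>f g. \<lbrakk> f \<in> S; g \<in> S \<rbrakk> \<Longrightarrow> add_map R N f g \<in> S"
  shows "\<lbrakk> twist_stable R K N P; set ls \<subseteq> N;
     \<And>l. l \<in> set ls \<Longrightarrow> annihilated R N P l;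
     \<And>f. \<lbrakk> f \<in> P; \<And>l. l \<in> set ls \<Longrightarrow> nilpotent_eigen R N f l \<rbrakk> \<Longrightarrow> f \<in> S \<rbrakk>
     \<Longrightarrow> P \<subseteq> S"
proof (induction ls arbitrary: P)
  case Nil
  then show ?case by auto
next
  case (Cons l ls)
  then have l: "l \<in> N" by auto
  let ?P = "{f \<in> P. nilpotent_eigen R N f l}"
  have sub: "?P \<subseteq> S"
  proof (rule Cons.IH)
    show "twist_stable R K N ?P" by (rule twist_stable_nilpotent[OF N K Cons.prems(1) l])
    show "f \<in> S" if "f \<in> ?P" "\<And>l. l \<in> set ls \<Longrightarrow> nilpotent_eigen R N f l" for f
      using Cons.prems(4)[of f] that by auto
    show "annihilated R N ?P l" if "l \<in> set ls" for l
      using Cons.prems(3)[of l] that by auto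
  qed (use Cons.prems in auto)
  obtain cs where "set cs \<subseteq> carrier R" "\<forall>f\<in>P. fold (twist R N l) cs f = zero_map R N"
    using Cons.prems(3)[of l] by auto
  then show ?case
    using split_by_annihilator[OF N K Cons.prems(1) l S_add] sub by blast
qed

text \<open>Apply the annihilating factors of the first \<open>l\<close> one after the other: the
  last nonzero map is an eigenvector. The kernel of its twist is stable, so the search goes on for
  the remaining \<open>l\<close> inside this kernel, where the eigenvalue already found is
  kept.\<close>

lemma exists_joint_eigenvector:
  assumes N: "subring N R" and K: "K \<subseteq> N"
  shows "\<lbrakk> twist_stable R K N P; f \<in> P; f \<noteq> zero_map R N; set ls \<subseteq> N;
     \<And>l. l \<in> set ls \<Longrightarrow> annihilated R N P l \<rbrakk>
     \<Longrightarrow> \<exists>h\<in>P. h \<noteq> zero_map R N \<and> (\<forall>l\<in>set ls. eigen R N h l)"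
proof (induction ls arbitrary: P f)
  case Nil
  then show ?case by auto
next
  case (Cons l ls)
  then have l: "l \<in> N" by auto
  obtain cs where cs: "set cs \<subseteq> carrier R" "fold (twist R N l) cs f = zero_map R N"
    using Cons.prems(2) Cons.prems(5)[of l] by auto
  have "\<exists>g\<in>P. g \<noteq> zero_map R N \<and> (eigen R N g l)"
    using cs Cons.prems(2,3)
  proof (induction cs arbitrary: f)
    case Nil
    then show ?case by auto
  next
    case (Cons c cs f)
    then show ?case using twist_stableD(2)[OF \<open>twist_stable R K N P\<close> _ l, of f c]
      by (cases "twist R N l c f = zero_map R N") auto
  qed
  then obtain g c where g: "g \<in> P" "g \<noteq> zero_map R N" "c \<in> carrier R" "twist R N l c g = zero_map R N" by auto
  let ?P = "{f \<in> P. twist R N l c f = zero_map R N}"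
  have "\<exists>h\<in>?P. h \<noteq> zero_map R N \<and> (\<forall>l\<in>set ls. eigen R N h l)"
  proof (rule Cons.IH[of _ g])
    show "twist_stable R K N ?P" by (rule twist_stable_kernel[OF N K Cons.prems(1) l g(3)])
    show "annihilated R N ?P l" if "l \<in> set ls" for l
      using Cons.prems(5)[of l] that by auto
  qed (use Cons.prems g in auto)
  then show ?case using g(3) by auto
qed

end

section \<open>Annihilating polynomials\<close>

text \<open>The polynomial \<open>p\<close> evaluated at the operator "precompose with
  \<open>l\<close>", applied to \<open>f\<close> and taken at \<open>x\<close>, with coefficients
  acting in the target. Coefficient lists have the leading coefficient first, so the head of
  \<open>a # p\<close> belongs to the exponent \<open>length p\<close>.\<close>

primrec poly_act :: "('a, 'b) ring_scheme \<Rightarrow> 'a \<Rightarrow> 'a list \<Rightarrow> ('a \<Rightarrow> 'a) \<Rightarrow> 'a \<Rightarrow> 'a" where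
  "poly_act R l [] f x = \<zero>\<^bsub>R\<^esub>"
| "poly_act R l (a # p) f x = (a \<otimes>\<^bsub>R\<^esub> f (l [^]\<^bsub>R\<^esub> length p \<otimes>\<^bsub>R\<^esub> x)) \<oplus>\<^bsub>R\<^esub> poly_act R l p f x"

context field
begin

context
  fixes K N l f
  assumes N: "subring N R" and K: "K \<subseteq> N" and l: "l \<in> N" and f: "f \<in> linear_maps R K N"
begin

lemma pow_closed: "l [^] (n :: nat) \<in> N"
  by (induction n) (use subring_closed[OF N K] l in auto)

lemma poly_act_closed: "\<lbrakk> set p \<subseteq> carrier R; x \<in> N \<rbrakk> \<Longrightarrow> poly_act R l p f x \<in> carrier R"
  by (induction p) (auto simp: subring_closed[OF N K] pow_closed linear_mapsD[OF f])

lemma poly_act_snoc_zero: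
  "\<lbrakk> set p \<subseteq> carrier R; x \<in> N \<rbrakk> \<Longrightarrow> poly_act R l (p @ [\<zero>]) f x = poly_act R l p f (l \<otimes> x)"
  using l by (induction p)
    (auto simp: subring_closed[OF N K] pow_closed linear_mapsD[OF f] poly_act_closed m_assoc)

lemma poly_act_normalize:
  "\<lbrakk> set p \<subseteq> carrier R; x \<in> N \<rbrakk> \<Longrightarrow> poly_act R l (normalize p) f x = poly_act R l p f x"
  by (induction p) (auto simp: subring_closed[OF N K] pow_closed linear_mapsD[OF f] poly_act_closed)

lemma poly_act_replicate:
  "\<lbrakk> set p \<subseteq> carrier R; x \<in> N \<rbrakk> \<Longrightarrow> poly_act R l (replicate n \<zero> @ p) f x = poly_act R l p f x"
  by (induction n) (auto simp: subring_closed[OF N K] pow_closed linear_mapsD[OF f] poly_act_closed)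

lemma poly_act_map2:
  "\<lbrakk> length p = length q; set p \<subseteq> carrier R; set q \<subseteq> carrier R; x \<in> N \<rbrakk> \<Longrightarrow>
     poly_act R l (map2 (\<oplus>) p q) f x = poly_act R l p f x \<oplus> poly_act R l q f x"
  by (induction p q rule: list_induct2)
    (auto simp: subring_closed[OF N K] pow_closed linear_mapsD[OF f] poly_act_closed l_distr a_ac)

lemma poly_act_smult:
  "\<lbrakk> c \<in> carrier R; set p \<subseteq> carrier R; x \<in> N \<rbrakk> \<Longrightarrow>
     poly_act R l (map (\<lambda>a. c \<otimes> a) p) f x = c \<otimes> poly_act R l p f x"
  by (induction p)
    (auto simp: subring_closed[OF N K] pow_closed linear_mapsD[OF f] poly_act_closed r_distr m_assoc)

lemma poly_act_poly_add:
  assumes "set p \<subseteq> carrier R" "set q \<subseteq> carrier R" "x \<in> N"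
  shows "poly_act R l (poly_add p q) f x = poly_act R l p f x \<oplus> poly_act R l q f x"
proof -
  have aux: "poly_act R l (poly_add p q) f x = poly_act R l p f x \<oplus> poly_act R l q f x"
    if "length p \<ge> length q" "set p \<subseteq> carrier R" "set q \<subseteq> carrier R" for p q
  proof -
    let ?q = "replicate (length p - length q) \<zero> @ q"
    have q: "set ?q \<subseteq> carrier R" "length p = length ?q" using that by auto
    have "set (map2 (\<oplus>) p ?q) \<subseteq> carrier R"
      using that(2) q(1) set_zip_leftD[of _ _ p ?q] set_zip_rightD[of _ _ p ?q]
      by (auto simp del: set_append intro!: a_closed)
    then have "poly_act R l (poly_add p q) f x = poly_act R l (map2 (\<oplus>) p ?q) f x"
      using that assms(3) by (simp add: poly_act_normalize)
    also have "\<dots> = poly_act R l p f x \<oplus> poly_act R l q f x"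
      using poly_act_map2[OF q(2) that(2) q(1) assms(3)] poly_act_replicate[OF that(3) assms(3)] by simp
    finally show ?thesis .
  qed
  show ?thesis
  proof (cases "length p \<ge> length q")
    case True
    then show ?thesis using aux assms by blast
  next
    case False
    then have "poly_add p q = poly_add q p" "length p \<le> length q" by auto
    then have "poly_act R l (poly_add p q) f x = poly_act R l q f x \<oplus> poly_act R l p f x"
      using aux[OF _ assms(2,1)] by metis
    also have "\<dots> = poly_act R l p f x \<oplus> poly_act R l q f x"
      by (rule a_comm[OF poly_act_closed[OF assms(2,3)] poly_act_closed[OF assms(1,3)]])
    finally show ?thesis .
  qed
qed

lemma poly_act_twist:
  "\<lbrakk> set p \<subseteq> carrier R; x \<in> N; c \<in> carrier R \<rbrakk> \<Longrightarrow>
     poly_act R l p (twist R N l c f) x = poly_act R l p f (l \<otimes> x) \<ominus> c \<otimes> poly_act R l p f x"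
proof (induction p)
  case Nil
  then show ?case by (simp add: minus_eq)
next
  case (Cons a p)
  note [simp] = subring_closed[OF N K] pow_closed linear_mapsD[OF f] poly_act_closed l
  have "a \<otimes> (u \<ominus> c \<otimes> v) \<oplus> (s \<ominus> c \<otimes> t) = (a \<otimes> u \<oplus> s) \<ominus> c \<otimes> (a \<otimes> v \<oplus> t)"
    if "u \<in> carrier R" "v \<in> carrier R" "s \<in> carrier R" "t \<in> carrier R" for u v s t
    using that Cons.prems by (simp add: ring_normal_form)
  then show ?case using Cons by (simp add: twist_def m_lcomm[of l "l [^] length p" x])
qed

text \<open>The indeterminate acts as precomposition with \<open>l\<close>, hence
  \<open>X - c\<close> acts as \<open>twist R N l c\<close>. This turns a factorisation into linear
  factors into a product of twists. In \<open>poly_mult\<close> the factor \<open>X\<close> appears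
  as appending a zero coefficient.\<close>

lemma poly_act_linear_factor:
  assumes "set p \<subseteq> carrier R" "x \<in> N" "c \<in> carrier R"
  shows "poly_act R l (poly_mult [\<one>, \<ominus> c] p) f x = poly_act R l p (twist R N l c f) x"
proof -
  have [simp]: "map ((\<otimes>) \<one>) p = p" using assms(1) by (induction p) auto
  have map: "set (map ((\<otimes>) (\<ominus> c)) p) \<subseteq> carrier R" using assms by auto
  have "set (poly_add (map ((\<otimes>) (\<ominus> c)) p) []) \<subseteq> carrier R"
    by (rule poly_add_in_carrier[OF map]) simp
  then have "poly_act R l (poly_mult [\<one>, \<ominus> c] p) f x
      = poly_act R l (p @ [\<zero>]) f x \<oplus> poly_act R l (poly_add (map ((\<otimes>) (\<ominus> c)) p) []) f x"
    using assms by (simp del: poly_add.simps add: poly_act_poly_add)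
  also have "poly_act R l (poly_add (map ((\<otimes>) (\<ominus> c)) p) []) f x = \<ominus> c \<otimes> poly_act R l p f x"
    using assms map by (simp del: poly_add.simps add: poly_act_poly_add poly_act_smult poly_act_closed)
  also have "poly_act R l (p @ [\<zero>]) f x = poly_act R l p f (l \<otimes> x)"
    by (rule poly_act_snoc_zero[OF assms(1,2)])
  finally show ?thesis
    using assms l by (simp add: poly_act_twist poly_act_closed subring_closed[OF N K] l_minus minus_eq)
qed

text \<open>Coefficients from \<open>K\<close> can be pulled into the \<open>K\<close>-linear
  \<open>f\<close>, so the operator \<open>p(l)\<close> becomes precomposition with the element
  \<open>p(l)\<close>. A polynomial over \<open>K\<close> that vanishes at \<open>l\<close>
  therefore acts as zero.\<close>

lemma poly_act_eval:
  "\<lbrakk> set p \<subseteq> K; x \<in> N \<rbrakk> \<Longrightarrow> eval p l \<in> N \<and> poly_act R l p f x = f (eval p l \<otimes> x)"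
proof (induction p)
  case Nil
  then show ?case using linear_maps_zero[OF N K f] by (simp add: subring_closed[OF N K])
next
  case (Cons a p)
  then show ?case
    by (auto simp: subring_closed[OF N K] pow_closed linear_mapsD[OF f] l_distr m_assoc)
qed

end

text \<open>Induction on the degree, peeling off one root at a time; \<open>cs\<close> collects the
  roots with multiplicity and is fixed before \<open>f\<close> is chosen. In degree 0 the polynomial
  is a nonzero constant, which kills only the zero map.\<close>

lemma splitted_annihilator:
  assumes N: "subring N R" and K: "K \<subseteq> N" and l: "l \<in> N"
  shows "\<lbrakk> p \<in> carrier (poly_ring R); p \<noteq> []; splitted p \<rbrakk> \<Longrightarrow>
    \<exists>cs. set cs \<subseteq> carrier R \<and>
      (\<forall>f\<in>linear_maps R K N. (\<forall>x\<in>N. poly_act R l p f x = \<zero>) \<longrightarrow>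
         fold (twist R N l) cs f = zero_map R N)"
proof (induction "degree p" arbitrary: p)
  case 0
  then obtain a where p: "p = [a]" by (metis One_nat_def Suc_diff_1 Suc_length_conv length_0_conv length_greater_0_conv)
  have a: "a \<in> carrier R" "a \<noteq> \<zero>" using 0(2) p unfolding sym[OF univ_poly_carrier] polynomial_def by auto
  have "f = zero_map R N" if f: "f \<in> linear_maps R K N" and z: "\<forall>x\<in>N. poly_act R l p f x = \<zero>" for f
  proof (rule linear_maps_eqI[OF f zero_map_linear[OF N K]])
    fix x assume x: "x \<in> N"
    then have "a \<otimes> f x = \<zero>" using z p a linear_mapsD[OF f] subring_closed[OF N K] by auto
    then show "f x = zero_map R N x"
      using a x linear_mapsD[OF f] by (auto simp: zero_map_def dest: integral)
  qed
  then show ?case by (intro exI[of _ "[]"]) auto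
next
  case (Suc n)
  then have "roots p \<noteq> {#}" by (auto simp: splitted_def)
  then obtain a where a: "a \<in> carrier R" "[\<one>, \<ominus> a] pdivides p" "[\<one>, \<ominus> a] \<in> carrier (poly_ring R)"
    using not_empty_rootsE[OF Suc.prems(1)] by blast
  then obtain q where q: "q \<in> carrier (poly_ring R)" "p = [\<one>, \<ominus> a] \<otimes>\<^bsub>poly_ring R\<^esub> q"
    unfolding pdivides_def factor_def by auto
  interpret UP: domain "poly_ring R" using univ_poly_is_domain[OF carrier_is_subring] .
  have q0: "q \<noteq> []" using q(2) Suc.prems(2) a(3) UP.r_null by (auto simp: univ_poly_zero)
  have roots: "roots p = add_mset a (roots q)"
    using poly_mult_degree_one_monic_imp_same_roots[OF a(1) q(1) q0] q(2) by simp
  have deg: "degree p = Suc (degree q)"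
    using poly_mult_degree_eq[OF carrier_is_subring, of "[\<one>, \<ominus> a]" q] a(3) q q0
    by (simp add: univ_poly_carrier univ_poly_mult del: poly_mult.simps)
  then have "splitted q" using roots Suc.prems(3) by (simp add: splitted_def)
  moreover have "n = degree q" using deg Suc.hyps(2) by simp
  ultimately obtain cs where cs: "set cs \<subseteq> carrier R"
    "\<And>f. \<lbrakk> f \<in> linear_maps R K N; \<forall>x\<in>N. poly_act R l q f x = \<zero> \<rbrakk> \<Longrightarrow> fold (twist R N l) cs f = zero_map R N"
    using Suc.hyps(1)[of q] q(1) q0 by auto
  have "set q \<subseteq> carrier R" using q(1) unfolding sym[OF univ_poly_carrier] by (rule polynomial_incl)
  then have "poly_act R l q (twist R N l a f) x = poly_act R l p f x"
    if "f \<in> linear_maps R K N" "x \<in> N" for f x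
    using poly_act_linear_factor[OF N K l that(1) _ that(2) a(1)] q(2) by (simp add: univ_poly_mult del: poly_mult.simps)
  then show ?case
    using cs a(1) by (intro exI[of _ "a # cs"]) (auto simp: twist_linear[OF N K _ l])
qed

lemma normal_extensionD:
  assumes "normal_extension R K" "subfield K R" "x \<in> carrier R"
  shows "(algebraic over K) x" and "splitted (Irr K x)" and "is_root (Irr K x) x"
proof -
  show alg: "(algebraic over K) x" using assms unfolding normal_extension_def by auto
  note Irr = IrrE[OF assms(2,3) alg]
  have "Irr K x \<noteq> []" using pirreducibleE(1)[OF subfieldE(1)[OF assms(2)] Irr(1,2)] .
  then show "is_root (Irr K x) x" using Irr assms(3) by (simp add: is_root_def)
  then show "splitted (Irr K x)"
    using assms(1) Irr unfolding normal_extension_def by auto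
qed

text \<open>The minimal polynomial of \<open>l\<close> has the root \<open>l\<close> in
  \<open>L\<close>, so normality splits it there; it acts as zero on every \<open>K\<close>-linear
  map, and its roots give \<open>cs\<close>.\<close>

lemma normal_extension_annihilator:
  assumes normal: "normal_extension R K" and "subfield K R"
    and N: "subring N R" and K: "K \<subseteq> N" and l: "l \<in> N"
  obtains cs where "set cs \<subseteq> carrier R"
    "\<And>f. f \<in> linear_maps R K N \<Longrightarrow> fold (twist R N l) cs f = zero_map R N"
proof -
  have l': "l \<in> carrier R" using subring_closed[OF N K] l by auto
  note D = normal_extensionD[OF normal assms(2) l']
  note Irr = IrrE[OF assms(2) l' D(1)]
  have set_Irr: "set (Irr K l) \<subseteq> K" using Irr(1) unfolding sym[OF univ_poly_carrier] by (rule polynomial_incl)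
  have "poly_act R l (Irr K l) f x = \<zero>" if f: "f \<in> linear_maps R K N" and x: "x \<in> N" for f x
    using poly_act_eval[OF N K l f set_Irr x] Irr(4) linear_maps_zero[OF N K f] x subring_closed[OF N K] by auto
  moreover have "Irr K l \<in> carrier (poly_ring R)"
    using Irr(1) carrier_polynomial_shell[OF subfieldE(1)[OF assms(2)]] by blast
  ultimately show ?thesis
    using splitted_annihilator[OF N K l _ _ D(2)] D(3) that by (auto simp: is_root_def)
qed

section \<open>Embeddings from joint eigenvectors\<close>

text \<open>For a fixed \<open>h\<close> eigenvalues combine \<open>K\<close>-linearly: if
  \<open>u\<close> and \<open>v\<close> have eigenvalues \<open>c\<close> and \<open>d\<close>, then
  \<open>k u + v\<close> has \<open>k c + d\<close>. It is thus enough to produce an eigenvector for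
  a spanning list.\<close>

lemma eigenvalues_Span:
  assumes N: "subring N R" and K: "K \<subseteq> N" and sf: "subfield K R" and h: "h \<in> linear_maps R K N"
  shows "\<lbrakk> set Us \<subseteq> N; \<And>u. u \<in> set Us \<Longrightarrow> eigen R N h u \<rbrakk>
    \<Longrightarrow> \<forall>l\<in>Span K Us. l \<in> N \<and> (eigen R N h l)"
proof (induction Us)
  case Nil
  show ?case
    by (auto simp: subring_closed[OF N K] twist_def zero_map_def linear_maps_zero[OF N K h] linear_mapsD[OF h] minus_eq
        intro!: bexI[of _ \<zero>] restrict_ext)
next
  case (Cons u Us)
  obtain c where c: "c \<in> carrier R" "twist R N u c h = zero_map R N" and u: "u \<in> N" using Cons.prems by auto
  show ?case
  proof
    fix l assume "l \<in> Span K (u # Us)"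
    then obtain k v where l: "k \<in> K" "v \<in> Span K Us" "l = k \<otimes> u \<oplus> v"
      by (auto simp: line_extension_mem_iff)
    then obtain d where d: "v \<in> N" "d \<in> carrier R" "twist R N v d h = zero_map R N" using Cons by force
    note [simp] = subring_closed[OF N K] linear_mapsD[OF h]
    have k: "k \<in> N" using l by simp
    have "h (l \<otimes> x) = (k \<otimes> c \<oplus> d) \<otimes> h x" if x: "x \<in> N" for x
    proof -
      have "h (u \<otimes> x) = c \<otimes> h x" "h (v \<otimes> x) = d \<otimes> h x"
        using fun_cong[OF c(2), of x] fun_cong[OF d(3), of x] x c d u
        by (auto simp: twist_def zero_map_def r_right_minus_eq)
      moreover have "l \<otimes> x = k \<otimes> (u \<otimes> x) \<oplus> v \<otimes> x" using l(3) k d u x by (simp add: l_distr m_assoc)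
      ultimately show ?thesis using l(1) k u d x c by (simp add: l_distr m_assoc)
    qed
    then have "twist R N l (k \<otimes> c \<oplus> d) h = zero_map R N"
      using c d k by (auto simp: twist_def zero_map_def intro!: restrict_ext)
    then show "l \<in> N \<and> (eigen R N h l)"
      using l k u d c by auto
  qed
qed

text \<open>The eigenvalue \<open>c\<close> of \<open>l\<close> satisfies
  \<open>h l = c (h 1)\<close>. So \<open>h 1 = 0\<close> would force \<open>h = 0\<close>, and
  otherwise the eigenvalue is determined as \<open>h l / h 1\<close>. Multiplicativity follows from
  \<open>h (x y) = \<chi> x (h y)\<close> after division by \<open>h 1\<close>.\<close>

lemma eigenvector_embedding:
  assumes N: "subring N R" and K: "K \<subseteq> N" and h: "h \<in> linear_maps R K N" "h \<noteq> zero_map R N"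
    and eigen: "\<And>l. l \<in> N \<Longrightarrow> eigen R N h l"
  shows "\<exists>\<chi>\<in>embeddings R K N. \<forall>l\<in>N. twist R N l (\<chi> l) h = zero_map R N"
proof -
  note [simp] = subring_closed[OF N K] linear_mapsD[OF h(1)]
  define \<chi> where "\<chi> = (\<lambda>l\<in>N. h l \<otimes> inv (h \<one>))"
  have ev: "h (l \<otimes> x) = c \<otimes> h x" if "twist R N l c h = zero_map R N" "l \<in> N" "c \<in> carrier R" "x \<in> N" for l c x
    using fun_cong[OF that(1), of x] that by (auto simp: twist_def zero_map_def r_right_minus_eq)
  have "h \<one> \<noteq> \<zero>"
  proof
    assume 0: "h \<one> = \<zero>"
    have "h = zero_map R N"
    proof (rule linear_maps_eqI[OF h(1) zero_map_linear[OF N K]])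
      fix x assume x: "x \<in> N"
      from eigen[OF this] obtain c where "c \<in> carrier R" "twist R N x c h = zero_map R N" by auto
      then have "h (x \<otimes> \<one>) = c \<otimes> h \<one>" using x by (intro ev) auto
      then show "h x = zero_map R N x" using 0 x \<open>c \<in> carrier R\<close> by (simp add: zero_map_def)
    qed
    with h(2) show False ..
  qed
  then have inv1: "inv (h \<one>) \<in> carrier R" "h \<one> \<otimes> inv (h \<one>) = \<one>"
    using field_Units by auto
  have \<chi>: "\<chi> l \<in> carrier R" "twist R N l (\<chi> l) h = zero_map R N" if l: "l \<in> N" for l
  proof -
    obtain c where c: "c \<in> carrier R" "twist R N l c h = zero_map R N" using eigen[OF l] by auto
    then have "h (l \<otimes> \<one>) = c \<otimes> h \<one>" using l by (intro ev) auto
    then have "\<chi> l = c" using l inv1 c by (simp add: \<chi>_def m_assoc)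
    then show "\<chi> l \<in> carrier R" "twist R N l (\<chi> l) h = zero_map R N" using c by auto
  qed
  have "\<chi> \<in> linear_maps R K N"
    by (rule linear_mapsI) (use \<chi>(1) inv1 in \<open>auto simp: \<chi>_def l_distr m_assoc\<close>)
  moreover have "\<chi> \<one> = \<one>" using inv1 by (simp add: \<chi>_def)
  moreover have "\<chi> (x \<otimes> y) = \<chi> x \<otimes> \<chi> y" if "x \<in> N" "y \<in> N" for x y
  proof -
    have "h (x \<otimes> y) = \<chi> x \<otimes> h y" using \<chi> that by (intro ev) auto
    then show ?thesis using that inv1 \<chi>(1) by (simp add: \<chi>_def[THEN fun_cong, of "x \<otimes> y"] \<chi>_def[THEN fun_cong, of y] m_assoc)
  qed
  ultimately show ?thesis using \<chi> unfolding embeddings_def by auto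
qed

section \<open>Embeddings of a normal extension into itself are automorphisms\<close>

lemma embedding_nat_pow:
  assumes N: "subring N R" and K: "K \<subseteq> N" and \<chi>: "\<chi> \<in> embeddings R K N" and x: "x \<in> N"
  shows "x [^] (n :: nat) \<in> N \<and> \<chi> (x [^] n) = \<chi> x [^] n"
  by (induction n) (use subring_closed[OF N K] embeddingsD[OF \<chi>] x in auto)

lemma embedding_eval:
  assumes N: "subring N R" and K: "K \<subseteq> N" and \<chi>: "\<chi> \<in> embeddings R K N" and x: "x \<in> N"
  shows "set p \<subseteq> K \<Longrightarrow> eval p x \<in> N \<and> \<chi> (eval p x) = eval p (\<chi> x)"
proof (induction p)
  case Nil
  then show ?case using subring_closed[OF N K] linear_maps_zero[OF N K embeddingsD(1)[OF \<chi>]] by auto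
next
  case (Cons a p)
  then show ?case
    using subring_closed[OF N K] embedding_nat_pow[OF N K \<chi> x]
    by (auto simp: linear_mapsD[OF embeddingsD(1)[OF \<chi>]])
qed

lemma embedding_inj_on:
  assumes N: "subfield N R" and K: "K \<subseteq> N" and \<chi>: "\<chi> \<in> embeddings R K N"
  shows "inj_on \<chi> N"
proof (rule inj_onI)
  fix x y assume xy: "x \<in> N" "y \<in> N" "\<chi> x = \<chi> y"
  note [simp] = subring_closed[OF subfieldE(1)[OF N] K]
  note lin = linear_mapsD[OF embeddingsD(1)[OF \<chi>]]
  have d: "x \<ominus> y \<in> N" using xy subringE(5)[OF subfieldE(1)[OF N]] by (simp add: minus_eq)
  have "\<chi> (x \<ominus> y) \<oplus> \<chi> y = \<zero> \<oplus> \<chi> y"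
    using lin(3)[OF d xy(2)] xy lin(1) by (simp add: minus_eq a_assoc l_neg)
  then have 0: "\<chi> (x \<ominus> y) = \<zero>" using lin(1) xy d by (metis add.right_cancel zero_closed)
  show "x = y"
  proof (rule ccontr)
    assume "x \<noteq> y"
    then have "x \<ominus> y \<in> N - {\<zero>}" using d xy r_right_minus_eq by auto
    then have "inv (x \<ominus> y) \<in> N" "(x \<ominus> y) \<otimes> inv (x \<ominus> y) = \<one>" using subfield_m_inv[OF N] by auto
    then have "\<chi> (x \<ominus> y) \<otimes> \<chi> (inv (x \<ominus> y)) = \<one>" using embeddingsD[OF \<chi>] d by metis
    then show False using 0 lin(1) \<open>inv (x \<ominus> y) \<in> N\<close> by simp
  qed
qed

lemma Gal_subset_embeddings: "M \<subseteq> carrier R \<Longrightarrow> Gal R M \<subseteq> embeddings R M (carrier R)"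
  unfolding Gal_def embeddings_def ring_iso_def
  by (auto intro!: linear_mapsI simp: ring_hom_closed ring_hom_add ring_hom_mult ring_hom_one)

text \<open>Surjectivity is the point. An embedding fixes the coefficients of the minimal polynomial
  of \<open>x\<close> over \<open>K\<close>, so it maps the finite set of its roots injectively into
  itself and hence permutes it; \<open>x\<close> is one of these roots.\<close>

lemma embeddings_carrier_eq_Gal:
  assumes normal: "normal_extension R K" and K: "subfield K R" and "K \<subseteq> M" "subring M R"
  shows "embeddings R M (carrier R) = Gal R M"
proof
  have M: "M \<subseteq> carrier R" using subringE(1)[OF assms(4)] .
  then show "Gal R M \<subseteq> embeddings R M (carrier R)" by (rule Gal_subset_embeddings)
  show "embeddings R M (carrier R) \<subseteq> Gal R M"
  proof
    fix \<chi> assume \<chi>: "\<chi> \<in> embeddings R M (carrier R)"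
    note lin = linear_mapsD[OF embeddingsD(1)[OF \<chi>]]
    have inj: "inj_on \<chi> (carrier R)" by (rule embedding_inj_on[OF carrier_is_subfield M \<chi>])
    have "x \<in> \<chi> ` carrier R" if x: "x \<in> carrier R" for x
    proof -
      note D = normal_extensionD[OF normal K x]
      note Irr = IrrE[OF K x D(1)]
      let ?S = "{y. is_root (Irr K x) y}"
      have set_Irr: "set (Irr K x) \<subseteq> M" using Irr(1) assms(3) polynomial_incl unfolding sym[OF univ_poly_carrier] by blast
      have P: "Irr K x \<in> carrier (poly_ring R)"
        using Irr(1) carrier_polynomial_shell[OF subfieldE(1)[OF K]] by blast
      have fin: "finite ?S" by (rule finite_number_of_roots[OF P])
      have "\<chi> (eval (Irr K x) y) = eval (Irr K x) (\<chi> y)" if "y \<in> carrier R" for y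
        using embedding_eval[OF carrier_is_subring M \<chi> that set_Irr] by auto
      then have "\<chi> ` ?S \<subseteq> ?S"
        using lin(1) linear_maps_zero[OF carrier_is_subring M embeddingsD(1)[OF \<chi>]] by (auto simp: is_root_def) metis
      moreover have "inj_on \<chi> ?S" using inj by (rule inj_on_subset) (auto simp: is_root_def)
      ultimately have "\<chi> ` ?S = ?S" using fin by (intro endo_inj_surj) auto
      then show ?thesis using D(3) by (auto simp: is_root_def)
    qed
    then have "bij_betw \<chi> (carrier R) (carrier R)" using inj lin(1) unfolding bij_betw_def by auto
    moreover have "\<chi> \<in> ring_hom R R"
      using lin embeddingsD[OF \<chi>] by (intro ring_hom_memI) auto
    moreover have "\<chi> m = m" if "m \<in> M" for m
      using lin(4)[of m \<one>] that M embeddingsD(2)[OF \<chi>] by auto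
    ultimately show "\<chi> \<in> Gal R M" using lin(2) unfolding Gal_def ring_iso_def by auto
  qed
qed

end

section \<open>The endomorphism algebra\<close>

lemma End_alg_carrier: "carrier (End_alg R M) = linear_maps R M (carrier R)"
  unfolding End_alg_def linear_maps_def by simp

lemma End_alg_ops:
  "f \<otimes>\<^bsub>End_alg R M\<^esub> g = compose (carrier R) f g"
  "\<one>\<^bsub>End_alg R M\<^esub> = (\<lambda>x\<in>carrier R. x)"
  "\<zero>\<^bsub>End_alg R M\<^esub> = zero_map R (carrier R)"
  "f \<oplus>\<^bsub>End_alg R M\<^esub> g = add_map R (carrier R) f g"
  unfolding End_alg_def zero_map_def add_map_def by simp_all

context field
begin

abbreviation End :: "'a set \<Rightarrow> ('a \<Rightarrow> 'a) ring" where
  "End \<equiv> End_alg R"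

abbreviation Lin :: "'a set \<Rightarrow> ('a \<Rightarrow> 'a) set" where
  "Lin M \<equiv> linear_maps R M (carrier R)"

abbreviation Zero :: "'a \<Rightarrow> 'a" where
  "Zero \<equiv> zero_map R (carrier R)"

abbreviation Add :: "('a \<Rightarrow> 'a) \<Rightarrow> ('a \<Rightarrow> 'a) \<Rightarrow> 'a \<Rightarrow> 'a" where
  "Add \<equiv> add_map R (carrier R)"

abbreviation Scale :: "'a \<Rightarrow> ('a \<Rightarrow> 'a) \<Rightarrow> 'a \<Rightarrow> 'a" where
  "Scale \<equiv> scale_map R (carrier R)"

abbreviation Twist :: "'a \<Rightarrow> 'a \<Rightarrow> ('a \<Rightarrow> 'a) \<Rightarrow> 'a \<Rightarrow> 'a" where
  "Twist \<equiv> twist R (carrier R)"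

abbreviation skew_comb :: "'a set \<Rightarrow> (('a \<Rightarrow> 'a) \<Rightarrow> 'a \<Rightarrow> 'a) \<Rightarrow> ('a \<Rightarrow> 'a) set \<Rightarrow> 'a \<Rightarrow> 'a" where
  "skew_comb K d S \<equiv> (\<Oplus>\<^bsub>End K\<^esub>h\<in>S. d h \<otimes>\<^bsub>End K\<^esub> h)"

context
  fixes M assumes M: "M \<subseteq> carrier R"
begin

lemma End_alg_closed: "\<lbrakk> f \<in> carrier (End M); x \<in> carrier R \<rbrakk> \<Longrightarrow> f x \<in> carrier R"
  by (simp add: End_alg_carrier linear_mapsD)

lemma End_alg_eqI:
  assumes "f \<in> carrier (End M)" "g \<in> carrier (End M)" "\<And>x. x \<in> carrier R \<Longrightarrow> f x = g x"
  shows "f = g"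
  using assms linear_maps_eqI unfolding End_alg_carrier by blast

lemma compose_linear:
  assumes "f \<in> Lin M" "g \<in> Lin M"
  shows "compose (carrier R) f g \<in> Lin M"
  using M by (intro linear_mapsI)
    (auto simp: compose_def linear_mapsD[OF assms(1)] linear_mapsD[OF assms(2)] subset_iff)

lemma End_alg_is_ring: "ring (End M)"
proof (rule ringI)
  note M' = M[THEN subsetD]
  show "abelian_group (End M)"
  proof (rule abelian_groupI)
    fix f g h assume f: "f \<in> carrier (End M)" and g: "g \<in> carrier (End M)"
      and h: "h \<in> carrier (End M)"
    note * = linear_mapsD[OF f[unfolded End_alg_carrier]] linear_mapsD[OF g[unfolded End_alg_carrier]]
      linear_mapsD[OF h[unfolded End_alg_carrier]]
    show "f \<oplus>\<^bsub>End M\<^esub> g \<in> carrier (End M)"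
      using f g add_map_linear[OF carrier_is_subring M] by (simp add: End_alg_carrier End_alg_ops)
    show "f \<oplus>\<^bsub>End M\<^esub> g \<oplus>\<^bsub>End M\<^esub> h = f \<oplus>\<^bsub>End M\<^esub> (g \<oplus>\<^bsub>End M\<^esub> h)"
      by (auto simp: End_alg_ops add_map_def * a_assoc intro!: restrict_ext)
    show "f \<oplus>\<^bsub>End M\<^esub> g = g \<oplus>\<^bsub>End M\<^esub> f"
      by (auto simp: End_alg_ops add_map_def * a_comm intro!: restrict_ext)
    show "\<zero>\<^bsub>End M\<^esub> \<oplus>\<^bsub>End M\<^esub> f = f"
      by (rule extensionalityI[OF _ *(2)]) (auto simp: End_alg_ops add_map_def zero_map_def *)
    have "Scale (\<ominus> \<one>) f \<in> carrier (End M)"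
      using f scale_map_linear[OF carrier_is_subring M] by (simp add: End_alg_carrier)
    moreover have "Scale (\<ominus> \<one>) f \<oplus>\<^bsub>End M\<^esub> f = \<zero>\<^bsub>End M\<^esub>"
      by (auto simp: End_alg_ops add_map_def scale_map_def zero_map_def * l_minus l_neg intro!: restrict_ext)
    ultimately show "\<exists>k\<in>carrier (End M). k \<oplus>\<^bsub>End M\<^esub> f = \<zero>\<^bsub>End M\<^esub>" by blast
  next
    show "\<zero>\<^bsub>End M\<^esub> \<in> carrier (End M)"
      using zero_map_linear[OF carrier_is_subring M] by (simp add: End_alg_carrier End_alg_ops)
  qed
  show "monoid (End M)"
  proof (rule monoidI)
    show "\<one>\<^bsub>End M\<^esub> \<in> carrier (End M)"
      unfolding End_alg_carrier End_alg_ops using M' by (intro linear_mapsI) auto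
    fix f g h assume f: "f \<in> carrier (End M)" and g: "g \<in> carrier (End M)"
      and h: "h \<in> carrier (End M)"
    note * = linear_mapsD[OF f[unfolded End_alg_carrier]] linear_mapsD[OF g[unfolded End_alg_carrier]]
      linear_mapsD[OF h[unfolded End_alg_carrier]]
    show "f \<otimes>\<^bsub>End M\<^esub> g \<in> carrier (End M)"
      using compose_linear f g by (simp add: End_alg_carrier End_alg_ops)
    show "f \<otimes>\<^bsub>End M\<^esub> g \<otimes>\<^bsub>End M\<^esub> h = f \<otimes>\<^bsub>End M\<^esub> (g \<otimes>\<^bsub>End M\<^esub> h)"
      by (auto simp: End_alg_ops compose_def * intro!: restrict_ext)
    show "\<one>\<^bsub>End M\<^esub> \<otimes>\<^bsub>End M\<^esub> f = f" "f \<otimes>\<^bsub>End M\<^esub> \<one>\<^bsub>End M\<^esub> = f"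
      by (rule extensionalityI[OF _ *(2)]; auto simp: End_alg_ops compose_def *)+
  qed
  fix f g h assume f: "f \<in> carrier (End M)" and g: "g \<in> carrier (End M)"
    and h: "h \<in> carrier (End M)"
  note * = linear_mapsD[OF f[unfolded End_alg_carrier]] linear_mapsD[OF g[unfolded End_alg_carrier]]
    linear_mapsD[OF h[unfolded End_alg_carrier]]
  show "(f \<oplus>\<^bsub>End M\<^esub> g) \<otimes>\<^bsub>End M\<^esub> h = f \<otimes>\<^bsub>End M\<^esub> h \<oplus>\<^bsub>End M\<^esub> g \<otimes>\<^bsub>End M\<^esub> h"
    "h \<otimes>\<^bsub>End M\<^esub> (f \<oplus>\<^bsub>End M\<^esub> g) = h \<otimes>\<^bsub>End M\<^esub> f \<oplus>\<^bsub>End M\<^esub> h \<otimes>\<^bsub>End M\<^esub> g"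
    by (auto simp: End_alg_ops compose_def add_map_def * intro!: restrict_ext)
qed

lemma End_alg_a_inv:
  assumes f: "f \<in> carrier (End M)"
  shows "\<ominus>\<^bsub>End M\<^esub> f = Scale (\<ominus> \<one>) f"
proof -
  interpret E: ring "End M" by (rule End_alg_is_ring)
  note * = linear_mapsD[OF f[unfolded End_alg_carrier]]
  have g: "Scale (\<ominus> \<one>) f \<in> carrier (End M)"
    using f scale_map_linear[OF carrier_is_subring M] by (simp add: End_alg_carrier)
  moreover have "Scale (\<ominus> \<one>) f \<oplus>\<^bsub>End M\<^esub> f = \<zero>\<^bsub>End M\<^esub>"
    by (auto simp: End_alg_ops add_map_def scale_map_def zero_map_def * l_minus l_neg intro!: restrict_ext)
  ultimately show ?thesis using f E.minus_equality by simp
qed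

lemma mult_op_closed: "l \<in> carrier R \<Longrightarrow> mult_op R l \<in> carrier (End M)"
  unfolding End_alg_carrier mult_op_def using M
  by (intro linear_mapsI) (auto simp: r_distr m_lcomm)

lemma mult_op_hom: "ring_hom_ring R (End M) (mult_op R)"
proof (rule ring_hom_ringI2[OF ring_axioms End_alg_is_ring ring_hom_memI])
  fix x y assume xy: "x \<in> carrier R" "y \<in> carrier R"
  show "mult_op R x \<in> carrier (End M)" by (rule mult_op_closed[OF xy(1)])
  show "mult_op R (x \<otimes> y) = mult_op R x \<otimes>\<^bsub>End M\<^esub> mult_op R y"
    unfolding End_alg_ops mult_op_def compose_def using xy by (intro restrict_ext) (simp add: m_assoc)
  show "mult_op R (x \<oplus> y) = mult_op R x \<oplus>\<^bsub>End M\<^esub> mult_op R y"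
    unfolding End_alg_ops mult_op_def add_map_def using xy by (intro restrict_ext) (simp add: l_distr)
next
  show "mult_op R \<one> = \<one>\<^bsub>End M\<^esub>"
    unfolding End_alg_ops mult_op_def by (intro restrict_ext) simp
qed

lemma mult_op_mult:
  assumes "f \<in> carrier (End M)"
  shows "mult_op R l \<otimes>\<^bsub>End M\<^esub> f = Scale l f"
  unfolding End_alg_ops compose_def scale_map_def
  by (intro restrict_ext) (simp add: mult_op_def End_alg_closed[OF assms])

text \<open>The bridge from the ring operations in the definition of \<open>diff_ops_order\<close>
  to \<open>twist\<close>; the case \<open>c = l\<close> is the commutator.\<close>

lemma End_alg_commutator:
  assumes f: "f \<in> carrier (End M)" and l: "l \<in> carrier R" and c: "c \<in> carrier R"
  shows "f \<otimes>\<^bsub>End M\<^esub> mult_op R l \<ominus>\<^bsub>End M\<^esub> mult_op R c \<otimes>\<^bsub>End M\<^esub> f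
    = Twist l c f"
proof -
  interpret E: ring "End M" by (rule End_alg_is_ring)
  have "mult_op R c \<otimes>\<^bsub>End M\<^esub> f \<in> carrier (End M)"
    using f c mult_op_closed by blast
  note minus = End_alg_a_inv[OF this]
  show ?thesis
    unfolding a_minus_def[of "End M"] minus
    unfolding End_alg_ops compose_def add_map_def scale_map_def twist_def
    using l c by (intro restrict_ext) (simp add: mult_op_def End_alg_closed[OF f] minus_eq l_minus)
qed

lemma mult_op_inj: "inj_on (mult_op R) (carrier R)"
proof (rule inj_onI)
  fix x y assume xy: "x \<in> carrier R" "y \<in> carrier R" "mult_op R x = mult_op R y"
  from xy(3) have "mult_op R x \<one> = mult_op R y \<one>" by simp
  with xy(1,2) show "x = y" by (simp add: mult_op_def)
qed

lemma End_alg_one_not_zero: "\<one>\<^bsub>End M\<^esub> \<noteq> \<zero>\<^bsub>End M\<^esub>"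
proof
  assume "\<one>\<^bsub>End M\<^esub> = \<zero>\<^bsub>End M\<^esub>"
  then have "\<one>\<^bsub>End M\<^esub> \<one> = \<zero>\<^bsub>End M\<^esub> \<one>" by simp
  then show False by (simp add: End_alg_ops zero_map_def)
qed

lemma mult_ops_subfield: "subfield K R \<Longrightarrow> subfield (mult_ops R K) (End M)"
  using ring_hom_ring.img_is_subfield(2)[OF mult_op_hom _ End_alg_one_not_zero] .

lemma linear_of_commutes_mult_ops:
  assumes "f \<in> carrier (End M)"
    and "\<And>l x. \<lbrakk> l \<in> carrier R; x \<in> carrier R \<rbrakk> \<Longrightarrow> f (l \<otimes> x) = l \<otimes> f x"
  shows "f = mult_op R (f \<one>)"
proof (rule End_alg_eqI[OF assms(1)])
  show "mult_op R (f \<one>) \<in> carrier (End M)" using mult_op_closed End_alg_closed[OF assms(1)] by blast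
  fix x assume "x \<in> carrier R"
  then show "f x = mult_op R (f \<one>) x"
    using assms(2)[of x \<one>] End_alg_closed[OF assms(1), of \<one>] by (simp add: mult_op_def m_comm)
qed

end

section \<open>Centralizers of multiplication operators and of sets of endomorphisms\<close>

lemma commutes_mult_op_iff:
  assumes f: "f \<in> Lin K" and m: "m \<in> carrier R"
  shows "f \<otimes>\<^bsub>End K\<^esub> mult_op R m = mult_op R m \<otimes>\<^bsub>End K\<^esub> f \<longleftrightarrow>
    (\<forall>x\<in>carrier R. f (m \<otimes> x) = m \<otimes> f x)"
  using m
  by (auto simp: linear_mapsD(1)[OF f] End_alg_ops compose_def mult_op_def restrict_def fun_eq_iff)

lemma centralizer_mult_ops:
  assumes "K \<subseteq> M" "M \<subseteq> carrier R"
  shows "centralizer (End K) (mult_ops R M) = carrier (End M)"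
proof -
  have "f \<in> Lin M"
    if "f \<in> Lin K" "\<forall>m\<in>M. \<forall>x\<in>carrier R. f (m \<otimes> x) = m \<otimes> f x" for f
    using that unfolding linear_maps_def by auto
  then show ?thesis
    using assms linear_maps_antimono[OF assms(1), of R "carrier R"]
    unfolding centralizer_def End_alg_carrier
    by (auto simp: commutes_mult_op_iff subset_iff linear_mapsD)
qed

lemma field_centralizer_eq:
  assumes "A \<subseteq> Lin K"
  shows "field_centralizer R K A = {m \<in> carrier R. \<forall>a\<in>A. \<forall>x\<in>carrier R. a (m \<otimes> x) = m \<otimes> a x}"
proof -
  have "mult_op R l \<otimes>\<^bsub>End K\<^esub> s = s \<otimes>\<^bsub>End K\<^esub> mult_op R l \<longleftrightarrow>
     (\<forall>x\<in>carrier R. s (l \<otimes> x) = l \<otimes> s x)" if "s \<in> A" "l \<in> carrier R" for s l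
    using commutes_mult_op_iff[of s K l] assms that by (auto simp: eq_commute[of "mult_op R l \<otimes>\<^bsub>End K\<^esub> s"])
  then show ?thesis unfolding field_centralizer_def by auto
qed

section \<open>Density\<close>

lemma add_minus_cancel: "\<lbrakk> x \<in> carrier R; y \<in> carrier R \<rbrakk> \<Longrightarrow> x \<oplus> (y \<oplus> \<ominus> x) = y"
  using a_lcomm[of x y "\<ominus> x"] by (simp add: r_neg)

lemma Span_ConsE:
  assumes "v \<in> Span K (u # Us)"
  obtains k w where "k \<in> K" "w \<in> Span K Us" "v = k \<otimes> u \<oplus> w"
  using assms unfolding Span.simps foldr_Cons o_apply line_extension_mem_iff by blast

text \<open>Extend a basis of \<open>V\<close> by \<open>u\<close> and then to a basis of
  \<open>E\<close>; the functional is the coordinate at \<open>u\<close>. The other basis vectors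
  span a hyperplane \<open>H\<close> that contains \<open>V\<close>.\<close>

lemma exists_functional:
  assumes K: "subfield K R" and E: "dimension n K E" and V: "dimension m K V" "V \<subseteq> E"
    and u: "u \<in> E" "u \<notin> V"
  shows "\<exists>f\<in>linear_maps R K E. f ` E \<subseteq> K \<and> (\<forall>v\<in>V. f v = \<zero>) \<and> f u = \<one>"
proof -
  note E_props = space_subgroup_props[OF K E]
  obtain Vs where Vs: "set Vs \<subseteq> carrier R" "independent K Vs" "Span K Vs = V"
    using exists_base[OF K V(1)] by blast
  have uc: "u \<in> carrier R" using u E_props by blast
  have "independent K (u # Vs)" using Vs u uc by (intro li_Cons) auto
  moreover have "set (u # Vs) \<subseteq> E" using u V(2) Vs Span_base_incl[OF K Vs(1)] by auto
  ultimately obtain Ws where Ws: "independent K (Ws @ (u # Vs))" "Span K (Ws @ (u # Vs)) = E"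
    using complete_base[OF K E] by blast
  have W_car: "set (Ws @ Vs) \<subseteq> carrier R" using independent_in_carrier[OF Ws(1)] by auto
  define H where "H = Span K (Ws @ Vs)"
  have "independent K (u # Ws @ Vs)"
    using independent_same_set[OF K _ _ Ws(1), of "u # Ws @ Vs"] by auto
  then have uH: "u \<notin> H" unfolding H_def using independent_backwards(1) by blast
  have E_eq: "E = line_extension K u H"
    using Span_same_set[OF K, of "Ws @ (u # Vs)" "u # Ws @ Vs"] Ws W_car uc unfolding H_def by auto
  have VH: "V \<subseteq> H" using mono_Span_append(2)[OF K, of Vs Ws] W_car Vs unfolding H_def by auto
  note H_props = Span_subgroup_props[OF K W_car, folded H_def] Span_smult_closed[OF K W_car, folded H_def]
  note K_props = subringE[OF subfieldE(1)[OF K]]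
  have KE: "x \<in> K \<Longrightarrow> x \<in> carrier R" for x using K_props(1) by auto
  have HE: "x \<in> H \<Longrightarrow> x \<in> carrier R" for x using H_props(1) by auto
  \<comment> \<open>Otherwise \<open>(k - k') u\<close> lies in \<open>H\<close>, and dividing by
    \<open>k - k'\<close> puts \<open>u\<close> into \<open>H\<close>.\<close>
  have uniq: "k = k'" if "k \<in> K" "k' \<in> K" "w \<in> H" "w' \<in> H" "k \<otimes> u \<oplus> w = k' \<otimes> u \<oplus> w'" for k k' w w'
  proof (rule ccontr)
    assume "k \<noteq> k'"
    have car: "k \<in> carrier R" "k' \<in> carrier R" "w \<in> carrier R" "w' \<in> carrier R" using that KE HE by auto
    then have "k \<ominus> k' \<in> K - {\<zero>}" using \<open>k \<noteq> k'\<close> that K_props(5,7) by (auto simp: minus_eq r_right_minus_eq[unfolded minus_eq])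
    moreover have "(k \<ominus> k') \<otimes> u = (k \<otimes> u \<oplus> w) \<oplus> (\<ominus> (k' \<otimes> u) \<oplus> \<ominus> w)"
      using car uc by (simp add: ring_normal_form r_neg1 r_neg2)
    then have "(k \<ominus> k') \<otimes> u = w' \<ominus> w"
      unfolding that(5) using car uc by (simp add: ring_normal_form r_neg r_neg1 r_neg2)
    then have "(k \<ominus> k') \<otimes> u \<in> H" using H_props(3,4) that by (simp add: minus_eq)
    ultimately have "u \<in> H"
      using Span_m_inv_simprule[OF K W_car _ uc] unfolding H_def by blast
    with uH show False ..
  qed
  define f where "f = (\<lambda>x\<in>E. THE k. k \<in> K \<and> (\<exists>w\<in>H. x = k \<otimes> u \<oplus> w))"
  have f_eq: "f (k \<otimes> u \<oplus> w) = k" if "k \<in> K" "w \<in> H" for k w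
  proof -
    have "k \<otimes> u \<oplus> w \<in> E" using that E_eq line_extension_mem_iff by auto
    then show ?thesis using that uniq by (auto simp: f_def intro!: the_equality)
  qed
  have decomp: "\<exists>k\<in>K. \<exists>w\<in>H. x = k \<otimes> u \<oplus> w" if "x \<in> E" for x
    using that E_eq line_extension_mem_iff by auto
  have "f \<in> linear_maps R K E"
  proof (rule linear_mapsI)
    show "f \<in> extensional E" by (simp add: f_def)
    show "f x \<in> carrier R" if "x \<in> E" for x using decomp[OF that] f_eq KE by auto
    show "f (x \<oplus> y) = f x \<oplus> f y" if xy: "x \<in> E" "y \<in> E" for x y
    proof -
      obtain k w k' w' where *: "k \<in> K" "w \<in> H" "x = k \<otimes> u \<oplus> w" "k' \<in> K" "w' \<in> H" "y = k' \<otimes> u \<oplus> w'"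
        using decomp xy by metis
      then have "x \<oplus> y = (k \<oplus> k') \<otimes> u \<oplus> (w \<oplus> w')" using KE HE uc by (simp add: ring_normal_form)
      then show ?thesis using * f_eq K_props(7) H_props(3) by simp
    qed
    show "f (k \<otimes> x) = k \<otimes> f x" if kx: "k \<in> K" "x \<in> E" for k x
    proof -
      obtain k' w where *: "k' \<in> K" "w \<in> H" "x = k' \<otimes> u \<oplus> w" using decomp kx by metis
      then have "k \<otimes> x = (k \<otimes> k') \<otimes> u \<oplus> k \<otimes> w" using KE HE uc kx by (simp add: r_distr m_assoc)
      then show ?thesis using * f_eq K_props(6) H_props(5) kx by simp
    qed
  qed
  moreover have "f ` E \<subseteq> K" using decomp f_eq by auto metis
  moreover have "f v = \<zero>" if "v \<in> V" for v
    using f_eq[OF K_props(2), of v] that VH HE uc by auto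
  moreover have "f u = \<one>" using f_eq[OF K_props(3) H_props(2)] uc by simp
  ultimately show ?thesis by blast
qed

lemma field_centralizer_subfield:
  assumes A: "A \<subseteq> Lin K" and K: "K \<subseteq> carrier R"
  shows "subfield (field_centralizer R K A) R"
proof (rule subfieldI')
  note eq = field_centralizer_eq[OF A]
  note lin = linear_mapsD[OF A[THEN subsetD]]
  note zero = linear_maps_zero[OF carrier_is_subring K A[THEN subsetD]]
  show "subring (field_centralizer R K A) R"
  proof (rule subringI)
    fix h assume h: "h \<in> field_centralizer R K A"
    have "a (\<ominus> h \<otimes> x) = \<ominus> h \<otimes> a x" if "a \<in> A" "x \<in> carrier R" for a x
    proof -
      have hx: "h \<in> carrier R" "a (h \<otimes> x) = h \<otimes> a x" using h that by (auto simp: eq)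
      have "a (\<ominus> h \<otimes> x) \<oplus> a (h \<otimes> x) = \<zero>"
        using lin(3)[OF that(1), of "\<ominus> h \<otimes> x" "h \<otimes> x"] hx that zero[OF that(1)] by (simp add: l_minus l_neg)
      then have "a (\<ominus> h \<otimes> x) = \<ominus> (a (h \<otimes> x))"
        using hx that lin(1) by (intro minus_equality[symmetric]) auto
      then show ?thesis using hx lin(1) that by (simp add: l_minus)
    qed
    then show "\<ominus> h \<in> field_centralizer R K A" using h by (auto simp: eq)
  qed (auto simp: eq lin l_distr m_assoc)
  fix k assume k: "k \<in> field_centralizer R K A - {\<zero>}"
  then have k': "k \<in> carrier R" "k \<noteq> \<zero>" by (auto simp: eq)
  then have inv: "inv k \<in> carrier R" "k \<otimes> inv k = \<one>" "inv k \<otimes> k = \<one>" using field_Units by auto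
  have "a (inv k \<otimes> x) = inv k \<otimes> a x" if "a \<in> A" "x \<in> carrier R" for a x
  proof -
    have "a (k \<otimes> (inv k \<otimes> x)) = k \<otimes> a (inv k \<otimes> x)" using k that inv by (auto simp: eq)
    then have "inv k \<otimes> a x = (inv k \<otimes> k) \<otimes> a (inv k \<otimes> x)"
      using inv k' that lin(1) by (simp add: m_assoc[symmetric])
    then show ?thesis using inv that lin(1) by simp
  qed
  then show "inv k \<in> field_centralizer R K A" using inv by (auto simp: eq)
qed

context
  fixes K A
  assumes K: "K \<subseteq> carrier R" and A: "subring A (End K)" and LA: "mult_ops R (carrier R) \<subseteq> A"
begin

lemma subalgebra_linear: "a \<in> A \<Longrightarrow> a \<in> Lin K"
  using subringE(1)[OF A] by (auto simp: End_alg_carrier)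

lemma subalgebra_scale_map: "\<lbrakk> a \<in> A; c \<in> carrier R \<rbrakk> \<Longrightarrow> Scale c a \<in> A"
  using subringE(6)[OF A, of "mult_op R c" a] LA subringE(1)[OF A] mult_op_mult[OF K, of a c]
  by (metis image_subset_iff subsetD)

lemma subalgebra_add_map: "\<lbrakk> a \<in> A; b \<in> A \<rbrakk> \<Longrightarrow> Add a b \<in> A"
  using subringE(7)[OF A, of a b] by (simp add: End_alg_ops)

lemma field_centralizerD:
  assumes "m \<in> field_centralizer R K A"
  shows "m \<in> carrier R" and "\<lbrakk> a \<in> A; x \<in> carrier R \<rbrakk> \<Longrightarrow> a (m \<otimes> x) = m \<otimes> a x"
  using assms field_centralizer_eq[OF subsetI[OF subalgebra_linear]] by auto

lemma subalgebra_compose: "\<lbrakk> a \<in> A; b \<in> A \<rbrakk> \<Longrightarrow> compose (carrier R) a b \<in> A"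
  using subringE(6)[OF A, of a b] by (simp add: End_alg_ops)

text \<open>If every \<open>a \<in> A\<close> killing \<open>V + M u\<close> kills \<open>x\<close>, and \<open>b\<close> kills \<open>V\<close> with \<open>b u = 1\<close>, then \<open>b x\<close>
  commutes with \<open>A\<close>, so \<open>x - (b x) u\<close> is killed by everything that kills \<open>V\<close>.\<close>

lemma density_step:
  assumes V: "V \<subseteq> carrier R" and u: "u \<in> carrier R" and x: "x \<in> carrier R"
    and b: "b \<in> A" "\<And>v. v \<in> V \<Longrightarrow> b v = \<zero>" "b u = \<one>"
    and kill: "\<And>a. \<lbrakk> a \<in> A; \<And>v. v \<in> V \<Longrightarrow> a v = \<zero>; a u = \<zero> \<rbrakk> \<Longrightarrow> a x = \<zero>"
  shows "b x \<in> field_centralizer R K A"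
    and "\<lbrakk> a \<in> A; \<And>v. v \<in> V \<Longrightarrow> a v = \<zero> \<rbrakk> \<Longrightarrow> a x = a u \<otimes> b x"
proof -
  note lin = linear_mapsD[OF subalgebra_linear]
  show main: "a x = a u \<otimes> b x" if a: "a \<in> A" "\<And>v. v \<in> V \<Longrightarrow> a v = \<zero>" for a
  proof -
    \<comment> \<open>\<open>a - (a u) b\<close> kills \<open>V\<close> as well as \<open>u\<close>,
      so \<open>kill\<close> applies to it and yields the formula for \<open>a x\<close>.\<close>
    let ?a = "Add a (Scale (\<ominus> (a u)) b)"
    have au: "a u \<in> carrier R" using a u lin(1) by blast
    have "?a \<in> A" using a b au by (intro subalgebra_add_map subalgebra_scale_map) auto
    moreover have "?a v = \<zero>" if "v \<in> V" for v
      using that V a(2) b(2) au by (auto simp: add_map_def scale_map_def)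
    moreover have "?a u = \<zero>" using u b au by (simp add: add_map_def scale_map_def r_neg)
    ultimately have "?a x = \<zero>" by (rule kill)
    then have "a x \<ominus> a u \<otimes> b x = \<zero>"
      using x lin(1) a b au by (simp add: add_map_def scale_map_def minus_eq l_minus)
    then show ?thesis using x lin(1) a b au by (simp add: r_right_minus_eq)
  qed
  have bx: "b x \<in> carrier R" using lin(1) b x by blast
  have "a (b x \<otimes> l) = b x \<otimes> a l" if a: "a \<in> A" and l: "l \<in> carrier R" for a l
  proof -
    \<comment> \<open>The product \<open>a l b\<close> lies in \<open>A\<close>, kills
      \<open>V\<close> and sends \<open>u\<close> to \<open>a l\<close>. For it \<open>main\<close>
      reads \<open>a (l (b x)) = (a l) (b x)\<close>, which says that \<open>b x\<close> commutes
      with \<open>a\<close>.\<close>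
    let ?c = "compose (carrier R) a (Scale l b)"
    have c: "?c \<in> A" using a b l by (intro subalgebra_compose subalgebra_scale_map) auto
    have zero: "a \<zero> = \<zero>" by (rule linear_maps_zero[OF carrier_is_subring K subalgebra_linear[OF a]])
    have "?c v = \<zero>" if "v \<in> V" for v
      using that V b(2) l zero by (auto simp: compose_def scale_map_def)
    from main[OF c this] show ?thesis
      using x u b l bx lin(1) a by (simp add: compose_def scale_map_def m_comm)
  qed
  then show "b x \<in> field_centralizer R K A"
    using bx subalgebra_linear by (subst field_centralizer_eq) auto
qed

text \<open>Induction on the list. If everything in \<open>A\<close> killing the span of
  \<open>u # Us\<close> also killed \<open>x\<close>, then by \<open>density_step\<close> everything
  killing the span of \<open>Us\<close> would kill \<open>x - m u\<close> with
  \<open>m = b x\<close> in \<open>M\<close>. The induction hypothesis then places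
  \<open>x - m u\<close> in the span of \<open>Us\<close>, so \<open>x\<close> would lie in the
  larger span.\<close>

lemma density:
  defines "M \<equiv> field_centralizer R K A"
  shows "\<lbrakk> independent M Us; x \<in> carrier R; x \<notin> Span M Us \<rbrakk> \<Longrightarrow>
    \<exists>a\<in>A. (\<forall>v\<in>Span M Us. a v = \<zero>) \<and> a x = \<one>"
proof (induction Us arbitrary: x)
  case Nil
  have one: "\<one>\<^bsub>End K\<^esub> \<in> A" by (rule subringE(3)[OF A])
  have "x \<noteq> \<zero>" using Nil by simp
  then have "inv x \<in> carrier R" "inv x \<otimes> x = \<one>" using Nil field_Units by auto
  then have "Scale (inv x) (\<one>\<^bsub>End K\<^esub>) \<in> A"
    "Scale (inv x) (\<one>\<^bsub>End K\<^esub>) x = \<one>"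
    "Scale (inv x) (\<one>\<^bsub>End K\<^esub>) \<zero> = \<zero>"
    using subalgebra_scale_map[OF one] Nil by (auto simp: scale_map_def End_alg_ops)
  then show ?case by auto
next
  case (Cons u Us)
  have M: "subfield M R" unfolding M_def using subalgebra_linear K by (intro field_centralizer_subfield) auto
  have u: "u \<in> carrier R" "u \<notin> Span M Us" "independent M Us"
    using independent_backwards[OF Cons.prems(1)] independent_in_carrier[OF Cons.prems(1)] by auto
  have Us: "set Us \<subseteq> carrier R" using independent_in_carrier[OF u(3)] .
  note V = Span_subgroup_props[OF M Us]
  note lin = linear_mapsD[OF subalgebra_linear]
  obtain b where b: "b \<in> A" "\<And>v. v \<in> Span M Us \<Longrightarrow> b v = \<zero>" "b u = \<one>"
    using Cons.IH[OF u(3) u(1) u(2)] by blast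
  have span: "Span M (u # Us) = line_extension M u (Span M Us)" by simp
  have "\<exists>a\<in>A. (\<forall>v\<in>Span M Us. a v = \<zero>) \<and> a u = \<zero> \<and> a x \<noteq> \<zero>"
  proof (rule ccontr)
    assume "\<not> ?thesis"
    then have kill: "\<And>a. \<lbrakk> a \<in> A; \<And>v. v \<in> Span M Us \<Longrightarrow> a v = \<zero>; a u = \<zero> \<rbrakk> \<Longrightarrow> a x = \<zero>" by blast
    have "b x \<in> field_centralizer R K A"
      by (rule density_step(1)[of "Span M Us" u x b]) (fact V(1) u(1) Cons.prems(2) b kill)+
    then have m: "b x \<in> M" "b x \<in> carrier R" using lin(1)[OF b(1) Cons.prems(2)] unfolding M_def by auto
    have step: "a x = a u \<otimes> b x" if "a \<in> A" "\<And>v. v \<in> Span M Us \<Longrightarrow> a v = \<zero>" for a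
      by (rule density_step(2)[of "Span M Us" u x b]) (fact V(1) u(1) Cons.prems(2) b kill that)+
    let ?y = "x \<ominus> b x \<otimes> u"
    have y: "?y \<in> carrier R" using m u Cons.prems by auto
    have x_eq: "x = b x \<otimes> u \<oplus> ?y" using m(2) u(1) Cons.prems(2) by (simp add: ring_normal_form r_neg r_neg2 r_neg1)
    show False
    proof (cases "?y \<in> Span M Us")
      case True
      then have "x \<in> Span M (u # Us)" using x_eq m unfolding span line_extension_mem_iff by blast
      then show False using Cons.prems by simp
    next
      case False
      \<comment> \<open>The induction hypothesis gives \<open>a ?y = 1\<close>, but \<open>a\<close>
        commutes with \<open>b x\<close>, and \<open>step\<close> then gives
        \<open>a ?y = 0\<close>.\<close>
      then obtain a where a: "a \<in> A" "\<And>v. v \<in> Span M Us \<Longrightarrow> a v = \<zero>" "a ?y = \<one>"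
        using Cons.IH[OF u(3) y] by blast
      have "a x = a (b x \<otimes> u) \<oplus> a ?y" using lin(3)[OF a(1), of "b x \<otimes> u" ?y] m u y x_eq by simp
      also have "a (b x \<otimes> u) = b x \<otimes> a u"
        using field_centralizerD(2)[OF m(1)[unfolded M_def] a(1) u(1)] .
      finally have "a u \<otimes> b x = a u \<otimes> b x \<oplus> \<one>"
        using step[OF a(1,2)] a(3) m lin(1)[OF a(1) u(1)] by (simp add: m_comm)
      then show False using m lin(1)[OF a(1) u(1)] by simp
    qed
  qed
  then obtain a where a: "a \<in> A" "\<forall>v\<in>Span M Us. a v = \<zero>" "a u = \<zero>" "a x \<noteq> \<zero>" by blast
  have ax: "inv (a x) \<in> carrier R" "inv (a x) \<otimes> a x = \<one>" using a(4) lin(1)[OF a(1) Cons.prems(2)] field_Units by auto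
  let ?a = "Scale (inv (a x)) a"
  have "?a v = \<zero>" if v: "v \<in> Span M (u # Us)" for v
  proof -
    obtain k w where kw: "k \<in> M" "w \<in> Span M Us" "v = k \<otimes> u \<oplus> w"
      using Span_ConsE[OF v] .
    have k: "k \<in> carrier R" "a (k \<otimes> u) = k \<otimes> a u"
      using field_centralizerD[OF kw(1)[unfolded M_def]] a(1) u(1) by auto
    have w: "w \<in> carrier R" using kw V(1) by blast
    have "a v = \<zero>" using k a kw w u lin(3)[OF a(1), of "k \<otimes> u" w] by simp
    then show ?thesis using ax k w u kw by (simp add: scale_map_def)
  qed
  moreover have "?a \<in> A" using subalgebra_scale_map[OF a(1) ax(1)] .
  moreover have "?a x = \<one>" using ax Cons.prems by (simp add: scale_map_def)
  ultimately show ?case by blast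
qed

text \<open>Interpolation: an \<open>M\<close>-linear \<open>f\<close> agrees with some element of
  \<open>A\<close> on the span of any independent list, and a basis of \<open>L\<close> over
  \<open>M\<close> is a finite such list.\<close>

lemma Jacobson_Bourbaki:
  defines "M \<equiv> field_centralizer R K A"
  assumes fin: "finite_dimension M (carrier R)"
  shows "A = carrier (End M)"
proof
  have eq: "M = {m \<in> carrier R. \<forall>a\<in>A. \<forall>x\<in>carrier R. a (m \<otimes> x) = m \<otimes> a x}"
    unfolding M_def using subalgebra_linear by (intro field_centralizer_eq) auto
  show sub: "A \<subseteq> carrier (End M)"
    using linear_mapsD[OF subalgebra_linear] unfolding End_alg_carrier by (auto simp: eq intro!: linear_mapsI)
  have M: "subfield M R" unfolding M_def using subalgebra_linear K by (intro field_centralizer_subfield) auto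
  show "carrier (End M) \<subseteq> A"
  proof
    fix f assume f: "f \<in> carrier (End M)"
    note f_lin = linear_mapsD[OF f[unfolded End_alg_carrier]]
    have "independent M Us \<Longrightarrow> \<exists>a\<in>A. \<forall>v\<in>Span M Us. a v = f v" for Us
    proof (induction Us)
      case Nil
      have z: "\<zero>\<^bsub>End K\<^esub> \<in> A" by (rule subringE(2)[OF A])
      moreover have "f \<zero> = \<zero>"
        using linear_maps_zero[OF carrier_is_subring subfieldE(3)[OF M]] f by (simp add: End_alg_carrier)
      ultimately show ?case by (intro bexI[OF _ z]) (simp add: End_alg_ops zero_map_def)
    next
      case (Cons u Us)
      have u: "u \<in> carrier R" "u \<notin> Span M Us" "independent M Us"
        using independent_backwards[OF Cons.prems(1)] independent_in_carrier[OF Cons.prems(1)] by auto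
      have Us: "set Us \<subseteq> carrier R" using independent_in_carrier[OF u(3)] .
      note V = Span_subgroup_props[OF M Us]
      obtain a where a: "a \<in> A" "\<And>v. v \<in> Span M Us \<Longrightarrow> a v = f v" using Cons u by blast
      obtain b where b: "b \<in> A" "\<And>v. v \<in> Span M Us \<Longrightarrow> b v = \<zero>" "b u = \<one>"
        using density[of Us u] u unfolding M_def by blast
      note a_lin = linear_mapsD[OF sub[unfolded End_alg_carrier, THEN subsetD, OF a(1)]]
      note b_lin = linear_mapsD[OF sub[unfolded End_alg_carrier, THEN subsetD, OF b(1)]]
      let ?d = "f u \<ominus> a u"
      have d: "?d \<in> carrier R" using a_lin(1) f_lin(1) u by simp
      \<comment> \<open>A correction in the manner of Newton interpolation: \<open>b\<close>
        vanishes on the old span and is 1 at \<open>u\<close>, so the value at \<open>u\<close> is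
        repaired without disturbing the earlier ones.\<close>
      let ?c = "Add a (Scale ?d b)"
      have "?c v = f v" if v: "v \<in> Span M (u # Us)" for v
      proof -
        obtain k w where kw: "k \<in> M" "w \<in> Span M Us" "v = k \<otimes> u \<oplus> w"
          using Span_ConsE[OF v] .
        have k: "k \<in> carrier R" using kw subfieldE(3)[OF M] by auto
        have w: "w \<in> carrier R" using kw V(1) by blast
        have "?c v = (k \<otimes> a u \<oplus> f w) \<oplus> ?d \<otimes> k"
          using kw k w u a b a_lin b_lin d f_lin by (simp add: add_map_def scale_map_def)
        also have "\<dots> = k \<otimes> f u \<oplus> f w"
          using k w u a_lin(1)[OF u(1)] f_lin(1) by (simp add: ring_normal_form r_neg1 r_neg2 add_minus_cancel)
        also have "\<dots> = f v" using kw k w u f_lin by simp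
        finally show ?thesis .
      qed
      moreover have "?c \<in> A" using a b d by (intro subalgebra_add_map subalgebra_scale_map) auto
      ultimately show ?case by blast
    qed
    moreover obtain Us where "independent M Us" "Span M Us = carrier R"
      using fin exists_base[OF M] by (blast elim: finite_dimensionE')
    ultimately obtain a where "a \<in> A" "\<forall>v\<in>carrier R. a v = f v" by metis
    then show "f \<in> A" using linear_maps_eqI[of a R K "carrier R" f M] subalgebra_linear f by (auto simp: End_alg_carrier)
  qed
qed

end

text \<open>If \<open>x\<close> were outside \<open>M\<close>, some \<open>M\<close>-linear
  functional \<open>f\<close> would kill \<open>M\<close> and have \<open>f x = 1\<close>; commuting
  with multiplication by \<open>x\<close> would force \<open>f x = x (f 1) = 0\<close>.\<close>

lemma field_centralizer_End_alg:
  assumes M: "subfield M R" and "K \<subseteq> M" and fin: "finite_dimension M (carrier R)"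
  shows "field_centralizer R K (carrier (End M)) = M"
proof -
  have sub: "carrier (End M) \<subseteq> Lin K"
    using linear_maps_antimono[OF assms(2)] by (simp add: End_alg_carrier)
  note eq = field_centralizer_eq[OF sub]
  have MR: "M \<subseteq> carrier R" using subfieldE(3)[OF M] .
  obtain n where n: "dimension n M (carrier R)" using fin by (rule finite_dimensionE')
  have "x \<in> M" if x: "x \<in> field_centralizer R K (carrier (End M))" for x
  proof (rule ccontr)
    assume "x \<notin> M"
    moreover have "x \<in> carrier R" using x eq by auto
    ultimately obtain f where f: "f \<in> Lin M" "\<forall>v\<in>M. f v = \<zero>" "f x = \<one>"
      using exists_functional[OF M n dimension_one[OF M] MR] by blast
    then have "f (x \<otimes> \<one>) = x \<otimes> f \<one>" using x unfolding eq by (auto simp: End_alg_carrier)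
    moreover have "f \<one> = \<zero>" using f(2) subringE(3)[OF subfieldE(1)[OF M]] by blast
    ultimately show False using f(3) \<open>x \<in> carrier R\<close> by simp
  qed
  moreover have "M \<subseteq> field_centralizer R K (carrier (End M))"
    unfolding eq using MR by (auto simp: End_alg_carrier linear_mapsD)
  ultimately show ?thesis by blast
qed

end

section \<open>Primary components and differential operators\<close>

text \<open>The generalised eigenspace of \<open>\<chi>\<close>, filtered by how many twists, with
  arbitrary and possibly different \<open>l\<close>, are enough to kill a map. Level 0 is the zero
  space, so differential operators of order at most \<open>n\<close> form level \<open>n + 1\<close>
  for the character \<open>l \<mapsto> l\<close>.\<close>

primrec primary :: "('a, 'b) ring_scheme \<Rightarrow> 'a set \<Rightarrow> ('a \<Rightarrow> 'a) \<Rightarrow> nat \<Rightarrow> ('a \<Rightarrow> 'a) set" where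
  "primary R K \<chi> 0 = {zero_map R (carrier R)}"
| "primary R K \<chi> (Suc n) = {f \<in> linear_maps R K (carrier R).
     \<forall>l\<in>carrier R. twist R (carrier R) l (\<chi> l) f \<in> primary R K \<chi> n}"

lemma primary_cong:
  "(\<And>l. l \<in> carrier R \<Longrightarrow> \<chi> l = \<psi> l) \<Longrightarrow> primary R K \<chi> n = primary R K \<psi> n"
  by (induction n) auto

context field
begin

context
  fixes K assumes K: "K \<subseteq> carrier R"
begin

lemma primary_linear: "f \<in> primary R K \<chi> n \<Longrightarrow> f \<in> Lin K"
  using zero_map_linear[OF carrier_is_subring K] by (cases n) auto

lemma zero_map_primary: "\<chi> \<in> carrier R \<rightarrow> carrier R \<Longrightarrow> Zero \<in> primary R K \<chi> n"
  by (induction n)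
    (auto simp: zero_map_linear[OF carrier_is_subring K] twist_zero_map[OF carrier_is_subring K] Pi_iff)

lemma primary_add_map:
  "\<lbrakk> \<chi> \<in> carrier R \<rightarrow> carrier R; f \<in> primary R K \<chi> n; g \<in> primary R K \<chi> n \<rbrakk> \<Longrightarrow>
     Add f g \<in> primary R K \<chi> n"
proof (induction n arbitrary: f g)
  case 0
  then show ?case by (auto simp: add_map_def zero_map_def intro!: restrict_ext)
next
  case (Suc n)
  then show ?case
    by (auto simp: add_map_linear[OF carrier_is_subring K] twist_add_map[OF carrier_is_subring K] Pi_iff)
qed

lemma primary_scale_map:
  "\<lbrakk> \<chi> \<in> carrier R \<rightarrow> carrier R; f \<in> primary R K \<chi> n; c \<in> carrier R \<rbrakk> \<Longrightarrow>
     Scale c f \<in> primary R K \<chi> n"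
proof (induction n arbitrary: f)
  case 0
  then show ?case by (auto simp: scale_map_zero_map[OF carrier_is_subring K])
next
  case (Suc n)
  then show ?case
    by (auto simp: scale_map_linear[OF carrier_is_subring K] twist_scale_map[OF carrier_is_subring K] Pi_iff)
qed

lemma primary_twist:
  "\<lbrakk> \<chi> \<in> carrier R \<rightarrow> carrier R; f \<in> primary R K \<chi> n; l \<in> carrier R; c \<in> carrier R \<rbrakk> \<Longrightarrow>
     Twist l c f \<in> primary R K \<chi> n"
proof (induction n arbitrary: f)
  case 0
  then show ?case by (auto simp: twist_zero_map[OF carrier_is_subring K])
next
  case (Suc n)
  have "Twist l' (\<chi> l') (Twist l c f) \<in> primary R K \<chi> n"
    if "l' \<in> carrier R" for l'
  proof -
    have "Twist l' (\<chi> l') (Twist l c f)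
        = Twist l c (Twist l' (\<chi> l') f)"
      using Suc.prems that by (intro twist_commute[OF carrier_is_subring K]) auto
    then show ?thesis using Suc that by auto
  qed
  then show ?case using Suc.prems by (auto simp: twist_linear[OF carrier_is_subring K])
qed

lemma primary_mono:
  assumes "\<chi> \<in> carrier R \<rightarrow> carrier R" "n \<le> m"
  shows "primary R K \<chi> n \<subseteq> primary R K \<chi> m"
proof -
  have "primary R K \<chi> n \<subseteq> primary R K \<chi> (Suc n)" for n
  proof (induction n)
    case 0
    then show ?case using zero_map_primary[OF assms(1), of "Suc 0"] by simp
  qed auto
  then show ?thesis using lift_Suc_mono_le[of "primary R K \<chi>"] assms(2) by blast
qed

text \<open>The shift by one comes from the start: level 1 consists of the maps whose commutators
  with \<open>L\<close> vanish. These are \<open>L\<close>-linear, hence multiplications by their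
  value at 1, which is order 0.\<close>

lemma diff_ops_order_eq_primary: "diff_ops_order R K n = primary R K (\<lambda>l. l) (Suc n)"
proof (induction n)
  case 0
  have "f = mult_op R (f \<one>)"
    if f: "f \<in> Lin K"
      and t: "\<And>l. l \<in> carrier R \<Longrightarrow> Twist l l f = Zero" for f
  proof (rule linear_of_commutes_mult_ops[OF K])
    show "f \<in> carrier (End K)" using f by (simp add: End_alg_carrier)
    show "f (l \<otimes> x) = l \<otimes> f x" if "l \<in> carrier R" "x \<in> carrier R" for l x
      using fun_cong[OF t, of l x] that linear_mapsD(1)[OF f]
      by (auto simp: twist_def zero_map_def r_right_minus_eq)
  qed
  then have "f \<in> mult_ops R (carrier R)"
    if "f \<in> Lin K"
      "\<And>l. l \<in> carrier R \<Longrightarrow> Twist l l f = Zero" for f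
    using that linear_mapsD(1)[OF that(1) one_closed] by blast
  moreover have "Twist l l (mult_op R x) = Zero"
    if "l \<in> carrier R" "x \<in> carrier R" for l x
    using that by (auto simp: twist_def mult_op_def zero_map_def m_lcomm[of x l] r_neg minus_eq intro!: restrict_ext)
  ultimately show ?case using mult_op_closed[OF K] by (auto simp: End_alg_carrier)
next
  case (Suc n)
  have "diff_ops_order R K (Suc n) = {f \<in> Lin K.
     \<forall>l\<in>carrier R. Twist l l f \<in> diff_ops_order R K n}"
    using End_alg_commutator[OF K] by (auto simp: End_alg_carrier[symmetric])
  then show ?case unfolding Suc by simp
qed

lemma diff_ops_iff: "f \<in> diff_ops R K \<longleftrightarrow> (\<exists>n. f \<in> primary R K (\<lambda>l. l) n)"
proof -
  have "f \<in> primary R K (\<lambda>l. l) n \<Longrightarrow> f \<in> primary R K (\<lambda>l. l) (Suc n)" for n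
    using primary_mono[of "\<lambda>l. l" n "Suc n"] by auto
  then show ?thesis unfolding diff_ops_def by (auto simp only: diff_ops_order_eq_primary UN_iff UNIV_I bex_simps)
qed

lemma diff_ops_linear: "f \<in> diff_ops R K \<Longrightarrow> f \<in> Lin K"
  using primary_linear unfolding diff_ops_iff by blast

lemma diff_ops_add_map:
  assumes "f \<in> diff_ops R K" "g \<in> diff_ops R K"
  shows "Add f g \<in> diff_ops R K"
proof -
  obtain n m where "f \<in> primary R K (\<lambda>l. l) n" "g \<in> primary R K (\<lambda>l. l) m"
    using assms unfolding diff_ops_iff by blast
  then have "f \<in> primary R K (\<lambda>l. l) (max n m)" "g \<in> primary R K (\<lambda>l. l) (max n m)"
    using primary_mono[of "\<lambda>l. l" n "max n m"] primary_mono[of "\<lambda>l. l" m "max n m"] by auto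
  then show ?thesis using primary_add_map[of "\<lambda>l. l"] unfolding diff_ops_iff by blast
qed

lemma diff_ops_scale_map:
  "\<lbrakk> f \<in> diff_ops R K; c \<in> carrier R \<rbrakk> \<Longrightarrow> Scale c f \<in> diff_ops R K"
  using primary_scale_map[of "\<lambda>l. l"] unfolding diff_ops_iff by blast

lemma diff_ops_mult_op: "l \<in> carrier R \<Longrightarrow> mult_op R l \<in> diff_ops R K"
  unfolding diff_ops_def by (auto intro!: exI[of _ 0])

text \<open>The Leibniz rule \<open>[f g, l] = [f, l] g + f [g, l]\<close>, with induction on the
  sum of the levels. Because of the shift between level and order the bound is one coarser than the
  additivity of orders, but only the union of all levels matters.\<close>

lemma primary_compose:
  "\<lbrakk> f \<in> primary R K (\<lambda>l. l) n; g \<in> primary R K (\<lambda>l. l) m \<rbrakk> \<Longrightarrow>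
     compose (carrier R) f g \<in> primary R K (\<lambda>l. l) (n + m)"
proof (induction "n + m" arbitrary: n m f g)
  case 0
  then show ?case by (auto simp: compose_def zero_map_def intro!: restrict_ext)
next
  case (Suc k)
  note f = primary_linear[OF Suc.prems(1)] and g = primary_linear[OF Suc.prems(2)]
  note fD = linear_mapsD[OF f] and gD = linear_mapsD[OF g]
  have zero: "Zero \<in> primary R K (\<lambda>l. l) k" for k by (rule zero_map_primary) auto
  have "Twist l l (compose (carrier R) f g) \<in> primary R K (\<lambda>l. l) k"
    if l: "l \<in> carrier R" for l
  proof -
    let ?f = "Twist l l f" and ?g = "Twist l l g"
    have 1: "compose (carrier R) ?f g \<in> primary R K (\<lambda>l. l) k"
    \<comment> \<open>At level 0 the factor is zero and its level cannot drop further; the product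
      then vanishes outright.\<close>
    proof (cases n)
      case 0
      then have "compose (carrier R) ?f g = Zero"
        using Suc.prems(1) l by (auto simp: gD(1) compose_def zero_map_def twist_def minus_eq intro!: restrict_ext)
      then show ?thesis using zero by simp
    next
      case (Suc n')
      then have "?f \<in> primary R K (\<lambda>l. l) n'" using Suc.prems(1) l by auto
      then show ?thesis using Suc.hyps(1)[of n' m ?f g] Suc.hyps(2) Suc.prems(2) Suc by auto
    qed
    have 2: "compose (carrier R) f ?g \<in> primary R K (\<lambda>l. l) k"
    proof (cases m)
      case 0
      then have "compose (carrier R) f ?g = Zero"
        using Suc.prems(2) l linear_maps_zero[OF carrier_is_subring K f]
        by (auto simp: compose_def zero_map_def twist_def minus_eq intro!: restrict_ext)
      then show ?thesis using zero by simp
    next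
      case (Suc m')
      then have "?g \<in> primary R K (\<lambda>l. l) m'" using Suc.prems(2) l by auto
      then show ?thesis using Suc.hyps(1)[of n m' f ?g] Suc.hyps(2) Suc.prems(1) Suc by auto
    qed
    have "Twist l l (compose (carrier R) f g)
        = Add (compose (carrier R) ?f g) (compose (carrier R) f ?g)"
    proof -
      have eq: "f (g (l \<otimes> x)) \<ominus> l \<otimes> f (g x) = (f (l \<otimes> g x) \<ominus> l \<otimes> f (g x)) \<oplus> f (g (l \<otimes> x) \<ominus> l \<otimes> g x)"
        if x: "x \<in> carrier R" for x
      proof -
        have car: "g (l \<otimes> x) \<in> carrier R" "l \<otimes> g x \<in> carrier R" using l x by (simp_all add: gD(1))
        then have "f (g (l \<otimes> x)) = f ((g (l \<otimes> x) \<ominus> l \<otimes> g x) \<oplus> l \<otimes> g x)"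
          by (simp add: minus_eq a_assoc l_neg)
        also have "\<dots> = f (g (l \<otimes> x) \<ominus> l \<otimes> g x) \<oplus> f (l \<otimes> g x)" using fD(3) car by simp
        finally show ?thesis
          using fD(1)[OF car(2)] fD(1)[of "g (l \<otimes> x) \<ominus> l \<otimes> g x"] fD(1)[OF gD(1)[OF x]] car l
          by (simp add: minus_eq a_ac)
      qed
      show ?thesis
        unfolding twist_def add_map_def using l by (intro restrict_ext) (simp add: compose_eq gD(1) eq)
    qed
    then show ?thesis using primary_add_map[OF _ 1 2] by auto
  qed
  then show ?case using compose_linear[OF K f g] unfolding Suc.hyps(2)[symmetric] by simp
qed

lemma diff_ops_compose:
  "\<lbrakk> f \<in> diff_ops R K; g \<in> diff_ops R K \<rbrakk> \<Longrightarrow> compose (carrier R) f g \<in> diff_ops R K"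
  using primary_compose unfolding diff_ops_iff by blast

lemma GalD:
  assumes "g \<in> Gal R K"
  shows "g \<in> Lin K" and "x \<in> carrier R \<Longrightarrow> g x \<in> carrier R"
    and "\<lbrakk> x \<in> carrier R; y \<in> carrier R \<rbrakk> \<Longrightarrow> g (x \<otimes> y) = g x \<otimes> g y"
    and "g \<one> = \<one>" and "m \<in> K \<Longrightarrow> g m = m"
  using Gal_subset_embeddings[OF K] embeddingsD[of g R K "carrier R"] linear_mapsD(1)[of g R K "carrier R"] assms
  by (auto simp: Gal_def)

text \<open>Since \<open>g (l x) = g l (g x)\<close>, twisting \<open>f g\<close> by
  \<open>l\<close> amounts to twisting \<open>f\<close> by \<open>g l\<close> and then composing
  with \<open>g\<close>. With \<open>\<chi>\<close> the identity this carries differential operators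
  to the component of \<open>g\<close>.\<close>

lemma primary_compose_Gal:
  assumes g: "g \<in> Gal R K"
  shows "f \<in> primary R K \<chi> n \<Longrightarrow> compose (carrier R) f g \<in> primary R K (\<lambda>l. \<chi> (g l)) n"
proof (induction n arbitrary: f)
  case 0
  then show ?case by (auto simp: GalD(2)[OF g] compose_def zero_map_def intro!: restrict_ext)
next
  case (Suc n)
  have "Twist l (\<chi> (g l)) (compose (carrier R) f g)
      = compose (carrier R) (Twist (g l) (\<chi> (g l)) f) g" if "l \<in> carrier R" for l
    unfolding twist_def compose_def using that by (intro restrict_ext) (simp add: GalD[OF g])
  then show ?case
    using Suc by (auto simp: GalD(2)[OF g] compose_linear[OF K _ GalD(1)[OF g]])
qed

text \<open>The counterpart on the target side: \<open>g\<close> passes through the twist and is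
  applied to the eigenvalue. Together with \<open>primary_compose_Gal\<close> it controls
  conjugation.\<close>

lemma primary_Gal_compose:
  assumes g: "g \<in> Gal R K" and \<chi>: "\<chi> \<in> carrier R \<rightarrow> carrier R"
  shows "f \<in> primary R K \<chi> n \<Longrightarrow> compose (carrier R) g f \<in> primary R K (\<lambda>l. g (\<chi> l)) n"
proof (induction n arbitrary: f)
  case 0
  then show ?case using linear_maps_zero[OF carrier_is_subring K GalD(1)[OF g]]
    by (auto simp: compose_def zero_map_def intro!: restrict_ext)
next
  case (Suc n)
  then have f: "f \<in> Lin K" by simp
  have "Twist l (g (\<chi> l)) (compose (carrier R) g f)
      = compose (carrier R) g (Twist l (\<chi> l) f)" if l: "l \<in> carrier R" for l
  proof -
    have "g (f (l \<otimes> x)) \<ominus> g (\<chi> l) \<otimes> g (f x) = g (f (l \<otimes> x) \<ominus> \<chi> l \<otimes> f x)" if x: "x \<in> carrier R" for x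
    proof -
      have car: "f (l \<otimes> x) \<in> carrier R" "\<chi> l \<otimes> f x \<in> carrier R" "\<chi> l \<in> carrier R" "f x \<in> carrier R"
        using l x \<chi> by (auto simp: linear_mapsD(1)[OF f])
      have "g (f (l \<otimes> x)) = g ((f (l \<otimes> x) \<ominus> \<chi> l \<otimes> f x) \<oplus> \<chi> l \<otimes> f x)"
        using car by (simp add: minus_eq a_assoc l_neg)
      also have "\<dots> = g (f (l \<otimes> x) \<ominus> \<chi> l \<otimes> f x) \<oplus> g (\<chi> l) \<otimes> g (f x)"
        using linear_mapsD(3)[OF GalD(1)[OF g]] GalD(3)[OF g] car by simp
      finally show ?thesis using car by (simp add: GalD(2)[OF g] minus_eq a_assoc r_neg)
    qed
    then show ?thesis
      unfolding twist_def compose_def using l by (intro restrict_ext) (simp add: linear_mapsD(1)[OF f])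
  qed
  then show ?case
    using Suc by (auto simp: compose_linear[OF K GalD(1)[OF g]])
qed

end

lemma primary_restrict:
  assumes "K \<subseteq> M" "M \<subseteq> carrier R" and \<chi>: "\<chi> \<in> carrier R \<rightarrow> carrier R"
  shows "primary R M \<chi> n = primary R K \<chi> n \<inter> Lin M"
proof (induction n)
  case 0
  then show ?case using zero_map_linear[OF carrier_is_subring assms(2)] by auto
next
  case (Suc n)
  have "Twist l (\<chi> l) f \<in> Lin M"
    if "f \<in> Lin M" "l \<in> carrier R" for l f
    using twist_linear[OF carrier_is_subring assms(2) that] \<chi> that(2) by blast
  then show ?case using Suc linear_maps_antimono[OF assms(1), of R "carrier R"] by auto
qed

lemma diff_ops_restrict:
  assumes "K \<subseteq> M" "M \<subseteq> carrier R"
  shows "diff_ops R M = diff_ops R K \<inter> Lin M"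
  using primary_restrict[OF assms, of "\<lambda>l. l"] assms by (auto simp: diff_ops_iff)

section \<open>Independence of the primary components\<close>

lemma twist_finsum:
  assumes K: "K \<subseteq> carrier R" and l: "l \<in> carrier R" and c: "c \<in> carrier R"
    and \<delta>: "\<And>h. h \<in> S \<Longrightarrow> \<delta> h \<in> Lin K" and "finite S"
  shows "Twist l c (finsum (End K) \<delta> S) =
    finsum (End K) (\<lambda>h. Twist l c (\<delta> h)) S"
  using assms(5) \<delta>
proof (induction S rule: finite_induct)
  interpret E: ring "End K" by (rule End_alg_is_ring[OF K])
  case empty
  show ?case using twist_zero_map[OF carrier_is_subring K l c] by (simp add: End_alg_ops(3))
next
  interpret E: ring "End K" by (rule End_alg_is_ring[OF K])
  case (insert h S)
  have lin: "\<delta> h \<in> carrier (End K)" "\<delta> \<in> S \<rightarrow> carrier (End K)"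
    using insert.prems by (auto simp: End_alg_carrier)
  then have sum: "finsum (End K) \<delta> S \<in> carrier (End K)" by (intro E.finsum_closed)
  have t: "Twist l c (\<delta> h) \<in> carrier (End K)"
    "(\<lambda>h. Twist l c (\<delta> h)) \<in> S \<rightarrow> carrier (End K)"
    using insert.prems twist_linear[OF carrier_is_subring K _ l c] by (auto simp: End_alg_carrier)
  show ?case
    using insert t lin sum twist_add_map[OF carrier_is_subring K _ _ l c]
    by (simp add: End_alg_ops(4) End_alg_carrier)
qed

text \<open>A version of Dedekind's independence of characters for generalised eigenvectors, by
  induction on the total level. A twist belonging to \<open>h0\<close> lowers the level of that
  component and raises no other, so by induction it kills every component. If two components were
  nonzero, one nonzero map would be an eigenvector for two characters, which must then agree; so at
  most one is nonzero, and it equals the vanishing sum.\<close>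

lemma primary_independent:
  assumes K: "K \<subseteq> carrier R" and "finite S"
    and S: "\<And>h. h \<in> S \<Longrightarrow> h \<in> carrier R \<rightarrow>\<^sub>E carrier R"
  shows "\<lbrakk> \<And>h. h \<in> S \<Longrightarrow> \<delta> h \<in> primary R K h (n h);
     finsum (End K) \<delta> S = \<zero>\<^bsub>End K\<^esub> \<rbrakk> \<Longrightarrow> \<forall>h\<in>S. \<delta> h = \<zero>\<^bsub>End K\<^esub>"
proof (induction "sum n S" arbitrary: n \<delta> rule: less_induct)
  case less
  interpret E: ring "End K" by (rule End_alg_is_ring[OF K])
  have lin: "\<delta> h \<in> Lin K" if "h \<in> S" for h
    by (rule primary_linear[OF K less.prems(1)[OF that]])
  have S': "h \<in> carrier R \<rightarrow> carrier R" if "h \<in> S" for h using S[OF that] by auto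
  have step: "Twist l (h0 l) (\<delta> h) = \<zero>\<^bsub>End K\<^esub>"
    if h0: "h0 \<in> S" "n h0 > 0" and l: "l \<in> carrier R" and h: "h \<in> S" for h0 h l
  proof -
    let ?\<delta> = "\<lambda>h. Twist l (h0 l) (\<delta> h)" and ?n = "n(h0 := n h0 - 1)"
    have c: "h0 l \<in> carrier R" using S'[OF h0(1)] l by auto
    have "sum ?n S < sum n S" using h0 \<open>finite S\<close> by (intro sum_strict_mono_ex1) auto
    moreover have "?\<delta> h \<in> primary R K h (?n h)" if "h \<in> S" for h
    proof (cases "h = h0")
      case True
      then show ?thesis using less.prems(1)[OF that] h0(2) l by (cases "n h0") auto
    next
      case False
      then show ?thesis using primary_twist[OF K S'[OF that] less.prems(1)[OF that] l c] by simp
    qed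
    moreover have "finsum (End K) ?\<delta> S = \<zero>\<^bsub>End K\<^esub>"
      using twist_finsum[where \<delta> = \<delta>, OF K l c lin \<open>finite S\<close>] less.prems(2) twist_zero_map[OF carrier_is_subring K l c]
      by (simp add: End_alg_ops(3))
    ultimately have "\<forall>h\<in>S. ?\<delta> h = \<zero>\<^bsub>End K\<^esub>" by (rule less.hyps)
    then show ?thesis using h by blast
  qed
  show ?case
  proof (rule ccontr)
    assume "\<not> ?case"
    then obtain h1 where h1: "h1 \<in> S" "\<delta> h1 \<noteq> \<zero>\<^bsub>End K\<^esub>" by blast
    have pos: "n h > 0" if "h \<in> S" "\<delta> h \<noteq> \<zero>\<^bsub>End K\<^esub>" for h
      using less.prems(1)[OF that(1)] that(2) by (cases "n h") (auto simp: End_alg_ops)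
    obtain x where x: "x \<in> carrier R" "\<delta> h1 x \<noteq> \<zero>"
      using linear_maps_eqI[OF lin[OF h1(1)] zero_map_linear[OF carrier_is_subring K]] h1(2)
      by (auto simp: zero_map_def End_alg_ops)
    have "\<delta> h = \<zero>\<^bsub>End K\<^esub>" if h: "h \<in> S" "h \<noteq> h1" for h
    proof (rule ccontr)
      assume "\<delta> h \<noteq> \<zero>\<^bsub>End K\<^esub>"
      then have n: "n h > 0" "n h1 > 0" using pos h h1 by auto
      \<comment> \<open>Both \<open>h\<close> and \<open>h1\<close> have positive level, so
        \<open>step\<close> makes the nonzero map \<open>\<delta> h1\<close> an eigenvector for
        either character.\<close>
      have "h l = h1 l" if l: "l \<in> carrier R" for l
      proof -
        have car: "h l \<in> carrier R" "h1 l \<in> carrier R" "\<delta> h1 x \<in> carrier R" "\<delta> h1 (l \<otimes> x) \<in> carrier R"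
          using S'[OF h(1)] S'[OF h1(1)] l x by (auto simp: linear_mapsD(1)[OF lin[OF h1(1)]])
        have "\<delta> h1 (l \<otimes> x) = h l \<otimes> \<delta> h1 x" "\<delta> h1 (l \<otimes> x) = h1 l \<otimes> \<delta> h1 x"
          using fun_cong[OF step[OF h(1) n(1) l h1(1)], of x] fun_cong[OF step[OF h1(1) n(2) l h1(1)], of x] x car
          by (auto simp: twist_def End_alg_ops zero_map_def r_right_minus_eq)
        then show ?thesis using m_rcancel[OF x(2)] car by simp
      qed
      then have "h = h1" by (rule PiE_ext[OF S[OF h(1)] S[OF h1(1)]])
      with h(2) show False ..
    qed
    then have "finsum (End K) \<delta> S = finsum (End K) (\<lambda>h. if h1 = h then \<delta> h else \<zero>\<^bsub>End K\<^esub>) S"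
      using lin h1 by (intro E.finsum_cong') (auto simp: End_alg_carrier[symmetric])
    also have "\<dots> = \<delta> h1" using h1 \<open>finite S\<close> lin by (intro E.finsum_singleton) (auto simp: End_alg_carrier)
    finally show False using less.prems(2) h1(2) by simp
  qed
qed

end

section \<open>The skew group algebra decomposition\<close>

lemma Gal_antimono: "K \<subseteq> M \<Longrightarrow> Gal R M \<subseteq> Gal R K"
  unfolding Gal_def by auto

lemma Gal_fixing_eq: "K \<subseteq> M \<Longrightarrow> Gal_fixing R K M = Gal R M"
  unfolding Gal_fixing_def Gal_def by auto

context field
begin

context
  fixes K assumes K: "K \<subseteq> carrier R"
begin

section \<open>The Galois group, differential operators and skew sums inside the endomorphism
  ring\<close>

definition Gal_inv :: "('a \<Rightarrow> 'a) \<Rightarrow> 'a \<Rightarrow> 'a" where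
  "Gal_inv g = (\<lambda>x\<in>carrier R. inv_into (carrier R) g x)"

lemma Gal_inv:
  assumes g: "g \<in> Gal R K"
  shows "Gal_inv g \<in> Gal R K" and "x \<in> carrier R \<Longrightarrow> g (Gal_inv g x) = x"
    and "x \<in> carrier R \<Longrightarrow> Gal_inv g (g x) = x"
proof -
  have bij: "bij_betw g (carrier R) (carrier R)" using g by (simp add: Gal_def ring_iso_def)
  have inv_closed: "Gal_inv g x \<in> carrier R" if "x \<in> carrier R" for x
    using bij_betwE[OF bij_betw_inv_into[OF bij]] that by (simp add: Gal_inv_def)
  show gi: "g (Gal_inv g x) = x" if "x \<in> carrier R" for x
    using bij_betw_inv_into_right[OF bij] that by (simp add: Gal_inv_def)
  show ig: "Gal_inv g (g x) = x" if "x \<in> carrier R" for x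
    using bij_betw_inv_into_left[OF bij] that GalD(2)[OF K g that] by (simp add: Gal_inv_def)
  have eqI: "Gal_inv g y = x" if "g x = y" "x \<in> carrier R" for x y using ig that by auto
  have "bij_betw (Gal_inv g) (carrier R) (carrier R)"
    using bij_betw_inv_into[OF bij] by (rule bij_betw_cong[THEN iffD1, rotated]) (simp add: Gal_inv_def)
  moreover have "Gal_inv g \<in> ring_hom R R"
  proof (rule ring_hom_memI)
    show "Gal_inv g (x \<otimes> y) = Gal_inv g x \<otimes> Gal_inv g y" if "x \<in> carrier R" "y \<in> carrier R" for x y
      using that by (intro eqI) (simp_all add: GalD(3)[OF K g] gi inv_closed)
    show "Gal_inv g (x \<oplus> y) = Gal_inv g x \<oplus> Gal_inv g y" if "x \<in> carrier R" "y \<in> carrier R" for x y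
      using that by (intro eqI) (simp_all add: linear_mapsD(3)[OF GalD(1)[OF K g]] gi inv_closed)
    show "Gal_inv g \<one> = \<one>" by (rule eqI) (simp_all add: GalD(4)[OF K g])
  qed (rule inv_closed)
  moreover have "Gal_inv g m = m" if "m \<in> K" for m
    by (rule eqI) (use that K in \<open>auto simp: GalD(5)[OF K g]\<close>)
  ultimately show "Gal_inv g \<in> Gal R K" by (auto simp: Gal_def ring_iso_def Gal_inv_def)
qed

lemma Gal_closed: "g \<in> Gal R K \<Longrightarrow> g \<in> carrier (End K)"
  using GalD(1)[OF K] by (simp add: End_alg_carrier)

lemma Gal_inv_compose:
  assumes g: "g \<in> Gal R K"
  shows "g \<otimes>\<^bsub>End K\<^esub> Gal_inv g = \<one>\<^bsub>End K\<^esub>"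
    and "Gal_inv g \<otimes>\<^bsub>End K\<^esub> g = \<one>\<^bsub>End K\<^esub>"
  unfolding End_alg_ops compose_def
  by (auto intro!: restrict_ext simp: Gal_inv(2,3)[OF g])

lemma Gal_Units: "g \<in> Gal R K \<Longrightarrow> g \<in> Units (End K)"
  unfolding Units_def using Gal_closed Gal_inv(1) Gal_inv_compose by blast

lemma Gal_m_inv:
  assumes g: "g \<in> Gal R K"
  shows "inv\<^bsub>End K\<^esub> g = Gal_inv g"
proof -
  interpret E: ring "End K" by (rule End_alg_is_ring[OF K])
  show ?thesis
    using E.inv_char[OF Gal_closed[OF g] Gal_closed[OF Gal_inv(1)[OF g]] Gal_inv_compose[OF g]] .
qed

lemma Gal_mult_closed:
  assumes "g \<in> Gal R K" "h \<in> Gal R K"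
  shows "g \<otimes>\<^bsub>End K\<^esub> h \<in> Gal R K"
proof -
  have "bij_betw (g \<circ> h) (carrier R) (carrier R)"
    by (rule bij_betw_trans) (use assms in \<open>auto simp: Gal_def ring_iso_def\<close>)
  moreover have "bij_betw (compose (carrier R) g h) (carrier R) (carrier R) =
      bij_betw (g \<circ> h) (carrier R) (carrier R)"
    by (rule bij_betw_cong) (simp add: compose_eq)
  ultimately have "bij_betw (compose (carrier R) g h) (carrier R) (carrier R)" by simp
  moreover have "compose (carrier R) g h \<in> ring_hom R R"
    by (rule ring_hom_memI)
      (simp_all add: compose_eq GalD(2-4)[OF K assms(1)] GalD(2-4)[OF K assms(2)]
        linear_mapsD(3)[OF GalD(1)[OF K assms(1)]] linear_mapsD(3)[OF GalD(1)[OF K assms(2)]])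
  moreover have "compose (carrier R) g h m = m" if "m \<in> K" for m
    using that K by (simp add: compose_eq subset_iff GalD(5)[OF K assms(1)] GalD(5)[OF K assms(2)])
  ultimately show ?thesis by (simp add: Gal_def ring_iso_def End_alg_ops(1) compose_def)
qed

lemma Gal_subgroup:
  assumes "K \<subseteq> M" "M \<subseteq> carrier R"
  shows "subgroup (Gal R M) (units_of (End K))"
proof -
  interpret E: ring "End K" by (rule End_alg_is_ring[OF K])
  note sub = Gal_antimono[OF assms(1), THEN subsetD]
  show ?thesis
  proof
    show "Gal R M \<subseteq> carrier (units_of (End K))" using Gal_Units sub by (auto simp: units_of_carrier)
    show "g \<otimes>\<^bsub>units_of (End K)\<^esub> h \<in> Gal R M" if "g \<in> Gal R M" "h \<in> Gal R M" for g h
      using Gal_mult_closed[OF sub[OF that(1)] sub[OF that(2)]] that assms(2)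
      by (simp add: units_of_mult Gal_def End_alg_ops(1) compose_eq subset_iff)
    have "(\<lambda>x\<in>carrier R. x) \<in> Gal R M"
      using assms(2) by (auto simp: Gal_def ring_iso_def bij_betw_def inj_on_def intro!: ring_hom_memI)
    then show "\<one>\<^bsub>units_of (End K)\<^esub> \<in> Gal R M" by (simp add: units_of_one End_alg_ops)
    show "inv\<^bsub>units_of (End K)\<^esub> g \<in> Gal R M" if g: "g \<in> Gal R M" for g
    proof -
      have "Gal_inv g m = m" if "m \<in> M" for m
        using Gal_inv(3)[OF sub[OF g], of m] g that assms(2) by (auto simp: Gal_def)
      then show ?thesis
        using Gal_inv(1)[OF sub[OF g]] by (simp add: E.units_of_inv Gal_Units[OF sub[OF g]] Gal_m_inv[OF sub[OF g]] Gal_def)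
    qed
  qed
qed

text \<open>Stability under left multiplication by all of \<open>L\<close> is asked, which covers
  both the scalars from \<open>K\<close> and, through the scalar -1, additive inverses.\<close>

lemma is_subalgebraI:
  assumes A: "A \<subseteq> carrier (End K)" and one: "\<one>\<^bsub>End K\<^esub> \<in> A"
    and add: "\<And>f g. \<lbrakk> f \<in> A; g \<in> A \<rbrakk> \<Longrightarrow> Add f g \<in> A"
    and mult: "\<And>f g. \<lbrakk> f \<in> A; g \<in> A \<rbrakk> \<Longrightarrow> compose (carrier R) f g \<in> A"
    and scale: "\<And>f c. \<lbrakk> f \<in> A; c \<in> carrier R \<rbrakk> \<Longrightarrow> Scale c f \<in> A"
  shows "is_subalgebra R K A"
proof -
  interpret E: ring "End K" by (rule End_alg_is_ring[OF K])
  have "subring A (End K)"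
  proof (rule E.subringI[OF A one])
    show "\<ominus>\<^bsub>End K\<^esub> f \<in> A" if "f \<in> A" for f
      using that A End_alg_a_inv[OF K, of f] scale[OF that, of "\<ominus> \<one>"] by auto
  qed (use add mult in \<open>auto simp: End_alg_ops\<close>)
  moreover have "subalgebra (mult_ops R K) A (End K)"
  proof (rule subalgebra.intro)
    show "subgroup A (add_monoid (End K))" by (rule subring.axioms(1)[OF \<open>subring A (End K)\<close>])
    have "mult_op R k \<otimes>\<^bsub>End K\<^esub> v \<in> A" if "k \<in> K" "v \<in> A" for k v
      using mult_op_mult[OF K subsetD[OF A that(2)], of k] scale[OF that(2), of k] that(1) K by auto
    then show "subalgebra_axioms (mult_ops R K) A (End K)" by unfold_locales auto
  qed
  ultimately show ?thesis by (simp add: is_subalgebra_def)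
qed

lemma finsum_closed_subset:
  assumes A: "A \<subseteq> carrier (End K)" "\<zero>\<^bsub>End K\<^esub> \<in> A"
    and add: "\<And>f g. \<lbrakk> f \<in> A; g \<in> A \<rbrakk> \<Longrightarrow> Add f g \<in> A"
    and "finite S" "\<And>s. s \<in> S \<Longrightarrow> f s \<in> A"
  shows "finsum (End K) f S \<in> A"
  using assms(4,5)
proof (induction S rule: finite_induct)
  interpret E: ring "End K" by (rule End_alg_is_ring[OF K])
  case empty
  then show ?case using A by simp
next
  interpret E: ring "End K" by (rule End_alg_is_ring[OF K])
  case (insert s S)
  then have "f \<in> S \<rightarrow> carrier (End K)" "f s \<in> carrier (End K)" using A by auto
  with insert show ?case by (simp add: End_alg_ops(4)[symmetric] E.finsum_insert) (simp add: End_alg_ops(4) add)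
qed

context
  fixes M assumes KM: "K \<subseteq> M" and M: "M \<subseteq> carrier R"
begin

lemma linear_maps_subset: "Lin M \<subseteq> carrier (End K)"
  using linear_maps_antimono[OF KM] by (simp add: End_alg_carrier)

lemma one_linear: "\<one>\<^bsub>End K\<^esub> \<in> Lin M"
  unfolding End_alg_ops using M by (intro linear_mapsI) auto

lemma End_alg_subalgebra: "is_subalgebra R K (carrier (End M))"
  unfolding End_alg_carrier
  using linear_maps_subset one_linear add_map_linear[OF carrier_is_subring M] compose_linear[OF M]
    scale_map_linear[OF carrier_is_subring M]
  by (intro is_subalgebraI) auto

lemma diff_ops_subalgebra: "is_subalgebra R K (diff_ops R M)"
proof (rule is_subalgebraI)
  show "diff_ops R M \<subseteq> carrier (End K)"
    using diff_ops_linear[OF M] linear_maps_subset by blast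
  have "mult_op R \<one> = \<one>\<^bsub>End K\<^esub>"
    unfolding End_alg_ops mult_op_def by (intro restrict_ext) simp
  then show "\<one>\<^bsub>End K\<^esub> \<in> diff_ops R M" using diff_ops_mult_op[OF M one_closed] by simp
qed (use diff_ops_add_map[OF M] diff_ops_compose[OF M] diff_ops_scale_map[OF M] in auto)

lemma diff_ops_comm_eq: "diff_ops_comm R K M = diff_ops R M"
proof -
  have "f \<in> Lin M \<longleftrightarrow>
      (\<forall>m\<in>M. f \<otimes>\<^bsub>End K\<^esub> mult_op R m = mult_op R m \<otimes>\<^bsub>End K\<^esub> f)"
    if f: "f \<in> diff_ops R K" for f
  proof -
    have lin: "f \<in> Lin K" by (rule diff_ops_linear[OF K f])
    have "f \<in> Lin M \<longleftrightarrow> (\<forall>m\<in>M. \<forall>x\<in>carrier R. f (m \<otimes> x) = m \<otimes> f x)"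
      using lin by (auto simp: linear_maps_def)
    then show ?thesis using commutes_mult_op_iff[OF lin] M by blast
  qed
  then show ?thesis
    unfolding diff_ops_comm_def diff_ops_restrict[OF KM M] by blast
qed

text \<open>Conjugation by \<open>h\<close> changes the character \<open>l \<mapsto> l\<close> into
  \<open>h\<close> after its own inverse, which is the same character, so it preserves
  \<open>D\<close>. For directness, \<open>d h\<close> composed with \<open>h\<close> is primary for
  the character \<open>h\<close>; \<open>primary_independent\<close> kills each summand, and the
  invertible \<open>h\<close> can be cancelled.\<close>

lemma skew_group_algebra: "is_skew_group_algebra R K (diff_ops R M) (Gal R M)"
proof -
  interpret E: ring "End K" by (rule End_alg_is_ring[OF K])
  note sub = Gal_antimono[OF KM, THEN subsetD]
  have conj: "h \<otimes>\<^bsub>End K\<^esub> d \<otimes>\<^bsub>End K\<^esub> inv\<^bsub>End K\<^esub> h \<in> diff_ops R M"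
    if h: "h \<in> Gal R M" and d: "d \<in> diff_ops R M" for h d
  proof -
    have h': "Gal_inv h \<in> Gal R M"
      using subgroup.m_inv_closed[OF Gal_subgroup[OF KM M] h]
      by (simp add: E.units_of_inv Gal_Units[OF sub[OF h]] Gal_m_inv[OF sub[OF h]])
    obtain n where n: "d \<in> primary R M (\<lambda>l. l) n" using d diff_ops_iff[OF M] by blast
    have "compose (carrier R) (compose (carrier R) h d) (Gal_inv h) \<in> primary R M (\<lambda>l. h (Gal_inv h l)) n"
      using primary_compose_Gal[OF M h' primary_Gal_compose[OF M h _ n]] by simp
    also have "primary R M (\<lambda>l. h (Gal_inv h l)) n = primary R M (\<lambda>l. l) n"
      using Gal_inv(2)[OF sub[OF h]] by (rule primary_cong)
    finally show ?thesis using Gal_m_inv[OF sub[OF h]] diff_ops_iff[OF M] by (auto simp: End_alg_ops)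
  qed
  have direct: "\<forall>h\<in>S. d h = \<zero>\<^bsub>End K\<^esub>"
    if S: "finite S" "S \<subseteq> Gal R M" and d: "d \<in> S \<rightarrow> diff_ops R M"
      and sum: "skew_comb K d S = \<zero>\<^bsub>End K\<^esub>" for S d
  proof -
    have hK: "h \<in> Gal R K" if "h \<in> S" for h using S that sub by blast
    have "\<exists>n. d h \<in> primary R K (\<lambda>l. l) n" if "h \<in> S" for h
      using d that diff_ops_restrict[OF KM M] diff_ops_iff[OF K, of "d h"] by blast
    then obtain n where n: "d h \<in> primary R K (\<lambda>l. l) (n h)" if "h \<in> S" for h by metis
    have "\<forall>h\<in>S. d h \<otimes>\<^bsub>End K\<^esub> h = \<zero>\<^bsub>End K\<^esub>"
    proof (rule primary_independent[OF K S(1)])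
      show "h \<in> carrier R \<rightarrow>\<^sub>E carrier R" if "h \<in> S" for h
        using GalD(1)[OF K hK[OF that]] by (auto simp: linear_maps_def)
      show "d h \<otimes>\<^bsub>End K\<^esub> h \<in> primary R K h (n h)" if "h \<in> S" for h
        using primary_compose_Gal[OF K hK[OF that] n[OF that]] by (simp add: End_alg_ops(1))
    qed (rule sum)
    moreover have "d h = (d h \<otimes>\<^bsub>End K\<^esub> h) \<otimes>\<^bsub>End K\<^esub> Gal_inv h" if "h \<in> S" for h
    proof -
      have "d h \<in> carrier (End K)"
        using primary_linear[OF K n[OF that]] by (simp add: End_alg_carrier)
      then show ?thesis
        using Gal_closed hK[OF that] Gal_inv(1) Gal_inv_compose(1) by (simp add: E.m_assoc)
    qed
    ultimately show ?thesis using Gal_closed[OF Gal_inv(1)[OF hK]] by (metis E.l_null)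
  qed
  show ?thesis
    unfolding is_skew_group_algebra_def
    using diff_ops_subalgebra Gal_subgroup[OF KM M] conj direct by blast
qed

lemma skew_sum_subset: "skew_sum (End K) (diff_ops R M) (Gal R M) \<subseteq> Lin M"
proof -
  have "skew_comb K d S \<in> Lin M"
    if S: "finite S" "S \<subseteq> Gal R M" "d \<in> S \<rightarrow> diff_ops R M" for S d
  proof (rule finsum_closed_subset[OF linear_maps_subset])
    show "\<zero>\<^bsub>End K\<^esub> \<in> Lin M"
      using zero_map_linear[OF carrier_is_subring M] by (simp add: End_alg_ops)
    show "d h \<otimes>\<^bsub>End K\<^esub> h \<in> Lin M" if "h \<in> S" for h
      using that S compose_linear[OF M diff_ops_linear[OF M] GalD(1)[OF M]] by (auto simp: End_alg_ops(1))
  qed (use S add_map_linear[OF carrier_is_subring M] in auto)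
  then show ?thesis unfolding skew_sum_def by blast
qed

lemma skew_sum_add_map:
  assumes "f \<in> skew_sum (End K) (diff_ops R M) (Gal R M)"
    and "g \<in> skew_sum (End K) (diff_ops R M) (Gal R M)"
  shows "Add f g \<in> skew_sum (End K) (diff_ops R M) (Gal R M)"
proof -
  interpret E: ring "End K" by (rule End_alg_is_ring[OF K])
  let ?z = "\<zero>\<^bsub>End K\<^esub>"
  have D: "diff_ops R M \<subseteq> carrier (End K)" "?z \<in> diff_ops R M"
    using diff_ops_subalgebra subringE[of "diff_ops R M" "End K"] by (auto simp: is_subalgebra_def)
  have H: "Gal R M \<subseteq> carrier (End K)" using Gal_closed Gal_antimono[OF KM] by blast
  obtain S d S' d' where *: "finite S" "S \<subseteq> Gal R M" "d \<in> S \<rightarrow> diff_ops R M"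
      "f = skew_comb K d S"
      "finite S'" "S' \<subseteq> Gal R M" "d' \<in> S' \<rightarrow> diff_ops R M"
      "g = skew_comb K d' S'"
    using assms unfolding skew_sum_def by blast
  \<comment> \<open>The two sums may have different supports; both are extended by zero coefficients
    to the union.\<close>
  let ?d = "\<lambda>h. if h \<in> S then d h else ?z" and ?d' = "\<lambda>h. if h \<in> S' then d' h else ?z"
  have ext: "?d \<in> S \<union> S' \<rightarrow> diff_ops R M" "?d' \<in> S \<union> S' \<rightarrow> diff_ops R M" using * D by auto
  have h_car: "h \<in> S \<Longrightarrow> h \<in> carrier (End K)" "h \<in> S' \<Longrightarrow> h \<in> carrier (End K)" for h
    using * H by auto
  have d_car: "h \<in> S \<Longrightarrow> d h \<in> carrier (End K)" "h \<in> S' \<Longrightarrow> d' h \<in> carrier (End K)" for h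
    using * D by auto
  have "f = skew_comb K ?d (S \<union> S')"
    unfolding *(4) using * by (intro E.add.finprod_mono_neutral_cong_left) (auto simp: d_car h_car)
  moreover have "g = skew_comb K ?d' (S \<union> S')"
    unfolding *(8) using * by (intro E.add.finprod_mono_neutral_cong_left) (auto simp: d_car h_car)
  ultimately have "f \<oplus>\<^bsub>End K\<^esub> g = (\<Oplus>\<^bsub>End K\<^esub>h\<in>S \<union> S'.
      ?d h \<otimes>\<^bsub>End K\<^esub> h \<oplus>\<^bsub>End K\<^esub> ?d' h \<otimes>\<^bsub>End K\<^esub> h)"
    by (subst E.finsum_addf) (auto simp: d_car h_car)
  also have "\<dots> = (\<Oplus>\<^bsub>End K\<^esub>h\<in>S \<union> S'. (?d h \<oplus>\<^bsub>End K\<^esub> ?d' h) \<otimes>\<^bsub>End K\<^esub> h)"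
    by (intro E.finsum_cong') (auto simp: E.l_distr d_car h_car)
  finally have sum: "Add f g =
      (\<Oplus>\<^bsub>End K\<^esub>h\<in>S \<union> S'. Add (?d h) (?d' h) \<otimes>\<^bsub>End K\<^esub> h)"
    by (simp add: End_alg_ops(4))
  have "(\<lambda>h. Add (?d h) (?d' h)) \<in> S \<union> S' \<rightarrow> diff_ops R M"
    using ext diff_ops_add_map[OF M] by (simp add: Pi_iff)
  then show ?thesis
    unfolding skew_sum_def mem_Collect_eq using *(1,2,5,6) sum
    by (intro exI[of _ "S \<union> S'"] exI[of _ "\<lambda>h. Add (?d h) (?d' h)"] conjI) simp_all
qed

end

end

text \<open>A pigeonhole bound. As \<open>\<chi>\<close> is \<open>K\<close>-linear, the twist by
  \<open>l\<close> and \<open>\<chi> l\<close> is a \<open>K\<close>-combination of the twists at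
  the basis elements \<open>u\<close>, and each of these lowers one exponent \<open>n u\<close>.
  After as many twists as the exponents sum to, nothing is left.\<close>

lemma primary_of_basis:
  assumes K: "subfield K R" and KM: "K \<subseteq> M" and M: "M \<subseteq> carrier R" and \<chi>: "\<chi> \<in> embeddings R K (carrier R)"
    and Us: "Span K Us = carrier R" "set Us \<subseteq> carrier R" "Us \<noteq> []"
  shows "\<lbrakk> f \<in> Lin M;
     \<And>u. u \<in> set Us \<Longrightarrow> (Twist u (\<chi> u) ^^ n u) f = Zero;
     sum n (set Us) \<le> m \<rbrakk> \<Longrightarrow> f \<in> primary R M \<chi> m"
proof (induction m arbitrary: f n)
  case 0
  \<comment> \<open>All exponents are 0 here, and an exponent 0 says that \<open>f\<close> is zero;
    the nonempty list supplies one.\<close>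
  obtain u where "u \<in> set Us" using Us(3) by (cases Us) auto
  moreover from this have "n u = 0" using 0(3) by simp
  ultimately show ?case using 0(2)[of u] by simp
next
  case (Suc m)
  note \<chi>D = linear_mapsD[OF embeddingsD(1)[OF \<chi>]]
  have \<chi>_fun: "\<chi> \<in> carrier R \<rightarrow> carrier R" using \<chi>D(1) by auto
  have KR: "K \<subseteq> carrier R" using subfieldE(3)[OF K] .
  have base: "Twist u (\<chi> u) f \<in> primary R M \<chi> m" if u: "u \<in> set Us" for u
  proof (cases "n u")
    case 0
    then have "f = Zero" using Suc.prems(2)[OF u] by simp
    then show ?thesis
      using twist_zero_map[OF carrier_is_subring M, of u "\<chi> u"] zero_map_primary[OF M \<chi>_fun] u Us(2) \<chi>D(1) by auto
  next
    case (Suc k)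
    have uR: "u \<in> carrier R" "\<chi> u \<in> carrier R" using u Us(2) \<chi>D(1) by auto
    show ?thesis
    proof (rule Suc.IH)
      show "Twist u (\<chi> u) f \<in> Lin M"
        using twist_linear[OF carrier_is_subring M Suc.prems(1) uR] .
      show "(Twist v (\<chi> v) ^^ (n(u := k)) v) (Twist u (\<chi> u) f) = Zero"
        if v: "v \<in> set Us" for v
      proof (cases "v = u")
        case True
        then show ?thesis using Suc.prems(2)[OF u] Suc by (simp add: funpow_swap1)
      next
        case False
        have vR: "v \<in> carrier R" "\<chi> v \<in> carrier R" using v Us(2) \<chi>D(1) by auto
        show ?thesis
          using twist_power_commute[OF carrier_is_subring M Suc.prems(1) vR uR, of "n v"] Suc.prems(2)[OF v]
            twist_zero_map[OF carrier_is_subring M uR] False by simp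
      qed
      have "sum (n(u := k)) (set Us) < sum n (set Us)"
        using u Suc by (intro sum_strict_mono_ex1) auto
      then show "sum (n(u := k)) (set Us) \<le> m" using Suc.prems(3) by simp
    qed
  qed
  have "set Vs \<subseteq> set Us \<Longrightarrow> \<forall>l\<in>Span K Vs. l \<in> carrier R \<and> Twist l (\<chi> l) f \<in> primary R M \<chi> m" for Vs
  proof (induction Vs)
    case Nil
    have "Twist \<zero> (\<chi> \<zero>) f = Zero"
      unfolding twist_def zero_map_def
      by (intro restrict_ext)
        (simp add: linear_mapsD(1)[OF Suc.prems(1)] linear_maps_zero[OF carrier_is_subring M Suc.prems(1)]
          linear_maps_zero[OF carrier_is_subring KR embeddingsD(1)[OF \<chi>]] minus_eq)
    then show ?case using zero_map_primary[OF M \<chi>_fun] by simp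
  next
    case (Cons u Vs)
    show ?case
    proof
      fix l assume "l \<in> Span K (u # Vs)"
      then obtain k w where kw: "k \<in> K" "w \<in> Span K Vs" "l = k \<otimes> u \<oplus> w" by (rule Span_ConsE)
      have u: "u \<in> set Us" "u \<in> carrier R" using Cons.prems Us(2) by auto
      have w: "w \<in> carrier R" "Twist w (\<chi> w) f \<in> primary R M \<chi> m" using Cons kw(2) by auto
      have k: "k \<in> carrier R" using kw(1) KR by auto
      have ku: "Twist (k \<otimes> u) (\<chi> (k \<otimes> u)) f \<in> primary R M \<chi> m"
      proof -
        have "Twist (k \<otimes> u) (\<chi> (k \<otimes> u)) f = Scale k (Twist u (\<chi> u) f)"
          unfolding twist_def scale_map_def
          using u kw(1) k KM by (intro restrict_ext)
            (simp add: subset_iff \<chi>D m_assoc linear_mapsD(1,4)[OF Suc.prems(1)] minus_eq r_distr r_minus)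
        then show ?thesis using primary_scale_map[OF M \<chi>_fun base[OF u(1)] k] by simp
      qed
      have "Twist l (\<chi> l) f =
         Add (Twist (k \<otimes> u) (\<chi> (k \<otimes> u)) f) (Twist w (\<chi> w) f)"
        unfolding twist_def add_map_def
        using u k w kw(3) by (intro restrict_ext)
          (simp add: \<chi>D(1,3) linear_mapsD(1,3)[OF Suc.prems(1)] l_distr ring_normal_form)
      then show "l \<in> carrier R \<and> Twist l (\<chi> l) f \<in> primary R M \<chi> m"
        using primary_add_map[OF M \<chi>_fun ku w(2)] kw k u w by simp
    qed
  qed
  then show ?case using Suc.prems(1) Us(1) by auto
qed

text \<open>On an eigenvector with eigenvalue \<open>a\<close> the twist by \<open>c\<close> is the
  scalar \<open>a - c\<close>. A power can thus kill a nonzero eigenvector only if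
  \<open>a = c\<close>, which identifies the eigenvalues below.\<close>

lemma twist_eigenvector_power:
  assumes h: "h \<in> Lin M" and l: "l \<in> carrier R" and a: "a \<in> carrier R" and c: "c \<in> carrier R"
    and eigen: "Twist l a h = Zero"
  shows "(Twist l c ^^ n) h = Scale ((a \<ominus> c) [^] n) h"
proof (induction n)
  case 0
  have "h = Scale \<one> h"
    by (rule extensionalityI[OF linear_mapsD(2)[OF h]]) (auto simp: scale_map_def linear_mapsD(1)[OF h])
  then show ?case by simp
next
  case (Suc n)
  have eq: "h (l \<otimes> x) = a \<otimes> h x" if "x \<in> carrier R" for x
    using fun_cong[OF eigen, of x] that l a by (simp add: twist_def zero_map_def r_right_minus_eq linear_mapsD(1)[OF h])
  have "p \<otimes> (a \<otimes> u) \<ominus> c \<otimes> (p \<otimes> u) = (p \<otimes> (a \<ominus> c)) \<otimes> u"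
    if "p \<in> carrier R" "u \<in> carrier R" for p u
    using that a c by (simp add: ring_normal_form)
  then have "Twist l c (Scale ((a \<ominus> c) [^] n) h)
      = Scale ((a \<ominus> c) [^] Suc n) h"
    unfolding twist_def scale_map_def using l a c
    by (intro restrict_ext) (simp add: eq linear_mapsD(1)[OF h])
  then show ?case using Suc by simp
qed

text \<open>By \<open>primary_decomposition\<close> it is enough to treat an \<open>f\<close> that
  is nilpotent for every basis element, with eigenvalues \<open>c u\<close>. These eigenvalues are
  the values of an automorphism \<open>\<chi>\<close>, and \<open>f\<close> composed with the
  inverse of \<open>\<chi>\<close> is a differential operator. There are two base fields because
  normality and finiteness concern \<open>K\<^sub>0\<close>, while \<open>K\<close> only fixes the
  ring in which the sums are formed; later both \<open>K\<close> and \<open>M\<close> take the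
  latter role.\<close>

lemma linear_maps_subset_skew_sum:
  assumes K0: "subfield K\<^sub>0 R" and normal: "normal_extension R K\<^sub>0" and fin: "finite_dimension K\<^sub>0 (carrier R)"
    and K0M: "K\<^sub>0 \<subseteq> M" and M: "subring M R" and KM: "K \<subseteq> M"
  shows "Lin M \<subseteq> skew_sum (End K) (diff_ops R M) (Gal R M)"
proof -
  have MR: "M \<subseteq> carrier R" using subringE(1)[OF M] .
  have KR: "K \<subseteq> carrier R" using KM MR by blast
  have K0R: "K\<^sub>0 \<subseteq> carrier R" using K0M MR by blast
  interpret E: ring "End K" by (rule End_alg_is_ring[OF KR])
  let ?S = "skew_sum (End K) (diff_ops R M) (Gal R M)"
  let ?P = "Lin M"
  obtain n where "dimension n K\<^sub>0 (carrier R)" using fin by (rule finite_dimensionE')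
  then obtain Us where Us: "set Us \<subseteq> carrier R" "Span K\<^sub>0 Us = carrier R"
    using exists_base[OF K0] by blast
  have "Us \<noteq> []"
  proof
    assume "Us = []"
    then have "\<one> \<in> {\<zero>}" using Us(2) one_closed by simp
    then show False by simp
  qed
  have ann: "annihilated R (carrier R) ?P l"
    if "l \<in> set Us" for l
  proof -
    have "l \<in> carrier R" using that Us(1) by auto
    from normal_extension_annihilator[OF normal K0 carrier_is_subring K0R this]
    obtain cs where "set cs \<subseteq> carrier R"
      "\<And>f. f \<in> Lin K\<^sub>0 \<Longrightarrow> fold (Twist l) cs f = Zero"
      by metis
    then show ?thesis using linear_maps_antimono[OF K0M, of R "carrier R"] by blast
  qed
  have part: "f \<in> ?S"
    if f: "f \<in> ?P"
      and nil: "\<And>l. l \<in> set Us \<Longrightarrow> nilpotent_eigen R (carrier R) f l" for f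
  proof (cases "f = Zero")
    case True
    then have "f = (\<Oplus>\<^bsub>End K\<^esub>h\<in>{}. undefined h \<otimes>\<^bsub>End K\<^esub> h)" by (simp add: End_alg_ops)
    then show ?thesis unfolding skew_sum_def by blast
  next
    case False
    obtain c n where c: "c u \<in> carrier R" and n: "(Twist u (c u) ^^ n u) f = Zero"
      if "u \<in> set Us" for u using nil by metis
    \<comment> \<open>All maps sharing the eigenvalues and exponents of \<open>f\<close>: a joint
      eigenvector taken from here must have exactly the eigenvalues \<open>c u\<close>.\<close>
    let ?Q = "{g \<in> ?P. \<forall>u\<in>set Us. (Twist u (c u) ^^ n u) g = Zero}"
    have "twist_stable R M (carrier R) ?Q"
      unfolding twist_stable_def
    proof (intro conjI ballI)
      fix g a assume g: "g \<in> ?Q" and a: "a \<in> carrier R"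
      have "(Twist u (c u) ^^ n u) (Scale a g) = Zero"
        if u: "u \<in> set Us" for u
        using twist_power_scale_map[OF carrier_is_subring MR _ _ c[OF u] a, of g u "n u"] g u Us(1)
          scale_map_zero_map[OF carrier_is_subring MR a] by auto
      then show "Scale a g \<in> ?Q"
        using g scale_map_linear[OF carrier_is_subring MR _ a] by simp
      fix l assume l: "l \<in> carrier R"
      have "(Twist u (c u) ^^ n u) (Twist l a g) = Zero"
        if u: "u \<in> set Us" for u
        using twist_power_commute[OF carrier_is_subring MR _ _ c[OF u] l a, of g u "n u"] g u Us(1)
          twist_zero_map[OF carrier_is_subring MR l a] by auto
      then show "Twist l a g \<in> ?Q"
        using g twist_linear[OF carrier_is_subring MR _ l a] by simp
    qed auto
    then have "\<exists>h\<in>?Q. h \<noteq> Zero \<and>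
       (\<forall>l\<in>set Us. eigen R (carrier R) h l)"
    proof (rule exists_joint_eigenvector[OF carrier_is_subring MR _ _ False Us(1)])
      show "f \<in> ?Q" using f n by simp
      show "annihilated R (carrier R) ?Q l"
        if "l \<in> set Us" for l
        using ann[OF that] by auto
    qed
    then obtain h where h: "h \<in> ?Q" "h \<noteq> Zero"
       "\<And>l. l \<in> set Us \<Longrightarrow> eigen R (carrier R) h l" by blast
    have hP: "h \<in> ?P" "h \<in> Lin K\<^sub>0"
      using h(1) linear_maps_antimono[OF K0M, of R "carrier R"] by auto
    have "eigen R (carrier R) h l" if "l \<in> carrier R" for l
      using eigenvalues_Span[OF carrier_is_subring K0R K0 hP(2) Us(1) h(3)] that Us(2) by blast
    then obtain \<chi> where \<chi>: "\<chi> \<in> embeddings R M (carrier R)"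
        "\<And>l. l \<in> carrier R \<Longrightarrow> Twist l (\<chi> l) h = Zero"
      using eigenvector_embedding[OF carrier_is_subring MR hP(1) h(2)] by blast
    have \<chi>_Gal: "\<chi> \<in> Gal R M" using \<chi>(1) embeddings_carrier_eq_Gal[OF normal K0 K0M M] by simp
    obtain x where x: "x \<in> carrier R" "h x \<noteq> \<zero>"
      using linear_maps_eqI[OF hP(1) zero_map_linear[OF carrier_is_subring MR]] h(2)
      by (auto simp: zero_map_def)
    have \<chi>c: "\<chi> u = c u" if u: "u \<in> set Us" for u
    proof -
      have uR: "u \<in> carrier R" "\<chi> u \<in> carrier R" using u Us(1) GalD(2)[OF MR \<chi>_Gal] by auto
      \<comment> \<open>Computed on the eigenvector \<open>h\<close>, the nilpotency condition of
        \<open>?Q\<close> becomes the vanishing of a power of \<open>\<chi> u - c u\<close>.\<close>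
      have "Scale ((\<chi> u \<ominus> c u) [^] n u) h = Zero"
        using twist_eigenvector_power[OF hP(1) uR c[OF u] \<chi>(2)[OF uR(1)], of "n u"] h(1) u by auto
      from fun_cong[OF this, of x] have "(\<chi> u \<ominus> c u) [^] n u \<otimes> h x = \<zero>"
        using x by (simp add: scale_map_def zero_map_def)
      then have "(\<chi> u \<ominus> c u) [^] n u = \<zero>"
        using x uR c[OF u] linear_mapsD(1)[OF hP(1) x(1)] by (auto dest: integral)
      moreover have "y = \<zero>" if "y \<in> carrier R" "y [^] k = \<zero>" for y and k :: nat
        using that by (induction k) (auto dest: integral)
      ultimately have "\<chi> u \<ominus> c u = \<zero>" using uR c[OF u] by blast
      then show ?thesis using uR c[OF u] by simp
    qed
    have \<chi>K0: "\<chi> \<in> embeddings R K\<^sub>0 (carrier R)"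
      using \<chi>(1) linear_maps_antimono[OF K0M, of R "carrier R"] unfolding embeddings_def by auto
    have "f \<in> primary R M \<chi> (sum n (set Us))"
      by (rule primary_of_basis[OF K0 K0M MR \<chi>K0 Us(2,1) \<open>Us \<noteq> []\<close> f, of n]) (use n \<chi>c in auto)
    then have "compose (carrier R) f (Gal_inv \<chi>) \<in> primary R M (\<lambda>l. \<chi> (Gal_inv \<chi> l)) (sum n (set Us))"
      by (rule primary_compose_Gal[OF MR Gal_inv(1)[OF MR \<chi>_Gal]])
    also have "primary R M (\<lambda>l. \<chi> (Gal_inv \<chi> l)) (sum n (set Us)) = primary R M (\<lambda>l. l) (sum n (set Us))"
      using Gal_inv(2)[OF MR \<chi>_Gal] by (rule primary_cong)
    finally have d: "compose (carrier R) f (Gal_inv \<chi>) \<in> diff_ops R M"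
      using diff_ops_iff[OF MR] by blast
    have \<chi>K: "\<chi> \<in> Gal R K" using \<chi>_Gal Gal_antimono[OF KM] by blast
    have car: "f \<in> carrier (End K)" using f linear_maps_antimono[OF KM] by (auto simp: End_alg_carrier)
    have "compose (carrier R) f (Gal_inv \<chi>) \<otimes>\<^bsub>End K\<^esub> \<chi> = f"
      using E.m_assoc[OF car Gal_closed[OF KR Gal_inv(1)[OF KR \<chi>K]] Gal_closed[OF KR \<chi>K]]
        Gal_inv_compose(2)[OF KR \<chi>K] car by (simp add: End_alg_ops(1)[of R K f "Gal_inv \<chi>"])
    then have "f = (\<Oplus>\<^bsub>End K\<^esub>h\<in>{\<chi>}. compose (carrier R) f (Gal_inv \<chi>) \<otimes>\<^bsub>End K\<^esub> h)"
      using car by (simp add: E.finsum_insert)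
    then show ?thesis unfolding skew_sum_def mem_Collect_eq using d \<chi>_Gal
      by (intro exI[of _ "{\<chi>}"] exI[of _ "\<lambda>_. compose (carrier R) f (Gal_inv \<chi>)"] conjI) simp_all
  qed
  show ?thesis
    by (rule primary_decomposition[OF carrier_is_subring MR skew_sum_add_map[OF KR KM MR] _ Us(1) ann part])
      (auto simp: twist_stable_linear_maps[OF carrier_is_subring MR])
qed

lemma equals_skew_group_algebra_centralizer:
  assumes "subfield K\<^sub>0 R" "normal_extension R K\<^sub>0" "finite_dimension K\<^sub>0 (carrier R)"
    and "K\<^sub>0 \<subseteq> M" "subring M R" "K \<subseteq> M"
  shows "skew_sum (End K) (diff_ops R M) (Gal R M) = carrier (End M)"
    and "equals_skew_group_algebra R K (centralizer (End K) (mult_ops R M)) (diff_ops R M) (Gal R M)"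
proof -
  have MR: "M \<subseteq> carrier R" using subringE(1)[OF assms(5)] .
  have KR: "K \<subseteq> carrier R" using assms(6) MR by blast
  show 1: "skew_sum (End K) (diff_ops R M) (Gal R M) = carrier (End M)"
    using linear_maps_subset_skew_sum[OF assms] skew_sum_subset[OF KR assms(6) MR] by (auto simp: End_alg_carrier)
  show "equals_skew_group_algebra R K (centralizer (End K) (mult_ops R M)) (diff_ops R M) (Gal R M)"
    unfolding equals_skew_group_algebra_def centralizer_mult_ops[OF assms(6) MR] 1
    using skew_group_algebra[OF KR assms(6) MR] by blast
qed

end

section \<open>Dimensions\<close>

lemma (in ring) dimension_linear_image:
  assumes "dimension n K V"
    and \<phi>: "\<phi> \<in> carrier R \<rightarrow> carrier R" "inj_on \<phi> (carrier R)"
    and add: "\<And>x y. \<lbrakk> x \<in> carrier R; y \<in> carrier R \<rbrakk> \<Longrightarrow> \<phi> (x \<oplus> y) = \<phi> x \<oplus> \<phi> y"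
    and smult: "\<And>k x. \<lbrakk> k \<in> K; x \<in> carrier R \<rbrakk> \<Longrightarrow> \<phi> (k \<otimes> x) = k \<otimes> \<phi> x"
    and K: "subfield K R"
  shows "dimension n K (\<phi> ` V)"
  using assms(1) smult K
proof (induction n K V rule: dimension.induct)
  case (zero_dim K)
  have "\<phi> \<zero> \<oplus> \<phi> \<zero> = \<phi> \<zero>" using add[of \<zero> \<zero>] by simp
  then have "\<phi> \<zero> = \<zero>" using \<phi>(1) by (auto simp: Pi_iff)
  then show ?case by simp
next
  case (Suc_dim v E n K)
  have E: "E \<subseteq> carrier R" using space_subgroup_props(1)[OF Suc_dim.prems(2) Suc_dim.hyps(3)] .
  have K': "K \<subseteq> carrier R" using subfieldE(3)[OF Suc_dim.prems(2)] .
  have "\<phi> v \<notin> \<phi> ` E" using Suc_dim.hyps(1,2) E inj_onD[OF \<phi>(2)] by blast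
  moreover have "dimension n K (\<phi> ` E)" using Suc_dim by blast
  moreover have "\<phi> v \<in> carrier R" using Suc_dim.hyps(1) \<phi>(1) by auto
  ultimately have "dimension (Suc n) K (line_extension K (\<phi> v) (\<phi> ` E))" by (intro dimension.Suc_dim)
  also have "line_extension K (\<phi> v) (\<phi> ` E) = \<phi> ` line_extension K v E"
  proof -
    have "\<phi> (k \<otimes> v \<oplus> w) = k \<otimes> \<phi> v \<oplus> \<phi> w" if "k \<in> K" "w \<in> E" for k w
      using that Suc_dim.prems(1)[of k v] Suc_dim.hyps(1) E K' by (subst add) auto
    then show ?thesis by (force simp: line_extension_mem_iff image_iff)
  qed
  finally show ?case .
qed

lemma (in ring) dimension_mono:
  assumes "subfield K R" "dimension n K V" "dimension m K W" "V \<subseteq> W"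
  shows "n \<le> m"
proof -
  obtain Vs where Vs: "set Vs \<subseteq> carrier R" "independent K Vs" "length Vs = n" "Span K Vs = V"
    using exists_base[OF assms(1,2)] by blast
  then show ?thesis
    using independent_length_le_dimension[OF assms(1,3) Vs(2)] Span_base_incl[OF assms(1) Vs(1)] assms(4) by auto
qed

context field
begin

text \<open>Annihilators of the spans of shorter and shorter final segments of a basis form a chain
  from 0 to the whole of \<open>End_M(L)\<close>. Each step adds one left
  \<open>L\<close>-dimension, spanned by a functional that is 1 at the basis vector
  released.\<close>

lemma dimension_End_alg:
  assumes M: "subfield M R" and n: "dimension n M (carrier R)" and KM: "K \<subseteq> M"
  shows "ring.dimension (End K) n (mult_ops R (carrier R)) (carrier (End M))"
proof -
  have MR: "M \<subseteq> carrier R" using subfieldE(3)[OF M] .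
  have KR: "K \<subseteq> carrier R" using KM MR by blast
  interpret E: ring "End K" by (rule End_alg_is_ring[OF KR])
  let ?L = "mult_ops R (carrier R)"
  define ann where "ann V = {f \<in> Lin M. \<forall>v\<in>V. f v = \<zero>}" for V
  have sub: "Lin M \<subseteq> carrier (End K)" by (rule linear_maps_subset[OF KR KM MR])
  obtain Us where Us: "independent M Us" "length Us = n" "Span M Us = carrier R"
    using exists_base[OF M n] by blast
  \<comment> \<open>\<open>Ws\<close> are the vectors still killed. The chain starts with
    \<open>Vs\<close> empty, where only the zero map is left, and each vector moved from
    \<open>Ws\<close> to \<open>Vs\<close> adds one dimension.\<close>
  have "Us = Vs @ Ws \<Longrightarrow> E.dimension (length Vs) ?L (ann (Span M Ws))" for Vs Ws
  proof (induction Vs arbitrary: Ws rule: rev_induct)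
    case Nil
    have "ann (carrier R) = {\<zero>\<^bsub>End K\<^esub>}"
    proof -
      have "f = Zero" if "f \<in> ann (carrier R)" for f
        using linear_maps_eqI[of f R M "carrier R" "Zero" M] that
          zero_map_linear[OF carrier_is_subring MR] by (simp add: ann_def zero_map_def)
      moreover have "Zero \<in> ann (carrier R)"
        using zero_map_linear[OF carrier_is_subring MR] by (simp add: ann_def zero_map_def)
      ultimately show ?thesis unfolding End_alg_ops by blast
    qed
    then show ?case using Nil Us(3) by simp
  next
    case (snoc v Vs)
    have ind: "independent M (v # Ws)" using independent_split(1)[OF M] Us(1) snoc.prems by auto
    then have v: "v \<notin> Span M Ws" "v \<in> carrier R" "independent M Ws"
      using independent_backwards independent_in_carrier by fastforce+
    have Ws: "set Ws \<subseteq> carrier R" using independent_in_carrier[OF v(3)] .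
    have W: "Span M Ws \<subseteq> carrier R" using Span_subgroup_props(1)[OF M Ws] .
    obtain f where f: "f \<in> Lin M" "\<forall>w\<in>Span M Ws. f w = \<zero>" "f v = \<one>"
      using exists_functional[OF M n dimension_independent[OF v(3)] W v(2,1)] by blast
    have v_span: "v \<in> Span M (v # Ws)" using Span_base_incl[OF M, of "v # Ws"] v(2) Ws by auto
    have W_span: "Span M Ws \<subseteq> Span M (v # Ws)" using mono_Span[OF M Ws v(2)] .
    have "f \<notin> ann (Span M (v # Ws))"
    proof
      assume "f \<in> ann (Span M (v # Ws))"
      then have "f v = \<zero>" using v_span unfolding ann_def by blast
      then show False using f(3) by simp
    qed
    moreover have "E.dimension (length Vs) ?L (ann (Span M (v # Ws)))" using snoc by simp
    ultimately have "E.dimension (Suc (length Vs)) ?L (E.line_extension ?L f (ann (Span M (v # Ws))))"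
      using f(1) sub by (intro E.Suc_dim) auto
    also have "E.line_extension ?L f (ann (Span M (v # Ws))) = ann (Span M Ws)"
    proof (intro equalityI subsetI)
      fix g assume "g \<in> E.line_extension ?L f (ann (Span M (v # Ws)))"
      then obtain k h where g: "k \<in> carrier R" "h \<in> ann (Span M (v # Ws))"
          "g = mult_op R k \<otimes>\<^bsub>End K\<^esub> f \<oplus>\<^bsub>End K\<^esub> h"
        unfolding E.line_extension_mem_iff by blast
      then have g_eq: "g = Add (Scale k f) h"
        using mult_op_mult[OF KR, of f k] f(1) sub by (auto simp: End_alg_ops(4))
      have "g \<in> Lin M"
        unfolding g_eq using g(1,2) f(1)
        by (intro add_map_linear[OF carrier_is_subring MR] scale_map_linear[OF carrier_is_subring MR]) (auto simp: ann_def)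
      moreover have "g w = \<zero>" if "w \<in> Span M Ws" for w
        using that W W_span f(2) g(1,2) by (auto simp: g_eq add_map_def scale_map_def ann_def subset_iff)
      ultimately show "g \<in> ann (Span M Ws)" by (simp add: ann_def)
    next
      fix g assume g: "g \<in> ann (Span M Ws)"
      note gD = linear_mapsD[of g R M "carrier R"] and fD = linear_mapsD[OF f(1)]
      have g_lin: "g \<in> Lin M" using g by (simp add: ann_def)
      have gv: "g v \<in> carrier R" using gD(1)[OF g_lin] v(2) by simp
      \<comment> \<open>Subtracting \<open>(g v) f\<close> makes the map vanish at \<open>v\<close>
        too, without changing it on the span of \<open>Ws\<close>.\<close>
      let ?h = "Add g (Scale (\<ominus> (g v)) f)"
      have h_lin: "?h \<in> Lin M"
        using g_lin f(1) gv
        by (intro add_map_linear[OF carrier_is_subring MR] scale_map_linear[OF carrier_is_subring MR]) auto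
      have "?h x = \<zero>" if x: "x \<in> Span M (v # Ws)" for x
      proof -
        obtain k w where kw: "k \<in> M" "w \<in> Span M Ws" "x = k \<otimes> v \<oplus> w" using x by (rule Span_ConsE)
        have car: "k \<in> carrier R" "w \<in> carrier R" using kw MR W by auto
        have "g x = k \<otimes> g v" "f x = k"
          using kw car g f v(2) by (auto simp: gD[OF g_lin] fD ann_def)
        then show ?thesis
          using kw(3) car v(2) gv by (simp add: add_map_def scale_map_def l_minus r_minus m_comm r_neg)
      qed
      then have "?h \<in> ann (Span M (v # Ws))" using h_lin by (simp add: ann_def)
      moreover have "g = mult_op R (g v) \<otimes>\<^bsub>End K\<^esub> f \<oplus>\<^bsub>End K\<^esub> ?h"
      proof -
        have "Add (Scale (g v) f) ?h = g"
        proof (rule extensionalityI[OF _ gD(2)[OF g_lin]])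
          fix x assume "x \<in> carrier R"
          then show "Add (Scale (g v) f) ?h x = g x"
            using gv by (simp add: add_map_def scale_map_def gD(1)[OF g_lin] fD(1) l_minus add_minus_cancel)
        qed (simp add: add_map_def)
        then show ?thesis using mult_op_mult[OF KR, of f "g v"] f(1) sub by (auto simp: End_alg_ops(4))
      qed
      ultimately show "g \<in> E.line_extension ?L f (ann (Span M (v # Ws)))"
        unfolding E.line_extension_mem_iff using gv by blast
    qed
    finally show ?case by simp
  qed
  from this[of Us "[]"] have "E.dimension n ?L (ann {\<zero>})" using Us(2) by simp
  moreover have "ann {\<zero>} = carrier (End M)"
    using linear_maps_zero[OF carrier_is_subring MR] by (auto simp: ann_def End_alg_carrier)
  ultimately show ?thesis by simp
qed

text \<open>Right multiplication by an invertible \<open>h\<close> is left \<open>L\<close>-linear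
  and injective, so each \<open>D h\<close> has the dimension of \<open>D\<close>; directness makes
  the dimensions add up.\<close>

lemma dimension_skew_sum:
  assumes KM: "K \<subseteq> M" and M: "M \<subseteq> carrier R"
    and k: "ring.dimension (End K) k (mult_ops R (carrier R)) (diff_ops R M)"
    and "finite S" "S \<subseteq> Gal R M"
  shows "ring.dimension (End K) (card S * k) (mult_ops R (carrier R))
    {skew_comb K d S | d. d \<in> S \<rightarrow> diff_ops R M}"
  using assms(4,5)
proof (induction S rule: finite_induct)
  have KR: "K \<subseteq> carrier R" using KM M by blast
  interpret E: ring "End K" by (rule End_alg_is_ring[OF KR])
  case empty
  then show ?case by (simp add: E.zero_dim)
next
  have KR: "K \<subseteq> carrier R" using KM M by blast
  interpret E: ring "End K" by (rule End_alg_is_ring[OF KR])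
  case (insert h S)
  let ?D = "diff_ops R M" and ?L = "mult_ops R (carrier R)"
  let ?V = "\<lambda>S. {skew_comb K d S | d. d \<in> S \<rightarrow> ?D}"
  have L: "subfield ?L (End K)" by (rule mult_ops_subfield[OF KR carrier_is_subfield])
  have D_sub: "subring ?D (End K)" using diff_ops_subalgebra[OF KR KM M] by (simp add: is_subalgebra_def)
  note D = subringE[OF D_sub]
  have G: "g \<in> carrier (End K)" if "g \<in> Gal R M" for g
    using that Gal_closed[OF KR] Gal_antimono[OF KM] by blast
  have h: "h \<in> Gal R M" "h \<in> Gal R K" "h \<in> carrier (End K)"
    using insert.prems Gal_antimono[OF KM, of R] G by auto
  let ?\<phi> = "\<lambda>f. f \<otimes>\<^bsub>End K\<^esub> h"
  have inj: "inj_on ?\<phi> (carrier (End K))"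
  proof (rule inj_on_inverseI[of _ "\<lambda>f. f \<otimes>\<^bsub>End K\<^esub> Gal_inv h"])
    show "f \<otimes>\<^bsub>End K\<^esub> h \<otimes>\<^bsub>End K\<^esub> Gal_inv h = f" if "f \<in> carrier (End K)" for f
      using E.m_assoc[OF that h(3) Gal_closed[OF KR Gal_inv(1)[OF KR h(2)]]] Gal_inv_compose(1)[OF KR h(2)] that
      by simp
  qed
  have 1: "E.dimension k ?L (?\<phi> ` ?D)"
  proof (rule E.dimension_linear_image[OF k _ inj _ _ L])
    show "?\<phi> (c \<otimes>\<^bsub>End K\<^esub> f) = c \<otimes>\<^bsub>End K\<^esub> ?\<phi> f" if "c \<in> ?L" "f \<in> carrier (End K)" for c f
      using that h(3) subfieldE(3)[OF L] by (auto intro: E.m_assoc)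
  qed (use h(3) in \<open>auto simp: E.l_distr\<close>)
  have 2: "E.dimension (card S * k) ?L (?V S)" using insert by simp
  have sum: "skew_comb K d (insert h S) =
      d h \<otimes>\<^bsub>End K\<^esub> h \<oplus>\<^bsub>End K\<^esub> skew_comb K d S"
    if "d \<in> insert h S \<rightarrow> ?D" for d
  proof (rule E.finsum_insert[OF insert.hyps])
    show "(\<lambda>g. d g \<otimes>\<^bsub>End K\<^esub> g) \<in> S \<rightarrow> carrier (End K)"
      using that D(1) G insert.prems by (auto intro!: E.m_closed)
    show "d h \<otimes>\<^bsub>End K\<^esub> h \<in> carrier (End K)" using that D(1) h(3) by auto
  qed
  have upd: "skew_comb K (d(h := a)) (insert h S) =
      a \<otimes>\<^bsub>End K\<^esub> h \<oplus>\<^bsub>End K\<^esub> skew_comb K d S"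
    if d: "d \<in> S \<rightarrow> ?D" and a: "a \<in> ?D" for d a
  proof -
    have "skew_comb K (d(h := a)) S = skew_comb K d S"
      using insert.hyps(2) d D(1) G insert.prems by (intro E.finsum_cong') (auto intro!: E.m_closed)
    then show ?thesis using d a by (subst sum) auto
  qed
  have direct: "\<forall>g\<in>insert h S. d g = \<zero>\<^bsub>End K\<^esub>"
    if "d \<in> insert h S \<rightarrow> ?D"
      "skew_comb K d (insert h S) = \<zero>\<^bsub>End K\<^esub>" for d
    using skew_group_algebra[OF KR KM M, unfolded is_skew_group_algebra_def] finite.insertI[OF insert.hyps(1), of h]
      insert.prems that by blast
  have "?\<phi> ` ?D \<inter> ?V S \<subseteq> {\<zero>\<^bsub>End K\<^esub>}"
  proof
    fix x assume "x \<in> ?\<phi> ` ?D \<inter> ?V S"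
    then obtain a d where x: "a \<in> ?D" "x = a \<otimes>\<^bsub>End K\<^esub> h" "d \<in> S \<rightarrow> ?D"
        "x = skew_comb K d S" by blast
    \<comment> \<open>An element \<open>a h\<close> that is also a sum over \<open>S\<close> gives a
      relation over \<open>insert h S\<close> with coefficient \<open>-a\<close> at
      \<open>h\<close>; directness yields \<open>a = 0\<close>.\<close>
    let ?d = "d(h := \<ominus>\<^bsub>End K\<^esub> a)"
    have a: "a \<in> carrier (End K)" "\<ominus>\<^bsub>End K\<^esub> a \<in> ?D" using x(1) D(1,5) by auto
    have "skew_comb K ?d (insert h S) = \<ominus>\<^bsub>End K\<^esub> x \<oplus>\<^bsub>End K\<^esub> x"
      using upd[OF x(3) a(2)] a(1) h(3) x(2,4) by (simp add: E.l_minus)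
    also have "\<dots> = \<zero>\<^bsub>End K\<^esub>" using x(2) a(1) h(3) by (simp add: E.l_neg)
    finally have "\<forall>g\<in>insert h S. ?d g = \<zero>\<^bsub>End K\<^esub>"
      by (intro direct) (use x(3) a(2) in auto)
    then have "\<ominus>\<^bsub>End K\<^esub> a = \<zero>\<^bsub>End K\<^esub>" by simp
    then have "a = \<zero>\<^bsub>End K\<^esub>" using E.minus_minus[OF a(1)] by simp
    then show "x \<in> {\<zero>\<^bsub>End K\<^esub>}" using x(2) h(3) by simp
  qed
  moreover have "\<zero>\<^bsub>End K\<^esub> \<in> ?\<phi> ` ?D \<inter> ?V S"
    using E.space_subgroup_props(2)[OF L 1] E.space_subgroup_props(2)[OF L 2] by blast
  ultimately have int: "?\<phi> ` ?D \<inter> ?V S = {\<zero>\<^bsub>End K\<^esub>}" by blast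
  have "E.dimension (k + card S * k) ?L (?\<phi> ` ?D <+>\<^bsub>End K\<^esub> ?V S)"
    by (rule E.dimension_direct_sum_space[OF L 1 2 int])
  moreover have "?\<phi> ` ?D <+>\<^bsub>End K\<^esub> ?V S = ?V (insert h S)"
  proof (intro equalityI subsetI)
    fix x assume "x \<in> ?\<phi> ` ?D <+>\<^bsub>End K\<^esub> ?V S"
    then obtain a d where x: "a \<in> ?D" "d \<in> S \<rightarrow> ?D"
        "x = a \<otimes>\<^bsub>End K\<^esub> h \<oplus>\<^bsub>End K\<^esub> skew_comb K d S"
      unfolding set_add_def' by blast
    show "x \<in> ?V (insert h S)"
      unfolding mem_Collect_eq
    proof (intro exI[of _ "d(h := a)"] conjI)
      show "x = skew_comb K (d(h := a)) (insert h S)"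
        using upd[OF x(2,1)] x(3) by simp
      show "d(h := a) \<in> insert h S \<rightarrow> ?D" using x(1,2) by auto
    qed
  next
    fix x assume "x \<in> ?V (insert h S)"
    then obtain d where d: "d \<in> insert h S \<rightarrow> ?D"
      "x = skew_comb K d (insert h S)" by blast
    have "d h \<in> ?D" "d \<in> S \<rightarrow> ?D" using d(1) by auto
    then show "x \<in> ?\<phi> ` ?D <+>\<^bsub>End K\<^esub> ?V S"
      unfolding set_add_def' d(2) sum[OF d(1)] by blast
  qed
  ultimately show ?case using insert.hyps by simp
qed

text \<open>Both sides are the left \<open>L\<close>-dimension of \<open>End_M(L)\<close>:
  \<open>n\<close> by dual functionals, and \<open>card (Gal R M) * k\<close> by the skew
  decomposition.\<close>

lemma card_Gal_dimension_diff_ops: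
  assumes K0: "subfield K\<^sub>0 R" and normal: "normal_extension R K\<^sub>0" and fin: "finite_dimension K\<^sub>0 (carrier R)"
    and K0M: "K\<^sub>0 \<subseteq> M" and M: "subfield M R" and KM: "K \<subseteq> M" and n: "dimension n M (carrier R)"
  shows "\<exists>k. ring.dimension (End K) k (mult_ops R (carrier R)) (diff_ops R M) \<and> card (Gal R M) * k = n"
proof -
  have MR: "M \<subseteq> carrier R" using subfieldE(3)[OF M] .
  have KR: "K \<subseteq> carrier R" using KM MR by blast
  interpret E: ring "End K" by (rule End_alg_is_ring[OF KR])
  let ?L = "mult_ops R (carrier R)" and ?D = "diff_ops R M"
  let ?V = "\<lambda>S. {skew_comb K d S | d. d \<in> S \<rightarrow> ?D}"
  have L: "subfield ?L (End K)" by (rule mult_ops_subfield[OF KR carrier_is_subfield])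
  have N: "E.dimension n ?L (carrier (End M))" by (rule dimension_End_alg[OF M n KM])
  note skew = equals_skew_group_algebra_centralizer(1)[OF K0 normal fin K0M subfieldE(1)[OF M] KM]
  have D_sub: "subring ?D (End K)" using diff_ops_subalgebra[OF KR KM MR] by (simp add: is_subalgebra_def)
  have "subalgebra ?L ?D (End K)"
  proof (rule subalgebra.intro)
    show "subgroup ?D (add_monoid (End K))" by (rule subring.axioms(1)[OF D_sub])
    have "mult_op R l \<otimes>\<^bsub>End K\<^esub> v \<in> ?D" if "l \<in> carrier R" "v \<in> ?D" for l v
      using mult_op_mult[OF KR subsetD[OF subringE(1)[OF D_sub] that(2)], of l]
        diff_ops_scale_map[OF MR that(2,1)] by simp
    then show "subalgebra_axioms ?L ?D (End K)" by unfold_locales auto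
  qed
  moreover have "?D \<subseteq> carrier (End M)" using diff_ops_linear[OF MR] by (auto simp: End_alg_carrier)
  ultimately have "E.finite_dimension ?L ?D"
    using E.subalbegra_incl_imp_finite_dimension[OF L E.finite_dimensionI[OF N]] by blast
  then obtain k where k: "E.dimension k ?L ?D" by (rule E.finite_dimensionE')
  \<comment> \<open>The identity is a nonzero differential operator; only with positive
    \<open>k\<close> does \<open>bound\<close> limit the size of \<open>S\<close>.\<close>
  have "k \<noteq> 0"
  proof
    assume "k = 0"
    then have "?D = {\<zero>\<^bsub>End K\<^esub>}" using k E.dimension_zero[OF L] by simp
    then show False using subringE(3)[OF D_sub] End_alg_one_not_zero[OF KR] by simp
  qed
  have bound: "card S * k \<le> n" if S: "finite S" "S \<subseteq> Gal R M" for S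
  proof (rule E.dimension_mono[OF L dimension_skew_sum[OF KM MR k S] N])
    show "?V S \<subseteq> carrier (End M)" unfolding skew[symmetric] skew_sum_def using S by blast
  qed
  \<comment> \<open>Finiteness has to precede the count, since \<open>card\<close> of an infinite
    set is 0. It follows because the sizes of finite subsets are bounded by
    \<open>n\<close>.\<close>
  have "finite (Gal R M)"
  proof (rule finite_if_finite_subsets_card_bdd[THEN conjunct1])
    fix S assume "S \<subseteq> Gal R M" "finite S"
    then show "card S \<le> n" using bound[of S] \<open>k \<noteq> 0\<close> by (metis le_trans mult_le_mono2 nat_mult_1_right less_one not_less)
  qed
  have "?V (Gal R M) = carrier (End M)"
  proof
    show "?V (Gal R M) \<subseteq> carrier (End M)"
      unfolding skew[symmetric] skew_sum_def using \<open>finite (Gal R M)\<close> by blast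
    show "carrier (End M) \<subseteq> ?V (Gal R M)"
    proof
      fix f assume "f \<in> carrier (End M)"
      then obtain S d where S: "finite S" "S \<subseteq> Gal R M" "d \<in> S \<rightarrow> ?D"
          "f = skew_comb K d S"
        unfolding skew[symmetric] skew_sum_def by blast
      let ?d = "\<lambda>h. if h \<in> S then d h else \<zero>\<^bsub>End K\<^esub>"
      have d: "?d \<in> Gal R M \<rightarrow> ?D" using S subringE(2)[OF D_sub] by auto
      have G: "g \<in> carrier (End K)" if "g \<in> Gal R M" for g
        using that Gal_closed[OF KR] Gal_antimono[OF KM] by blast
      have d_car: "d h \<in> carrier (End K)" if "h \<in> S" for h
        using S(3) that subringE(1)[OF D_sub] by auto
      have "f = skew_comb K ?d (Gal R M)"
        unfolding S(4) using S(1-3) \<open>finite (Gal R M)\<close>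
        by (intro E.add.finprod_mono_neutral_cong_left) (auto simp: d_car G)
      then show "f \<in> ?V (Gal R M)"
        unfolding mem_Collect_eq using d by (intro exI[of _ ?d] conjI)
    qed
  qed
  then have "card (Gal R M) * k = n"
    using E.dimension_is_inj[OF L _ N] dimension_skew_sum[OF KM MR k \<open>finite (Gal R M)\<close>] by simp
  then show ?thesis using k by blast
qed

lemma dimension_mult_ops:
  assumes "subfield K R" "K' \<subseteq> carrier R" "dimension n K V" "V \<subseteq> carrier R"
  shows "ring.dimension (End K') n (mult_ops R K) (mult_ops R V)"
  using ring_hom_ring.inj_hom_dimension[OF mult_op_hom[OF assms(2)] assms(1) End_alg_one_not_zero[OF assms(2)] _ assms(3)]
    inj_on_subset[OF mult_op_inj assms(4)] by blast

text \<open>The tower law over \<open>K \<subseteq> L\<close> multiplies the left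
  \<open>L\<close>-dimension of \<open>D(L/M)\<close> by \<open>[L:K]\<close>. Taking
  \<open>K\<close> or \<open>M\<close> as the scalar field gives the two formulas of (3).\<close>

lemma dimension_diff_ops:
  assumes K0: "subfield K\<^sub>0 R" and normal: "normal_extension R K\<^sub>0" and fin: "finite_dimension K\<^sub>0 (carrier R)"
    and K0M: "K\<^sub>0 \<subseteq> M" and M: "subfield M R" and K: "subfield K R" and KM: "K \<subseteq> M"
    and n: "dimension n M (carrier R)" and d: "dimension d K (carrier R)"
  shows "ring.finite_dimension (End K) (mult_ops R K) (diff_ops R M)"
    and "card (Gal R M) * (ring.dim (End K) over mult_ops R K) (diff_ops R M) = n * d"
proof -
  have KR: "K \<subseteq> carrier R" using subfieldE(3)[OF K] .
  interpret E: ring "End K" by (rule End_alg_is_ring[OF KR])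
  obtain k where k: "E.dimension k (mult_ops R (carrier R)) (diff_ops R M)" "card (Gal R M) * k = n"
    using card_Gal_dimension_diff_ops[OF K0 normal fin K0M M KM n] by blast
  have K': "subfield (mult_ops R K) (End K)" by (rule mult_ops_subfield[OF KR K])
  have dim: "E.dimension (d * k) (mult_ops R K) (diff_ops R M)"
    using E.telescopic_base[OF K' mult_ops_subfield[OF KR carrier_is_subfield]
        dimension_mult_ops[OF K KR d subset_refl] k(1)] .
  then show "E.finite_dimension (mult_ops R K) (diff_ops R M)" by (rule E.finite_dimensionI)
  show "card (Gal R M) * (E.dim over mult_ops R K) (diff_ops R M) = n * d"
    using E.dimI[OF K' dim] k(2) by (simp add: mult.commute mult.left_commute)
qed

section \<open>Normal closures are finite\<close>

text \<open>The minimal polynomial of \<open>a\<close> divides the irreducible \<open>p\<close>, so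
  it is \<open>p\<close> up to a unit and vanishes at \<open>b\<close> as well; every
  \<open>q\<close> with root \<open>a\<close> is a multiple of it. This makes
  \<open>a \<mapsto> b\<close> well defined on \<open>K(a)\<close>.\<close>

lemma irreducible_roots_Irr:
  assumes K: "subfield K R" and p: "p \<in> carrier (K[X])" "pirreducible K p"
    and a: "is_root p a" and b: "is_root p b" and q: "q \<in> carrier (K[X])" "eval q a = \<zero>"
  shows "eval q b = \<zero>"
proof -
  have aR: "a \<in> carrier R" "eval p a = \<zero>" and bR: "b \<in> carrier R" "eval p b = \<zero>"
    using a b by (auto simp: is_root_def)
  interpret UP: domain "K[X]" using univ_poly_is_domain[OF subfieldE(1)[OF K]] .
  have "p \<noteq> []" using a by (simp add: is_root_def)
  then have alg: "(algebraic over K) a" using algebraicI[OF p(1) _ aR(2)] by simp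
  note Irr = IrrE[OF K aR(1) alg]
  have eval_mult: "eval (r \<otimes>\<^bsub>K[X]\<^esub> s) b = eval r b \<otimes> eval s b"
    if "r \<in> carrier (K[X])" "s \<in> carrier (K[X])" for r s
    using ring_hom_mult[OF eval_is_hom[OF subfieldE(1)[OF K] bR(1)]] that by simp
  have div: "\<exists>s\<in>carrier (K[X]). r = Irr K a \<otimes>\<^bsub>K[X]\<^esub> s" if "r \<in> carrier (K[X])" "eval r a = \<zero>" for r
    using Irr_minimal[OF K aR(1) alg that] pdivides_iff_shell[OF K Irr(1) that(1)] by (auto simp: factor_def)
  obtain s where s: "s \<in> carrier (K[X])" "p = Irr K a \<otimes>\<^bsub>K[X]\<^esub> s" using div[OF p(1) aR(2)] by blast
  have "Irr K a \<notin> Units (K[X])" using pirreducibleE(2)[OF subfieldE(1)[OF K] Irr(1,2)] .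
  then have "s \<in> Units (K[X])" using pirreducibleE(3)[OF subfieldE(1)[OF K] p Irr(1) s] by simp
  then obtain k where k: "k \<in> K" "k \<noteq> \<zero>" "s = [k]" using univ_poly_units[OF K] by auto
  have kR: "k \<in> carrier R" using k subfieldE(3)[OF K] by auto
  have IrrR: "eval (Irr K a) b \<in> carrier R"
    using eval_poly_in_carrier[OF subfieldE(1)[OF K] _ bR(1)] Irr(1) by (simp add: univ_poly_carrier)
  have "eval (Irr K a) b \<otimes> k = \<zero>" using eval_mult[OF Irr(1) s(1)] s(2) bR(2) k(3) kR by simp
  then have "eval (Irr K a) b = \<zero>" using k(2) kR IrrR integral by blast
  moreover obtain t where "t \<in> carrier (K[X])" "q = Irr K a \<otimes>\<^bsub>K[X]\<^esub> t" using div[OF q] by blast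
  moreover from this have "eval t b \<in> carrier R"
    using eval_poly_in_carrier[OF subfieldE(1)[OF K] _ bR(1)] by (simp add: univ_poly_carrier)
  ultimately show ?thesis using eval_mult[OF Irr(1)] by simp
qed

text \<open>A functional \<open>N \<rightarrow> K(a)\<close> followed by \<open>a \<mapsto> b\<close> is an eigenvector for \<open>a\<close> with eigenvalue \<open>b\<close>;
  a joint eigenvector in the stable subspace it generates is an embedding up to a factor.\<close>

lemma exists_embedding:
  assumes K: "subfield K R" and normal: "normal_extension R K" and N: "subfield N R" and KN: "K \<subseteq> N"
    and fin: "finite_dimension K N" and a: "a \<in> N"
    and p: "p \<in> carrier (K[X])" "pirreducible K p" "is_root p a" "is_root p b"
  shows "\<exists>\<chi>\<in>embeddings R K N. \<chi> a = b"
proof -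
  have Nr: "subring N R" by (rule subfieldE(1)[OF N])
  note Nc = subring_closed[OF Nr KN]
  have aR: "a \<in> carrier R" and bR: "b \<in> carrier R" using p(3,4) by (auto simp: is_root_def)
  have alg: "(algebraic over K) a" using normal_extensionD(1)[OF normal K aR] .
  let ?S = "simple_extension K a"
  have S: "subfield ?S R" using simple_extension_is_subfield[OF K aR] alg by simp
  have SN: "?S \<subseteq> N" by (rule simple_extension_subring_incl[OF Nr KN a])
  have KS: "K \<subseteq> ?S" by (rule simple_extension_incl[OF subfieldE(3)[OF K] aR])
  have aS: "a \<in> ?S" by (rule simple_extension_mem[OF subfieldE(1)[OF K] aR])
  obtain n where n: "dimension n K N" using fin by (rule finite_dimensionE')
  obtain Us where Us: "set Us \<subseteq> carrier R" "Span K Us = N" using exists_base[OF K n] by blast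
  have UsN: "set Us \<subseteq> N" using Span_base_incl[OF K Us(1)] Us(2) by simp
  have "Span ?S Us = N"
  proof
    have "subalgebra ?S N R"
    proof (rule subalgebra.intro)
      show "subgroup N (add_monoid R)" by (rule subring.axioms(1)[OF Nr])
      show "subalgebra_axioms ?S N R" by unfold_locales (use SN Nc in auto)
    qed
    then show "Span ?S Us \<subseteq> N" by (rule subalgebra_Span_incl[OF S _ UsN])
    have "subalgebra ?S (Span ?S Us) R" by (rule Span_is_subalgebra[OF S Us(1)])
    then have "subalgebra K (Span ?S Us) R"
      using KS unfolding subalgebra_def subalgebra_axioms_def by blast
    then have "Span K Us \<subseteq> Span ?S Us"
      using subalgebra_Span_incl[OF K _ Span_base_incl[OF S Us(1)]] by blast
    then show "N \<subseteq> Span ?S Us" using Us(2) by simp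
  qed
  then obtain m where m: "dimension m ?S N"
    using Span_finite_dimension[OF S Us(1)] by (auto elim: finite_dimensionE')
  \<comment> \<open>The functional separates 1 from the zero subspace. Linearity over
    \<open>?S = K(a)\<close>, and not only over \<open>K\<close>, is what lets \<open>a\<close> be
    pulled out of \<open>f\<close>.\<close>
  obtain f where f: "f \<in> linear_maps R ?S N" "f ` N \<subseteq> ?S" "f \<one> = \<one>"
    using exists_functional[OF S m zero_dim _ Nc(4)] Nc(3) by auto
  note fD = linear_mapsD[OF f(1)]
  have ev: "(\<lambda>p. eval p x) \<in> ring_hom (K[X]) R" if "x \<in> carrier R" for x
    using eval_is_hom[OF subfieldE(1)[OF K] that] .
  interpret UP: domain "K[X]" using univ_poly_is_domain[OF subfieldE(1)[OF K]] .
  \<comment> \<open>The homomorphism from \<open>K(a)\<close> to \<open>L\<close> with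
    \<open>a \<mapsto> b\<close>, through a chosen polynomial representative;
    \<open>irreducible_roots_Irr\<close> shows that the choice does not matter.\<close>
  define \<sigma> where "\<sigma> y = eval (SOME q. q \<in> carrier (K[X]) \<and> eval q a = y) b" for y
  have \<sigma>: "\<sigma> (eval q a) = eval q b" if q: "q \<in> carrier (K[X])" for q
  proof -
    let ?r = "SOME r. r \<in> carrier (K[X]) \<and> eval r a = eval q a"
    have r: "?r \<in> carrier (K[X])" "eval ?r a = eval q a"
      using someI[of "\<lambda>r. r \<in> carrier (K[X]) \<and> eval r a = eval q a" q] q by auto
    have sub: "eval (?r \<ominus>\<^bsub>K[X]\<^esub> q) x = eval ?r x \<ominus> eval q x" if "x \<in> carrier R" for x
    proof -
      interpret h: ring_hom_ring "K[X]" R "\<lambda>p. eval p x" by (rule eval_ring_hom[OF subfieldE(1)[OF K] that])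
      show ?thesis using r(1) q by (simp add: a_minus_def)
    qed
    have car: "eval ?r x \<in> carrier R" "eval q x \<in> carrier R" if "x \<in> carrier R" for x
      using ring_hom_closed[OF ev[OF that]] r(1) q by auto
    have "eval (?r \<ominus>\<^bsub>K[X]\<^esub> q) b = \<zero>"
      using irreducible_roots_Irr[OF K p UP.minus_closed[OF r(1) q]] sub[OF aR] r(2) car[OF aR] by simp
    then show ?thesis using sub[OF bR] car[OF bR] by (simp add: \<sigma>_def)
  qed
  have poly: "\<exists>q\<in>carrier (K[X]). y = eval q a" if "y \<in> ?S" for y
    using that simple_extension_as_eval_img[OF subfieldE(3)[OF K] aR] by auto
  have \<sigma>_closed: "\<sigma> y \<in> carrier R" if "y \<in> ?S" for y
    using poly[OF that] \<sigma> ring_hom_closed[OF ev[OF bR]] by auto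
  have \<sigma>_add: "\<sigma> (y \<oplus> z) = \<sigma> y \<oplus> \<sigma> z" if yz: "y \<in> ?S" "z \<in> ?S" for y z
  proof -
    obtain q r where qr: "q \<in> carrier (K[X])" "y = eval q a" "r \<in> carrier (K[X])" "z = eval r a"
      using poly yz by metis
    then show ?thesis
      using ring_hom_add[OF ev[OF aR] qr(1,3)] ring_hom_add[OF ev[OF bR] qr(1,3)] \<sigma> by (metis UP.a_closed)
  qed
  have \<sigma>_mult: "\<sigma> (y \<otimes> z) = \<sigma> y \<otimes> \<sigma> z" if yz: "y \<in> ?S" "z \<in> ?S" for y z
  proof -
    obtain q r where qr: "q \<in> carrier (K[X])" "y = eval q a" "r \<in> carrier (K[X])" "z = eval r a"
      using poly yz by metis
    then show ?thesis
      using ring_hom_mult[OF ev[OF aR] qr(1,3)] ring_hom_mult[OF ev[OF bR] qr(1,3)] \<sigma> by (metis UP.m_closed)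
  qed
  have \<sigma>_K: "\<sigma> k = k" if k: "k \<in> K" for k
  proof (cases "k = \<zero>")
    case True
    then show ?thesis using \<sigma>[of "[]"] by (simp add: univ_poly_zero_closed)
  next
    case False
    then have "[k] \<in> carrier (K[X])" using k by (auto simp: univ_poly_carrier[symmetric] polynomial_def)
    moreover have "eval [k] x = k" if "x \<in> carrier R" for x using k subfieldE(3)[OF K] that by auto
    ultimately show ?thesis using \<sigma>[of "[k]"] aR bR by simp
  qed
  have \<sigma>_a: "\<sigma> a = b"
    using \<sigma>[OF var_closed(1)[OF subfieldE(1)[OF K]]] eval_var[OF aR] eval_var[OF bR] by simp
  define g where "g = (\<lambda>x\<in>N. \<sigma> (f x))"
  have fS: "f x \<in> ?S" if "x \<in> N" for x using f(2) that by blast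
  have g: "g \<in> linear_maps R K N"
  proof (rule linear_mapsI)
    show "g (k \<otimes> x) = k \<otimes> g x" if "k \<in> K" "x \<in> N" for k x
      using that KS Nc by (auto simp: g_def fD(4) \<sigma>_mult fS \<sigma>_K)
  qed (use Nc in \<open>auto simp: g_def \<sigma>_closed fS fD(3) \<sigma>_add\<close>)
  have "\<sigma> \<one> = \<one>" using \<sigma>_K subringE(3)[OF subfieldE(1)[OF K]] by blast
  then have "g \<one> = \<one>" using f(3) Nc(4) by (simp add: g_def)
  then have g0: "g \<noteq> zero_map R N" using Nc(4) by (auto simp: zero_map_def)
  have g_eigen: "twist R N a b g = zero_map R N"
    unfolding twist_def zero_map_def
    by (intro restrict_ext) (use aS a Nc in \<open>auto simp: g_def fD(4) \<sigma>_mult fS \<sigma>_a \<sigma>_closed r_neg minus_eq bR\<close>)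
  \<comment> \<open>Any joint eigenvector found in this kernel keeps the eigenvalue \<open>b\<close>
    at \<open>a\<close>, which forces \<open>\<chi> a = b\<close>.\<close>
  let ?P = "{h \<in> linear_maps R K N. twist R N a b h = zero_map R N}"
  have ann: "annihilated R N ?P l"
    if "l \<in> set Us" for l
  proof -
    have "l \<in> N" using UsN that by blast
    from normal_extension_annihilator[OF normal K Nr KN this]
    obtain cs where "set cs \<subseteq> carrier R" "\<And>f. f \<in> linear_maps R K N \<Longrightarrow> fold (twist R N l) cs f = zero_map R N"
      by metis
    then show ?thesis by blast
  qed
  have stable: "twist_stable R K N ?P"
    by (rule twist_stable_kernel[OF Nr KN twist_stable_linear_maps[OF Nr KN] a bR])
  have gP: "g \<in> ?P" using g g_eigen by simp
  obtain h where h: "h \<in> ?P" "h \<noteq> zero_map R N"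
      "\<And>l. l \<in> set Us \<Longrightarrow> eigen R N h l"
    using exists_joint_eigenvector[OF Nr KN stable gP g0 UsN ann] by blast
  have h_lin: "h \<in> linear_maps R K N" using h(1) by simp
  have "eigen R N h l" if "l \<in> N" for l
    using eigenvalues_Span[OF Nr KN K h_lin UsN h(3)] that Us(2) by blast
  then obtain \<chi> where \<chi>: "\<chi> \<in> embeddings R K N" "\<And>l. l \<in> N \<Longrightarrow> twist R N l (\<chi> l) h = zero_map R N"
    using eigenvector_embedding[OF Nr KN h_lin h(2)] by blast
  obtain x where x: "x \<in> N" "h x \<noteq> \<zero>"
    using linear_maps_eqI[OF h_lin zero_map_linear[OF Nr KN]] h(2) by (auto simp: zero_map_def)
  note hD = linear_mapsD(1)[OF h_lin]
  have \<chi>a: "\<chi> a \<in> carrier R" using linear_mapsD(1)[OF embeddingsD(1)[OF \<chi>(1)] a] .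
  have eigen: "h (a \<otimes> x) = c \<otimes> h x" if "twist R N a c h = zero_map R N" "c \<in> carrier R" for c
    using fun_cong[OF that(1), of x] that(2) x(1) Nc(6)[OF a x(1)]
    by (simp add: twist_def zero_map_def r_right_minus_eq hD)
  have "h (a \<otimes> x) = \<chi> a \<otimes> h x" by (rule eigen[OF \<chi>(2)[OF a] \<chi>a])
  moreover have "h (a \<otimes> x) = b \<otimes> h x" using eigen[OF _ bR] h(1) by blast
  ultimately have "\<chi> a = b" using m_rcancel[OF x(2) hD[OF x(1)] \<chi>a bR] by simp
  then show ?thesis using \<chi>(1) by blast
qed

text \<open>An irreducible factor of \<open>p\<close> over \<open>N\<close> splits over
  \<open>L\<close>, so it has a root there. That root is a root of \<open>p\<close>, hence in
  \<open>N\<close>, and an irreducible polynomial with a root in its own field is linear.\<close>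

lemma splitted_subfield:
  assumes N: "subfield N R" and p: "p \<in> carrier (N[X])" "p \<noteq> []" "splitted p"
    and roots: "\<And>b. is_root p b \<Longrightarrow> b \<in> N"
  shows "ring.splitted (R\<lparr>carrier := N\<rparr>) p"
proof -
  have Nr: "subring N R" by (rule subfieldE(1)[OF N])
  interpret N: field "R\<lparr>carrier := N\<rparr>" using subfield_iff(2)[OF N] .
  have ring_eq: "univ_poly (R\<lparr>carrier := N\<rparr>) N = N[X]" using univ_poly_consistent[OF Nr] by simp
  have p': "p \<in> carrier (univ_poly (R\<lparr>carrier := N\<rparr>) (carrier (R\<lparr>carrier := N\<rparr>)))" using p(1) ring_eq by simp
  show ?thesis
  proof (rule N.trivial_factors_imp_splitted[OF p'])
    fix q assume "q \<in> carrier (univ_poly (R\<lparr>carrier := N\<rparr>) (carrier (R\<lparr>carrier := N\<rparr>)))"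
      and irr: "pirreducible\<^bsub>R\<lparr>carrier := N\<rparr>\<^esub> (carrier (R\<lparr>carrier := N\<rparr>)) q"
      and dvd: "q pdivides\<^bsub>R\<lparr>carrier := N\<rparr>\<^esub> p"
    then have q': "q \<in> carrier (univ_poly (R\<lparr>carrier := N\<rparr>) (carrier (R\<lparr>carrier := N\<rparr>)))"
      and q: "q \<in> carrier (N[X])" and irr': "pirreducible N q" using ring_eq by simp_all
    have "q divides\<^bsub>N[X]\<^esub> p" using dvd ring_eq by (simp add: pdivides_def)
    then have dvdR: "q pdivides p" using pdivides_iff_shell[OF N q p(1)] by simp
    have qR: "q \<in> carrier (poly_ring R)" and pR: "p \<in> carrier (poly_ring R)"
      using carrier_polynomial_shell[OF Nr] q p(1) by auto
    have split: "splitted q" by (rule pdivides_imp_splitted[OF qR pR p(2,3) dvdR])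
    have deg: "degree q \<ge> 1" by (rule pirreducible_degree[OF N q irr'])
    then have "roots q \<noteq> {#}" using split by (auto simp: splitted_def)
    then obtain b where b: "b \<in># roots q" by auto
    have "q \<noteq> []" using deg by auto
    have root_q: "is_root q b" using b roots_mem_iff_is_root[OF qR] by simp
    have "b \<in># roots p" using pdivides_imp_roots_incl[OF qR pR p(2) dvdR] b by (rule mset_subset_eqD)
    then have "b \<in> N" using roots roots_mem_iff_is_root[OF pR] by simp
    then have "ring.is_root (R\<lparr>carrier := N\<rparr>) q b"
      using root_q eval_consistent[OF Nr] by (simp add: N.is_root_def is_root_def)
    then have "N.roots q \<noteq> {#}" using N.roots_mem_iff_is_root[OF q'] by auto
    then show "degree q \<le> 1" using N.pirreducible_roots[OF q' irr] by force
  qed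
qed

text \<open>Adjoin to \<open>K\<close> all roots of the minimal polynomials of a basis of
  \<open>F\<close>. The result \<open>N\<close> is finite over \<open>K\<close>, contains
  \<open>F\<close>, and is mapped into itself by every embedding into \<open>L\<close>, since
  embeddings permute those roots. Conjugates of elements of \<open>N\<close> are images under
  embeddings, so \<open>N\<close> is normal and minimality gives \<open>N = L\<close>.\<close>

lemma normal_closure_finite_dimension:
  assumes K: "subfield K R" and F: "subfield F R" and "K \<subseteq> F" and fin: "finite_dimension K F"
    and closure: "is_normal_closure R K F"
  shows "finite_dimension K (carrier R)"
proof -
  have normal: "normal_extension R K" using closure by (simp add: is_normal_closure_def)
  have KR: "K \<subseteq> carrier R" using subfieldE(3)[OF K] .
  obtain n where "dimension n K F" using fin by (rule finite_dimensionE')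
  then obtain Us where Us: "set Us \<subseteq> carrier R" "Span K Us = F" using exists_base[OF K] by blast
  let ?roots = "\<Union>u\<in>set Us. {x. is_root (Irr K u) x}"
  have Irr: "Irr K u \<in> carrier (K[X])" "Irr K u \<in> carrier (poly_ring R)" "set (Irr K u) \<subseteq> K"
    if "u \<in> carrier R" for u
  proof -
    show 1: "Irr K u \<in> carrier (K[X])" using IrrE(1)[OF K that normal_extensionD(1)[OF normal K that]] .
    then show "Irr K u \<in> carrier (poly_ring R)" by (rule carrier_polynomial_shell[OF subfieldE(1)[OF K]])
    show "set (Irr K u) \<subseteq> K" using 1 polynomial_incl unfolding sym[OF univ_poly_carrier] by blast
  qed
  have "finite ?roots" using finite_number_of_roots Irr(2) Us(1) by blast
  then obtain xs where xs: "set xs = ?roots" using finite_list by blast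
  have xsR: "set xs \<subseteq> carrier R" using xs by (auto simp: is_root_def)
  have alg: "(algebraic over K) x" if "x \<in> carrier R" for x using normal_extensionD(1)[OF normal K that] .
  define N where "N = finite_extension K xs"
  have N: "subfield N R" unfolding N_def using finite_extension_is_subfield[OF K xsR] alg xsR by blast
  have Nfin: "finite_dimension K N"
    unfolding N_def using finite_extension_finite_dimension(1)[OF K xsR] alg xsR by blast
  have KN: "K \<subseteq> N" unfolding N_def by (rule finite_extension_incl[OF KR xsR])
  have Nr: "subring N R" by (rule subfieldE(1)[OF N])
  note Nc = subring_closed[OF Nr KN]
  have xsN: "set xs \<subseteq> N" unfolding N_def by (rule finite_extension_mem[OF subfieldE(1)[OF K] xsR])
  have FN: "F \<subseteq> N"
  proof -
    have "set Us \<subseteq> N"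
      using normal_extensionD(3)[OF normal K] Us(1) xs xsN by blast
    then show ?thesis
      using subalgebra_Span_incl[OF K finite_dimension_imp_subalgebra[OF K Nfin]] Us(2) by blast
  qed
  have roots_N: "b \<in> N"
    if p: "p \<in> carrier (K[X])" "pirreducible K p" "is_root p a" "is_root p b" and a: "a \<in> N" for p a b
  proof -
    obtain \<chi> where \<chi>: "\<chi> \<in> embeddings R K N" "\<chi> a = b"
      using exists_embedding[OF K normal N KN Nfin a p] by blast
    note \<chi>D = linear_mapsD[OF embeddingsD(1)[OF \<chi>(1)]]
    \<comment> \<open>A subring containing \<open>K\<close> and the adjoined roots, hence all of
      \<open>N\<close>; so \<open>\<chi>\<close> maps \<open>N\<close> into
      \<open>N\<close>.\<close>
    let ?T = "{y \<in> N. \<chi> y \<in> N}"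
    have inv: "\<chi> (\<ominus> y) = \<ominus> (\<chi> y)" if "y \<in> N" for y
    proof -
      have yN: "\<ominus> y \<in> N" using subringE(5)[OF Nr that] .
      have "\<chi> (\<ominus> y) \<oplus> \<chi> y = \<zero>"
        using \<chi>D(3)[OF yN that] linear_maps_zero[OF Nr KN embeddingsD(1)[OF \<chi>(1)]] Nc(1)[OF that] by (simp add: l_neg)
      then show ?thesis using \<chi>D(1)[OF yN] \<chi>D(1)[OF that] by (metis minus_equality)
    qed
    have T: "subring ?T R"
    proof (rule subringI)
      show "\<one> \<in> ?T" using Nc embeddingsD(2)[OF \<chi>(1)] by simp
      show "\<ominus> y \<in> ?T" if "y \<in> ?T" for y using that subringE(5)[OF Nr] inv by simp
    qed (use Nc \<chi>D(3) embeddingsD(3)[OF \<chi>(1)] in auto)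
    have \<chi>K: "\<chi> k = k" if "k \<in> K" for k
      using \<chi>D(4)[OF that Nc(4)] Nc(1)[OF Nc(2)[OF that]] embeddingsD(2)[OF \<chi>(1)] by simp
    have "x \<in> ?T" if x: "x \<in> set xs" for x
    proof -
      have xN: "x \<in> N" using x xsN by blast
      obtain u where u: "u \<in> set Us" "is_root (Irr K u) x" using x xs by blast
      have uR: "u \<in> carrier R" using u(1) Us(1) by blast
      have "eval (Irr K u) (\<chi> x) = \<chi> (eval (Irr K u) x)"
        using embedding_eval[OF Nr KN \<chi>(1) xN Irr(3)[OF uR]] by simp
      then have "is_root (Irr K u) (\<chi> x)"
        using u(2) linear_maps_zero[OF Nr KN embeddingsD(1)[OF \<chi>(1)]] \<chi>D(1)[OF xN] by (simp add: is_root_def)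
      then show ?thesis using u(1) xs xsN xN by blast
    qed
    then have "set xs \<subseteq> ?T" by blast
    moreover have "K \<subseteq> ?T" using KN \<chi>K by auto
    ultimately have "N \<subseteq> ?T" unfolding N_def using finite_extension_subring_incl[OF T] by (simp add: N_def)
    then show ?thesis using a \<chi>(2) by auto
  qed
  have "normal_extension (R\<lparr>carrier := N\<rparr>) K"
    unfolding normal_extension_def
  proof (intro conjI ballI impI)
    fix x assume "x \<in> carrier (R\<lparr>carrier := N\<rparr>)"
    then have "(algebraic over K) x" using alg Nc(1) by simp
    then show "(ring.algebraic (R\<lparr>carrier := N\<rparr>) over K) x"
      using transcendental_consistent[OF Nr] by (simp add: over_def)
  next
    fix p assume "p \<in> carrier (univ_poly (R\<lparr>carrier := N\<rparr>) K)" "pirreducible\<^bsub>R\<lparr>carrier := N\<rparr>\<^esub> K p"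
      and ex: "\<exists>x. ring.is_root (R\<lparr>carrier := N\<rparr>) p x"
    then have p: "p \<in> carrier (K[X])" "pirreducible K p" using univ_poly_consistent[OF Nr] by simp_all
    obtain a where a: "a \<in> N" "is_root p a"
      using ex eval_consistent[OF Nr] Nc(1)
      by (auto simp: ring.is_root_def[OF subring_is_ring[OF Nr]] is_root_def)
    have "splitted p" using normal p a(2) unfolding normal_extension_def by blast
    moreover have "p \<in> carrier (N[X])" using p(1) KN unfolding sym[OF univ_poly_carrier] polynomial_def by auto
    moreover have "p \<noteq> []" using a(2) by (simp add: is_root_def)
    ultimately show "ring.splitted (R\<lparr>carrier := N\<rparr>) p"
      using splitted_subfield[OF N] roots_N[OF p a(2) _ a(1)] by blast
  qed
  then have "N = carrier R" using closure N FN by (simp add: is_normal_closure_def)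
  with Nfin show ?thesis by simp
qed

lemma finite_dimension_over_intermediate:
  assumes K: "subfield K R" and M: "subfield M R" and "K \<subseteq> M" and fin: "finite_dimension K (carrier R)"
  shows "finite_dimension K M" and "finite_dimension M (carrier R)"
proof -
  have MR: "M \<subseteq> carrier R" using subfieldE(3)[OF M] .
  have "subalgebra K M R"
  proof (rule subalgebra.intro)
    show "subgroup M (add_monoid R)" by (rule subring.axioms(1)[OF subfieldE(1)[OF M]])
    show "subalgebra_axioms K M R"
      by unfold_locales (use \<open>K \<subseteq> M\<close> subringE(6)[OF subfieldE(1)[OF M]] in auto)
  qed
  then show "finite_dimension K M" by (rule subalbegra_incl_imp_finite_dimension[OF K fin _ MR])
  obtain n where "dimension n K (carrier R)" using fin by (rule finite_dimensionE')
  then obtain Us where Us: "set Us \<subseteq> carrier R" "Span K Us = carrier R" using exists_base[OF K] by blast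
  have "subalgebra K (Span M Us) R"
    using Span_is_subalgebra[OF M Us(1)] \<open>K \<subseteq> M\<close> unfolding subalgebra_def subalgebra_axioms_def by blast
  then have "Span K Us \<subseteq> Span M Us"
    using subalgebra_Span_incl[OF K _ Span_base_incl[OF M Us(1)]] by blast
  then have "Span M Us = carrier R" using Us(2) Span_subgroup_props(1)[OF M Us(1)] by auto
  then show "finite_dimension M (carrier R)" using Span_finite_dimension[OF M Us(1)] by simp
qed

section \<open>The correspondence\<close>

text \<open>A map commuting with \<open>End_M(L)\<close> commutes in particular with
  \<open>L\<close>, so it is a multiplication; its multiplier lies in
  \<open>C_L(End_M(L)) = M\<close>.\<close>

lemma centralizer_End_alg:
  assumes M: "subfield M R" and KM: "K \<subseteq> M" and fin: "finite_dimension M (carrier R)"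
  shows "centralizer (End K) (carrier (End M)) = mult_ops R M"
proof
  have MR: "M \<subseteq> carrier R" using subfieldE(3)[OF M] .
  have KR: "K \<subseteq> carrier R" using KM MR by blast
  note fc = field_centralizer_End_alg[OF M KM fin]
  show "mult_ops R M \<subseteq> centralizer (End K) (carrier (End M))"
  proof
    fix f assume "f \<in> mult_ops R M"
    then obtain m where m: "m \<in> M" "f = mult_op R m" by blast
    then have "m \<in> field_centralizer R K (carrier (End M))" using fc by simp
    then show "f \<in> centralizer (End K) (carrier (End M))"
      using m mult_op_closed[OF KR] MR unfolding centralizer_def field_centralizer_def by blast
  qed
  show "centralizer (End K) (carrier (End M)) \<subseteq> mult_ops R M"
  proof
    fix f assume "f \<in> centralizer (End K) (carrier (End M))"
    then have f: "f \<in> carrier (End K)"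
      and comm: "\<And>s. s \<in> carrier (End M) \<Longrightarrow> f \<otimes>\<^bsub>End K\<^esub> s = s \<otimes>\<^bsub>End K\<^esub> f"
      unfolding centralizer_def by auto
    have f_lin: "f \<in> Lin K" using f by (simp add: End_alg_carrier)
    have f_eq: "f = mult_op R (f \<one>)"
    proof (rule linear_of_commutes_mult_ops[OF KR f])
      show "f (l \<otimes> x) = l \<otimes> f x" if "l \<in> carrier R" "x \<in> carrier R" for l x
        using commutes_mult_op_iff[OF f_lin that(1)] comm[OF mult_op_closed[OF MR that(1)]] that(2) by blast
    qed
    moreover have "f \<one> \<in> field_centralizer R K (carrier (End M))"
      unfolding field_centralizer_def using comm f_eq linear_mapsD(1)[OF f_lin one_closed] by simp
    ultimately show "f \<in> mult_ops R M" using fc by blast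
  qed
qed

text \<open>Centralizing reverses inclusions: \<open>A\<close> contains \<open>End_F(L)\<close>, so
  \<open>C_L(A)\<close> lies in \<open>C_L(End_F(L)) = F\<close>. That \<open>A\<close> is recovered
  from this field is the density theorem.\<close>

lemma intermediate_field_of_algebra:
  assumes K: "subfield K R" and F: "subfield F R" and KF: "K \<subseteq> F" and fin: "finite_dimension K (carrier R)"
    and A: "A \<in> algebras_over_containing R K F"
  shows "field_centralizer R K A \<in> intermediate_fields R F K"
    and "A = carrier (End_alg R (field_centralizer R K A))"
proof -
  let ?M = "field_centralizer R K A"
  have KR: "K \<subseteq> carrier R" using subfieldE(3)[OF K] .
  have sub: "subring A (End K)" and LA: "mult_ops R (carrier R) \<subseteq> A"
    and CF: "carrier (End F) \<subseteq> A"
    using A centralizer_mult_ops[OF KF subfieldE(3)[OF F]]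
    by (auto simp: algebras_over_containing_def algebras_over_def is_subalgebra_def)
  have subalgebra_linear: "A \<subseteq> Lin K" using subringE(1)[OF sub] by (simp add: End_alg_carrier)
  have M: "subfield ?M R" by (rule field_centralizer_subfield[OF subalgebra_linear KR])
  have KM: "K \<subseteq> ?M"
    unfolding field_centralizer_eq[OF subalgebra_linear] using KR linear_mapsD(4)[OF subsetD[OF subalgebra_linear]] by auto
  have "?M \<subseteq> field_centralizer R K (carrier (End F))"
    unfolding field_centralizer_def using CF by blast
  also have "\<dots> = F"
    by (rule field_centralizer_End_alg[OF F KF finite_dimension_over_intermediate(2)[OF K F KF fin]])
  finally show "?M \<in> intermediate_fields R F K" using M KM by (simp add: intermediate_fields_def)
  show "A = carrier (End_alg R ?M)"
    by (rule Jacobson_Bourbaki[OF KR sub LA finite_dimension_over_intermediate(2)[OF K M KM fin]])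
qed

lemma End_alg_in_algebras_over_containing:
  assumes KM: "K \<subseteq> M" and MF: "M \<subseteq> F" and F: "F \<subseteq> carrier R"
  shows "carrier (End M) \<in> algebras_over_containing R K F"
proof -
  have MR: "M \<subseteq> carrier R" and KR: "K \<subseteq> carrier R" and KF: "K \<subseteq> F" using assms by auto
  show ?thesis
    unfolding algebras_over_containing_def algebras_over_def centralizer_mult_ops[OF KF F]
    using End_alg_subalgebra[OF KR KM MR] mult_op_closed[OF MR] linear_maps_antimono[OF MF, of R "carrier R"]
    by (auto simp: End_alg_carrier)
qed

section \<open>Invariants of the Galois group and of the differential operators killing 1\<close>

lemma End_alg_Int_Gal:
  assumes KM: "K \<subseteq> M" and M: "M \<subseteq> carrier R"
  shows "carrier (End M) \<inter> Gal R K = Gal R M"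
proof
  have KR: "K \<subseteq> carrier R" using assms by blast
  show "Gal R M \<subseteq> carrier (End M) \<inter> Gal R K"
    using Gal_closed[OF M] Gal_antimono[OF KM] by blast
  show "carrier (End M) \<inter> Gal R K \<subseteq> Gal R M"
  proof
    fix g assume g: "g \<in> carrier (End M) \<inter> Gal R K"
    have "g m = m" if "m \<in> M" for m
      using linear_mapsD(4)[of g R M "carrier R" m \<one>] g that M GalD(4)[OF KR, of g]
      by (auto simp: End_alg_carrier)
    then show "g \<in> Gal R M" using g by (simp add: Gal_def)
  qed
qed

lemma End_alg_Int_diff_ops_plus:
  assumes "K \<subseteq> M" and "M \<subseteq> carrier R"
  shows "carrier (End M) \<inter> diff_ops_plus R K = diff_ops_plus R M"
  unfolding diff_ops_plus_def diff_ops_restrict[OF assms] by (auto simp: End_alg_carrier)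

text \<open>This is the splitting \<open>D = D_+ + L\<close>: subtracting multiplication by
  \<open>d(1)\<close> leaves an operator that kills 1. It carries statements about
  \<open>D_+\<close> over to \<open>D\<close>.\<close>

lemma diff_ops_plus_part:
  assumes M: "M \<subseteq> carrier R" and d: "d \<in> diff_ops R M"
  shows "Add d (mult_op R (\<ominus> (d \<one>))) \<in> diff_ops_plus R M"
proof -
  have d1: "d \<one> \<in> carrier R" using linear_mapsD(1)[OF diff_ops_linear[OF M d]] by simp
  then have "Add d (mult_op R (\<ominus> (d \<one>))) \<in> diff_ops R M"
    using d diff_ops_mult_op[OF M] by (intro diff_ops_add_map[OF M]) auto
  then show ?thesis using d1 by (simp add: diff_ops_plus_def add_map_def mult_op_def r_neg)
qed

text \<open>If every \<open>s \<in> D\<^sub>+\<close> kills \<open>x\<close>, then so does \<open>s l - s(l) \<in> D\<^sub>+\<close>, whence \<open>s(l x) = s(l) x\<close>.\<close>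

lemma common_zeros_eq_field_centralizer:
  assumes KM: "K \<subseteq> M" and M: "M \<subseteq> carrier R"
  shows "common_zeros R (diff_ops_plus R M) = field_centralizer R K (diff_ops_plus R M)"
proof -
  have lin: "s \<in> Lin M" if "s \<in> diff_ops_plus R M" for s
    using that diff_ops_linear[OF M] by (simp add: diff_ops_plus_def)
  have sub: "diff_ops_plus R M \<subseteq> Lin K"
    using lin linear_maps_antimono[OF KM] by blast
  note eq = field_centralizer_eq[OF sub]
  show ?thesis
  proof (intro equalityI subsetI)
    fix x assume x: "x \<in> field_centralizer R K (diff_ops_plus R M)"
    then have xR: "x \<in> carrier R" unfolding eq by simp
    have "s x = \<zero>" if s: "s \<in> diff_ops_plus R M" for s
    proof -
      have "s (x \<otimes> \<one>) = x \<otimes> s \<one>" using x s unfolding eq by blast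
      then show ?thesis using s xR by (simp add: diff_ops_plus_def)
    qed
    then show "x \<in> common_zeros R (diff_ops_plus R M)" using xR by (simp add: common_zeros_def)
  next
    fix x assume "x \<in> common_zeros R (diff_ops_plus R M)"
    then have xR: "x \<in> carrier R" and x: "\<And>s. s \<in> diff_ops_plus R M \<Longrightarrow> s x = \<zero>"
      by (auto simp: common_zeros_def)
    have "s (x \<otimes> l) = x \<otimes> s l" if s: "s \<in> diff_ops_plus R M" and l: "l \<in> carrier R" for s l
    proof -
      note sD = linear_mapsD(1)[OF lin[OF s]]
      let ?t = "compose (carrier R) s (mult_op R l)"
      have t: "?t \<in> diff_ops R M"
        using s diff_ops_compose[OF M _ diff_ops_mult_op[OF M l]] by (simp add: diff_ops_plus_def)
      have t1: "?t \<one> = s l" using l by (simp add: compose_eq mult_op_def)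
      have "s (l \<otimes> x) \<oplus> \<ominus> (s l) \<otimes> x = \<zero>"
        using x[OF diff_ops_plus_part[OF M t]] t1 xR l by (simp add: add_map_def compose_eq mult_op_def)
      then have "s (l \<otimes> x) \<ominus> s l \<otimes> x = \<zero>" using sD l xR by (simp add: minus_eq l_minus)
      then show ?thesis using sD l xR by (simp add: r_right_minus_eq m_comm)
    qed
    then show "x \<in> field_centralizer R K (diff_ops_plus R M)" unfolding eq using xR by simp
  qed
qed

text \<open>An \<open>x\<close> commuting with \<open>D_+\<close> commutes with
  \<open>D = D_+ + L\<close>, and an \<open>x\<close> fixed by \<open>h\<close> commutes with
  \<open>h\<close>, because \<open>h (x y) = h x (h y)\<close>. So \<open>x\<close> commutes with
  the whole skew group algebra, which is \<open>End_M(L)\<close>, and only elements of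
  \<open>M\<close> do so.\<close>

lemma intermediate_field_eq_invariants:
  assumes K: "subfield K R" and normal: "normal_extension R K" and fin: "finite_dimension K (carrier R)"
    and M: "subfield M R" and KM: "K \<subseteq> M"
  shows "M = field_centralizer R K (diff_ops_plus R M) \<inter> fixed_points (carrier R) (Gal R M)"
proof (intro equalityI subsetI)
  have MR: "M \<subseteq> carrier R" using subfieldE(3)[OF M] .
  have KR: "K \<subseteq> carrier R" using subfieldE(3)[OF K] .
  have lin: "diff_ops_plus R M \<subseteq> Lin M"
    using diff_ops_linear[OF MR] by (auto simp: diff_ops_plus_def)
  note eq = field_centralizer_eq[OF subset_trans[OF lin linear_maps_antimono[OF KM]]]
  {
    fix m assume m: "m \<in> M"
    then show "m \<in> field_centralizer R K (diff_ops_plus R M) \<inter> fixed_points (carrier R) (Gal R M)"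
      unfolding eq fixed_points_def using MR linear_mapsD(4)[OF subsetD[OF lin]] GalD(5)[OF MR] by auto
  }
  fix x assume "x \<in> field_centralizer R K (diff_ops_plus R M) \<inter> fixed_points (carrier R) (Gal R M)"
  then have xR: "x \<in> carrier R"
    and comm: "\<And>s y. \<lbrakk> s \<in> diff_ops_plus R M; y \<in> carrier R \<rbrakk> \<Longrightarrow> s (x \<otimes> y) = x \<otimes> s y"
    and fix_x: "\<And>h. h \<in> Gal R M \<Longrightarrow> h x = x"
    unfolding eq fixed_points_def by auto
  \<comment> \<open>The endomorphisms commuting with \<open>x\<close>. They are closed under sums,
    so membership of a skew sum can be checked on each summand \<open>d h\<close>.\<close>
  define A where "A = {f \<in> carrier (End K). \<forall>y\<in>carrier R. f (x \<otimes> y) = x \<otimes> f y}"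
  have D: "d (x \<otimes> y) = x \<otimes> d y" if d: "d \<in> diff_ops R M" and y: "y \<in> carrier R" for d y
  proof -
    have car: "d z \<in> carrier R" if "z \<in> carrier R" for z
      using linear_mapsD(1)[OF diff_ops_linear[OF MR d] that] .
    have "d (x \<otimes> y) \<oplus> \<ominus> (d \<one>) \<otimes> (x \<otimes> y) = x \<otimes> (d y \<oplus> \<ominus> (d \<one>) \<otimes> y)"
      using comm[OF diff_ops_plus_part[OF MR d] y] xR y by (simp add: add_map_def mult_op_def)
    also have "\<dots> = x \<otimes> d y \<oplus> \<ominus> (d \<one>) \<otimes> (x \<otimes> y)"
      using xR y car by (simp add: r_distr m_lcomm)
    finally show ?thesis using xR y car by simp
  qed
  have "f \<in> A" if "f \<in> carrier (End M)" for f
  proof -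
    have "f \<in> skew_sum (End K) (diff_ops R M) (Gal R M)"
      using that equals_skew_group_algebra_centralizer(1)[OF K normal fin KM subfieldE(1)[OF M] KM] by simp
    then obtain S d where f: "finite S" "S \<subseteq> Gal R M" "d \<in> S \<rightarrow> diff_ops R M"
        "f = skew_comb K d S"
      unfolding skew_sum_def by blast
    show ?thesis unfolding f(4)
    proof (rule finsum_closed_subset[OF KR _ _ _ f(1)])
      show "A \<subseteq> carrier (End K)" by (auto simp: A_def)
      show "\<zero>\<^bsub>End K\<^esub> \<in> A"
        using zero_map_linear[OF carrier_is_subring KR] xR
        by (simp add: A_def End_alg_carrier End_alg_ops zero_map_def)
      show "Add p q \<in> A" if "p \<in> A" "q \<in> A" for p q
      proof -
        have pq: "p \<in> Lin K" "q \<in> Lin K"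
          using that by (auto simp: A_def End_alg_carrier)
        have "Add p q (x \<otimes> y) = x \<otimes> Add p q y" if y: "y \<in> carrier R" for y
          using y xR \<open>p \<in> A\<close> \<open>q \<in> A\<close>
          by (simp add: A_def add_map_def r_distr linear_mapsD(1)[OF pq(1)] linear_mapsD(1)[OF pq(2)])
        then show ?thesis
          using add_map_linear[OF carrier_is_subring KR pq] by (simp add: A_def End_alg_carrier)
      qed
      show "d h \<otimes>\<^bsub>End K\<^esub> h \<in> A" if h: "h \<in> S" for h
      proof -
        have dh: "d h \<in> diff_ops R M" and hM: "h \<in> Gal R M" using f h by auto
        have "compose (carrier R) (d h) h \<in> Lin M"
          by (rule compose_linear[OF MR diff_ops_linear[OF MR dh] GalD(1)[OF MR hM]])
        then have "compose (carrier R) (d h) h \<in> Lin K"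
          using linear_maps_antimono[OF KM] by blast
        then show ?thesis
          using xR by (simp add: A_def End_alg_carrier End_alg_ops(1) compose_eq GalD(2,3)[OF MR hM] fix_x[OF hM] D[OF dh])
      qed
    qed
  qed
  then have "x \<in> field_centralizer R K (carrier (End M))"
    using xR field_centralizer_eq[of "carrier (End M)" K] linear_maps_antimono[OF KM, of R "carrier R"]
    by (simp add: A_def End_alg_carrier)
  then show "x \<in> M"
    using field_centralizer_End_alg[OF M KM finite_dimension_over_intermediate(2)[OF K M KM fin]] by simp
qed

end

lemma fixed_points_Int: "Y \<subseteq> Z \<Longrightarrow> fixed_points Y H = Y \<inter> fixed_points Z H"
  unfolding fixed_points_def by auto

theorem theorem1p1:
  fixes L :: "('a, 'b) ring_scheme" and K F :: "'a set"
  assumes "field L" and "subfield K L" and "subfield F L" and "K \<subseteq> F"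
    and "ring.finite_dimension L K F"
    and "is_normal_closure L K F"
  shows
    "\<comment> \<open>(1)\<close>
     (algebras_over_containing L K F =
         (\<lambda>M. centralizer (End_alg L K) (mult_ops L M)) ` intermediate_fields L F K) \<and>
     (\<forall>M\<in>intermediate_fields L F K.
         equals_skew_group_algebra L K (centralizer (End_alg L K) (mult_ops L M))
           (diff_ops L M) (Gal L M) \<and>
         equals_skew_group_algebra L K (centralizer (End_alg L K) (mult_ops L M))
           (diff_ops_comm L K M) (Gal_fixing L K M)) \<and>
     \<comment> \<open>(2)\<close>
     bij_betw (\<lambda>M. centralizer (End_alg L K) (mult_ops L M))
         (intermediate_fields L F K) (algebras_over_containing L K F) \<and>
     (\<forall>A\<in>algebras_over_containing L K F.
         (let M = the_inv_into (intermediate_fields L F K)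
                    (\<lambda>M. centralizer (End_alg L K) (mult_ops L M)) A;
              D = A \<inter> diff_ops_plus L K;
              G = A \<inter> Gal L K
          in mult_ops L M = centralizer (End_alg L K) A \<and>
             M = field_centralizer L K D \<inter> fixed_points (carrier L) G \<and>
             M = fixed_points (field_centralizer L K D) G \<and>
             M = common_zeros L D \<inter> fixed_points (carrier L) G \<and>
             M = fixed_points (common_zeros L D) G)) \<and>
     (\<forall>M\<in>intermediate_fields L F K.
         (let N = the_inv_into (intermediate_fields L F K)
                    (\<lambda>M. centralizer (End_alg L K) (mult_ops L M))
                    (skew_sum (End_alg L K) (diff_ops L M) (Gal L M))
          in N = common_zeros L (diff_ops_plus L M) \<inter> fixed_points (carrier L) (Gal L M) \<and>
             N = fixed_points (common_zeros L (diff_ops_plus L M)) (Gal L M))) \<and>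
     \<comment> \<open>(3)\<close>
     (\<forall>M\<in>intermediate_fields L F K.
         ring.finite_dimension L K M \<and>
         ring.finite_dimension L K (carrier L) \<and>
         ring.finite_dimension (End_alg L K) (mult_ops L K) (diff_ops L M) \<and>
         (ring.dim L over K) M * card (Gal L M) *
           (ring.dim (End_alg L K) over mult_ops L K) (diff_ops L M) =
         ((ring.dim L over K) (carrier L))\<^sup>2) \<and>
     (\<forall>M\<in>intermediate_fields L F K.
         ring.finite_dimension L M (carrier L) \<and>
         ring.finite_dimension (End_alg L M) (mult_ops L M) (diff_ops L M) \<and>
         card (Gal L M) * (ring.dim (End_alg L M) over mult_ops L M) (diff_ops L M) =
         ((ring.dim L over M) (carrier L))\<^sup>2)"
proof -
  interpret field L by fact
  note K = assms(2) and F = assms(3) and KF = assms(4)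
  have normal: "normal_extension L K" using assms(6) by (simp add: is_normal_closure_def)
  have fin: "finite_dimension K (carrier L)" by (rule normal_closure_finite_dimension[OF assms(2-6)])
  have FL: "F \<subseteq> carrier L" using subfieldE(3)[OF F] .
  let ?I = "intermediate_fields L F K" and ?C = "\<lambda>M. centralizer (End_alg L K) (mult_ops L M)"
  have I: "subfield M L" "K \<subseteq> M" "M \<subseteq> F" "M \<subseteq> carrier L" if "M \<in> ?I" for M
    using that FL by (auto simp: intermediate_fields_def)
  have C: "?C M = carrier (End_alg L M)" if "M \<in> ?I" for M
    by (rule centralizer_mult_ops[OF I(2,4)[OF that]])
  have fin_M: "finite_dimension K M" "finite_dimension M (carrier L)" if "M \<in> ?I" for M
    using finite_dimension_over_intermediate[OF K I(1,2)[OF that] fin] by auto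
  have skew: "equals_skew_group_algebra L K (?C M) (diff_ops L M) (Gal L M)" if "M \<in> ?I" for M
    by (rule equals_skew_group_algebra_centralizer(2)[OF K normal fin I(2)[OF that] subfieldE(1)[OF I(1)[OF that]] I(2)[OF that]])
  have img: "algebras_over_containing L K F = ?C ` ?I"
  proof (intro equalityI subsetI)
    fix A assume "A \<in> algebras_over_containing L K F"
    from intermediate_field_of_algebra[OF K F KF fin this] show "A \<in> ?C ` ?I" using C by blast
  next
    fix A assume "A \<in> ?C ` ?I"
    then show "A \<in> algebras_over_containing L K F"
      using C I End_alg_in_algebras_over_containing[OF _ _ FL] by auto
  qed
  have inj: "inj_on ?C ?I"
  proof (rule inj_on_inverseI[of _ "field_centralizer L K"])
    show "field_centralizer L K (?C M) = M" if "M \<in> ?I" for M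
      using field_centralizer_End_alg[OF I(1,2)[OF that] fin_M(2)[OF that]] C[OF that] by simp
  qed
  have inv: "the_inv_into ?I ?C (?C M) = M" if "M \<in> ?I" for M
    by (rule the_inv_into_f_f[OF inj that])
  have invariants: "M = field_centralizer L K (diff_ops_plus L M) \<inter> fixed_points (carrier L) (Gal L M)"
      "M = fixed_points (field_centralizer L K (diff_ops_plus L M)) (Gal L M)"
      "M = common_zeros L (diff_ops_plus L M) \<inter> fixed_points (carrier L) (Gal L M)"
      "M = fixed_points (common_zeros L (diff_ops_plus L M)) (Gal L M)" if M: "M \<in> ?I" for M
  proof -
    show 1: "M = field_centralizer L K (diff_ops_plus L M) \<inter> fixed_points (carrier L) (Gal L M)"
      by (rule intermediate_field_eq_invariants[OF K normal fin I(1,2)[OF M]])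
    have sub: "field_centralizer L K (diff_ops_plus L M) \<subseteq> carrier L" by (auto simp: field_centralizer_def)
    show 2: "M = fixed_points (field_centralizer L K (diff_ops_plus L M)) (Gal L M)"
      using 1 fixed_points_Int[OF sub] by simp
    show "M = common_zeros L (diff_ops_plus L M) \<inter> fixed_points (carrier L) (Gal L M)"
      "M = fixed_points (common_zeros L (diff_ops_plus L M)) (Gal L M)"
      using 1 2 common_zeros_eq_field_centralizer[OF I(2,4)[OF M]] by simp_all
  qed
  show ?thesis
  proof (intro conjI ballI)
    show "algebras_over_containing L K F = ?C ` ?I" by (rule img)
    show "bij_betw ?C ?I (algebras_over_containing L K F)" using inj img by (simp add: bij_betw_def)
  next
    fix A assume "A \<in> algebras_over_containing L K F"
    then obtain M where M: "M \<in> ?I" "A = ?C M" using img by blast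
    \<comment> \<open>For \<open>A = End_M(L)\<close> the intersections with \<open>D_+\<close> and
      with the Galois group of \<open>L/K\<close> are those of \<open>L/M\<close>, so all the
      formulas are instances of \<open>invariants\<close>.\<close>
    have A: "the_inv_into ?I ?C A = M" "A \<inter> diff_ops_plus L K = diff_ops_plus L M" "A \<inter> Gal L K = Gal L M"
      using inv[OF M(1)] C[OF M(1)] M(2) End_alg_Int_diff_ops_plus[OF I(2,4)[OF M(1)]]
        End_alg_Int_Gal[OF I(2,4)[OF M(1)]] by simp_all
    have cent: "mult_ops L M = centralizer (End_alg L K) A"
      using centralizer_End_alg[OF I(1,2)[OF M(1)] fin_M(2)[OF M(1)]] C[OF M(1)] M(2) by simp
    show "let M = the_inv_into ?I ?C A; D = A \<inter> diff_ops_plus L K; G = A \<inter> Gal L K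
          in mult_ops L M = centralizer (End_alg L K) A \<and>
             M = field_centralizer L K D \<inter> fixed_points (carrier L) G \<and>
             M = fixed_points (field_centralizer L K D) G \<and>
             M = common_zeros L D \<inter> fixed_points (carrier L) G \<and>
             M = fixed_points (common_zeros L D) G"
      unfolding Let_def A by (intro conjI cent invariants[OF M(1)])
  next
    fix M assume M: "M \<in> ?I"
    show "equals_skew_group_algebra L K (?C M) (diff_ops L M) (Gal L M)" by (rule skew[OF M])
    then show "equals_skew_group_algebra L K (?C M) (diff_ops_comm L K M) (Gal_fixing L K M)"
      using diff_ops_comm_eq[OF subfieldE(3)[OF K] I(2,4)[OF M]] Gal_fixing_eq[OF I(2)[OF M], of L] by simp
    have "skew_sum (End_alg L K) (diff_ops L M) (Gal L M) = ?C M"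
      using skew[OF M] by (simp add: equals_skew_group_algebra_def)
    then have N: "the_inv_into ?I ?C (skew_sum (End_alg L K) (diff_ops L M) (Gal L M)) = M"
      using inv[OF M] by simp
    show "let N = the_inv_into ?I ?C (skew_sum (End_alg L K) (diff_ops L M) (Gal L M))
          in N = common_zeros L (diff_ops_plus L M) \<inter> fixed_points (carrier L) (Gal L M) \<and>
             N = fixed_points (common_zeros L (diff_ops_plus L M)) (Gal L M)"
      unfolding Let_def N by (intro conjI invariants[OF M])
    show "finite_dimension K M" "finite_dimension K (carrier L)" "finite_dimension M (carrier L)"
      using fin_M[OF M] fin by auto
    have m: "dimension ((dim over K) M) K M" and d: "dimension ((dim over K) (carrier L)) K (carrier L)"
      and n: "dimension ((dim over M) (carrier L)) M (carrier L)"
      using finite_dimensionE[OF K fin_M(1)[OF M]] finite_dimensionE[OF K fin]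
        finite_dimensionE[OF I(1)[OF M] fin_M(2)[OF M]] by auto
    have tower: "(dim over K) M * (dim over M) (carrier L) = (dim over K) (carrier L)"
      by (rule dimension_is_inj[OF K telescopic_base[OF K I(1)[OF M] m n] d])
    \<comment> \<open>Yields \<open>|G| dim_K D = [L:M] [L:K]\<close>; the factor
      \<open>[M:K]\<close> and the tower law turn the right side into a square.\<close>
    note DK = dimension_diff_ops[OF K normal fin I(2,1)[OF M] K I(2)[OF M] n d]
    show "ring.finite_dimension (End_alg L K) (mult_ops L K) (diff_ops L M)" by (rule DK(1))
    show "(dim over K) M * card (Gal L M) * (ring.dim (End_alg L K) over mult_ops L K) (diff_ops L M) =
        ((dim over K) (carrier L))\<^sup>2"
      using DK(2) tower by (metis mult.assoc power2_eq_square)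
    \<comment> \<open>The same count with \<open>M\<close> as scalar field, where both degrees are
      \<open>[L:M]\<close>; normality and finiteness still refer to \<open>K\<close>.\<close>
    note DM = dimension_diff_ops[OF K normal fin I(2,1)[OF M] I(1)[OF M] subset_refl n n]
    show "ring.finite_dimension (End_alg L M) (mult_ops L M) (diff_ops L M)" by (rule DM(1))
    show "card (Gal L M) * (ring.dim (End_alg L M) over mult_ops L M) (diff_ops L M) =
        ((dim over M) (carrier L))\<^sup>2"
      using DM(2) by (simp add: power2_eq_square)
  qed
qed

end
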